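(* Let $M$ be a manifold, $\dim M\neq 0$, with two compatible Poisson structures $\{,\}_1$ and $\{,\}_2$. Let $\mathcal U\subset\mathbb R$ be an open subset and let $F_\lambda$, $\lambda\in\mathcal U$, be a family of smooth functions on $M$. Suppose that for any $\lambda\in\mathcal U$ the function $F_\lambda$ is a Casimir function for the Poisson bracket $\lambda\{,\}_1+\{,\}_2$, and that for any $m\in M$ the covector $dF_\lambda|_m\in T_m^*M$ depends continuously on $\lambda$. For $m\in M$ let $W_1(m)\subset T_m^*M$ be the vector subspace spanned by the differentials $dF_\lambda|_m$ for all $\lambda\in\mathcal U$. Suppose that (1) for one particular $m_0\in M$ one has $\dim W_1(m_0)\ge \frac{\dim M}{2}$; (2) for one particular $(\lambda_1,\lambda_2)\in\mathbb R^2$ the Poisson structure $\lambda_1\{,\}_1+\lambda_2\{,\}_2$ has at most one independent Casimir function on any open subset of $M$ near $m_0$. Then $\dim M$ is odd, and there is an open subset $U\subset M$ with $m_0$ in the closure of $U$ such that the bihamiltonian structure is homogeneous of type $(\dim M)$ on $U$.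
   Context: Everything is $C^\infty$ (an analytic version is obtained by replacing $\mathbb R$ by $\mathbb C$). A Poisson bracket on $M$ is a skew-symmetric bilinear bracket on functions satisfying the Leibniz and Jacobi identities. Two Poisson brackets $\{,\}_1,\{,\}_2$ are compatible if $\lambda_1\{,\}_1+\lambda_2\{,\}_2$ is Poisson for all $\lambda_1,\lambda_2$; a bihamiltonian structure is a manifold with a pair of compatible Poisson brackets. A function $F$ is Casimir for $\{,\}$ if $\{F,f\}=0$ for every smooth $f$. "At most $r$ independent Casimir functions on any open subset of $M$ near $m_0$" means: there is a neighbourhood $V$ of $m_0$ such that for every open $U'\subset V$, any $r+1$ Casimir functions defined on $U'$ are functionally dependent, i.e. their differentials are linearly dependent at every point of $U'$. A bracket induces on each $T_m^*M$ a skew-symmetric bilinear pairing $(\alpha,\beta)=\{f,g\}|_m$ for $\alpha=df|_m$, $\beta=dg|_m$; thus a bihamiltonian structure gives a pair of skew-symmetric pairings $(,)_1,(,)_2$ on each $T_m^*M$ (complexified, $T_m^*M\otimes\mathbb C$, if $M$ is a real manifold). A vector space with a pair of skew-symmetric pairings is decomposable if it is isomorphic to a direct sum of two nonzero such spaces. The Kronecker pair $\mathcal K_{2k-1}$, $k\ge1$, is the vector space with basis $\mathbf w_0,\dots,\mathbf w_{2k-2}$ whose only nonzero pairings (up to skew-symmetry) are $(\mathbf w_{2l},\mathbf w_{2l+1})_1=1$, $(\mathbf w_{2l+1},\mathbf w_{2l+2})_2=1$, $0\le l\le k-2$; every odd-dimensional indecomposable pair is isomorphic to some $\mathcal K_{2k-1}$.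 A bihamiltonian structure is homogeneous of type $(2k_1-1,\dots,2k_l-1)$ if for every point $m$ the pair of pairings on $T_m^*M$ decomposes into a direct sum of indecomposable blocks of dimensions $2k_1-1,\dots,2k_l-1$, i.e. is isomorphic to $\bigoplus_i\mathcal K_{2k_i-1}$. *)

theory Defs
  imports "HOL-Analysis.Analysis" "HOL-Library.Function_Algebras"
begin

section \<open>Vector spaces of functions\<close>

text \<open>Covectors and elements of abstract pairs of pairings are functions into the base field, added
  and scaled pointwise; the vector spaces below are subspaces of such function spaces.\<close>

definition pscale :: "'k::field \<Rightarrow> ('i \<Rightarrow> 'k) \<Rightarrow> ('i \<Rightarrow> 'k)" where
  "pscale c x = (\<lambda>i. c * x i)"

global_interpretation pointwise: vector_space pscale
  by unfold_locales (auto simp: pscale_def fun_eq_iff algebra_simps)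


section \<open>Smooth manifolds, smooth functions and covectors\<close>

text \<open>Smoothness on an open subset of a Euclidean space.\<close>

primrec Ck_on :: "nat \<Rightarrow> 'v::real_normed_vector set \<Rightarrow> ('v \<Rightarrow> 'w::real_normed_vector) \<Rightarrow> bool" where
  "Ck_on 0 S f \<longleftrightarrow> continuous_on S f"
| "Ck_on (Suc k) S f \<longleftrightarrow> (\<forall>x\<in>S. f differentiable at x) \<and>
     (\<forall>v. Ck_on k S (\<lambda>x. frechet_derivative f (at x) v))"

definition Cinf_on :: "'v::real_normed_vector set \<Rightarrow> ('v \<Rightarrow> 'w::real_normed_vector) \<Rightarrow> bool" where
  "Cinf_on S f \<longleftrightarrow> (\<forall>k. Ck_on k S f)"

text \<open>A manifold is a topological space \<open>X\<close> (with underlying set \<open>topspace X\<close>) together with a smooth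
  atlas modelled on a Euclidean space \<open>'e\<close>; its dimension is \<open>DIM('e)\<close>. A chart is a pair \<open>(V, \<phi>)\<close>
  of a domain and a coordinate map; \<open>\<phi>\<close> is irrelevant outside \<open>V\<close>.\<close>

type_synonym ('a, 'e) chart = "'a set \<times> ('a \<Rightarrow> 'e)"

definition smooth_manifold :: "'a topology \<Rightarrow> ('a, 'e::euclidean_space) chart set \<Rightarrow> bool" where
  "smooth_manifold X A \<longleftrightarrow>
     Hausdorff_space X \<and> second_countable X \<and>
     (\<Union>(V, \<phi>)\<in>A. V) = topspace X \<and>
     (\<forall>(V, \<phi>)\<in>A. openin X V \<and> open (\<phi> ` V) \<and>
        homeomorphic_map (subtopology X V) (top_of_set (\<phi> ` V)) \<phi>) \<and>
     (\<forall>(V, \<phi>)\<in>A. \<forall>(W, \<psi>)\<in>A. Cinf_on (\<phi> ` (V \<inter> W)) (\<psi> \<circ> inv_into V \<phi>))"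

text \<open>Real functions that are smooth on the open subset \<open>U\<close> of the manifold with atlas \<open>A\<close>.\<close>

definition smooth_funs :: "('a, 'e::euclidean_space) chart set \<Rightarrow> 'a set \<Rightarrow> ('a \<Rightarrow> real) set" where
  "smooth_funs A U = {f. \<forall>(V, \<phi>)\<in>A. Cinf_on (\<phi> ` (U \<inter> V)) (f \<circ> inv_into V \<phi>)}"

text \<open>A tangent vector at \<open>m\<close> is represented by a chart around \<open>m\<close> and a coordinate vector. A covector
  at \<open>m\<close> is the function on such representatives that it induces, extended by \<open>0\<close> to charts not
  around \<open>m\<close>.\<close>

type_synonym ('a, 'e) tangent_rep = "('a, 'e) chart \<times> 'e"

definition differential ::
  "('a, 'e::euclidean_space) chart set \<Rightarrow> ('a \<Rightarrow> real) \<Rightarrow> 'a \<Rightarrow> ('a, 'e) tangent_rep \<Rightarrow> real" where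
  "differential A f m = (\<lambda>((V, \<phi>), v).
     if (V, \<phi>) \<in> A \<and> m \<in> V then frechet_derivative (f \<circ> inv_into V \<phi>) (at (\<phi> m)) v else 0)"

definition cotangent_space :: "'a topology \<Rightarrow> ('a, 'e::euclidean_space) chart set \<Rightarrow> 'a \<Rightarrow>
    (('a, 'e) tangent_rep \<Rightarrow> real) set" where
  "cotangent_space X A m = (\<lambda>f. differential A f m) ` smooth_funs A (topspace X)"


section \<open>Poisson brackets and Casimir functions\<close>

type_synonym 'a bracket = "('a \<Rightarrow> real) \<Rightarrow> ('a \<Rightarrow> real) \<Rightarrow> ('a \<Rightarrow> real)"

text \<open>Functions on the manifold are represented by functions on the whole type, so all
  identities are required on \<open>M = topspace X\<close> only, and the second clause says that the bracket is
  well defined as an operation on functions on \<open>M\<close>. Linearity in the second argument follows from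
  linearity in the first one and skew-symmetry, and likewise for the Leibniz identity.\<close>

definition poisson_bracket ::
  "'a topology \<Rightarrow> ('a, 'e::euclidean_space) chart set \<Rightarrow> 'a bracket \<Rightarrow> bool" where
  "poisson_bracket X A B \<longleftrightarrow> (let M = topspace X; C = smooth_funs A M in
     (\<forall>f\<in>C. \<forall>g\<in>C. B f g \<in> C) \<and>
     (\<forall>f\<in>C. \<forall>f'\<in>C. \<forall>g\<in>C. \<forall>g'\<in>C. (\<forall>x\<in>M. f x = f' x) \<longrightarrow> (\<forall>x\<in>M. g x = g' x) \<longrightarrow>
        (\<forall>x\<in>M. B f g x = B f' g' x)) \<and>
     (\<forall>f\<in>C. \<forall>g\<in>C. \<forall>x\<in>M. B f g x = - B g f x) \<and>
     (\<forall>f\<in>C. \<forall>g\<in>C. \<forall>h\<in>C. \<forall>a b. \<forall>x\<in>M.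
        B (\<lambda>y. a * f y + b * g y) h x = a * B f h x + b * B g h x) \<and>
     (\<forall>f\<in>C. \<forall>g\<in>C. \<forall>h\<in>C. \<forall>x\<in>M. B f (\<lambda>y. g y * h y) x = B f g x * h x + g x * B f h x) \<and>
     (\<forall>f\<in>C. \<forall>g\<in>C. \<forall>h\<in>C. \<forall>x\<in>M. B f (B g h) x + B g (B h f) x + B h (B f g) x = 0))"

definition bracket_comb :: "real \<Rightarrow> real \<Rightarrow> 'a bracket \<Rightarrow> 'a bracket \<Rightarrow> 'a bracket" where
  "bracket_comb a b B1 B2 = (\<lambda>f g x. a * B1 f g x + b * B2 f g x)"

definition compatible_brackets ::
  "'a topology \<Rightarrow> ('a, 'e::euclidean_space) chart set \<Rightarrow> 'a bracket \<Rightarrow> 'a bracket \<Rightarrow> bool" where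
  "compatible_brackets X A B1 B2 \<longleftrightarrow> (\<forall>a b. poisson_bracket X A (bracket_comb a b B1 B2))"

definition covector_pairing ::
  "'a topology \<Rightarrow> ('a, 'e::euclidean_space) chart set \<Rightarrow> 'a bracket \<Rightarrow> 'a \<Rightarrow>
    (('a, 'e) tangent_rep \<Rightarrow> real) \<Rightarrow> (('a, 'e) tangent_rep \<Rightarrow> real) \<Rightarrow> real" where
  "covector_pairing X A B m \<alpha> \<beta> = (THE r. \<exists>f\<in>smooth_funs A (topspace X). \<exists>g\<in>smooth_funs A (topspace X).
     differential A f m = \<alpha> \<and> differential A g m = \<beta> \<and> B f g m = r)"

text \<open>The restriction of the bracket to open subsets, to be applied to functions that are only
  smooth near \<open>m\<close>.\<close>

definition local_bracket ::
  "'a topology \<Rightarrow> ('a, 'e::euclidean_space) chart set \<Rightarrow> 'a bracket \<Rightarrow> 'a bracket" where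
  "local_bracket X A B = (\<lambda>f g m. covector_pairing X A B m (differential A f m) (differential A g m))"

definition casimir_on ::
  "('a, 'e::euclidean_space) chart set \<Rightarrow> 'a set \<Rightarrow> 'a bracket \<Rightarrow> ('a \<Rightarrow> real) \<Rightarrow> bool" where
  "casimir_on A U B F \<longleftrightarrow> F \<in> smooth_funs A U \<and> (\<forall>f\<in>smooth_funs A U. \<forall>x\<in>U. B F f x = 0)"

definition functionally_dependent_on ::
  "('a, 'e::euclidean_space) chart set \<Rightarrow> 'a set \<Rightarrow> nat set \<Rightarrow> (nat \<Rightarrow> 'a \<Rightarrow> real) \<Rightarrow> bool" where
  "functionally_dependent_on A U I F \<longleftrightarrow> (\<forall>m\<in>U. \<exists>c. (\<exists>i\<in>I. c i \<noteq> 0) \<and>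
     (\<Sum>i\<in>I. pscale (c i) (differential A (F i) m)) = 0)"

definition at_most_independent_casimirs_near ::
  "'a topology \<Rightarrow> ('a, 'e::euclidean_space) chart set \<Rightarrow> 'a bracket \<Rightarrow> 'a \<Rightarrow> nat \<Rightarrow> bool" where
  "at_most_independent_casimirs_near X A B m0 r \<longleftrightarrow> (\<exists>V. openin X V \<and> m0 \<in> V \<and>
     (\<forall>U. openin X U \<longrightarrow> U \<subseteq> V \<longrightarrow>
        (\<forall>F. (\<forall>i<r + 1. casimir_on A U (local_bracket X A B) (F i)) \<longrightarrow>
           functionally_dependent_on A U {..<r + 1} F)))"


section \<open>Pairs of skew-symmetric pairings\<close>

text \<open>A complex vector space with two bilinear pairings; the pairings are irrelevant outside the
  carrier.\<close>

type_synonym 'i pairing_pair = "('i \<Rightarrow> complex) set \<times>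
  (('i \<Rightarrow> complex) \<Rightarrow> ('i \<Rightarrow> complex) \<Rightarrow> complex) \<times> (('i \<Rightarrow> complex) \<Rightarrow> ('i \<Rightarrow> complex) \<Rightarrow> complex)"

definition pair_isomorphic :: "'i pairing_pair \<Rightarrow> 'j pairing_pair \<Rightarrow> bool" where
  "pair_isomorphic P Q \<longleftrightarrow> (case (P, Q) of ((V, p1, p2), (W, q1, q2)) \<Rightarrow>
     \<exists>T. bij_betw T V W \<and>
       (\<forall>x\<in>V. \<forall>y\<in>V. T (x + y) = T x + T y) \<and> (\<forall>c. \<forall>x\<in>V. T (pscale c x) = pscale c (T x)) \<and>
       (\<forall>x\<in>V. \<forall>y\<in>V. q1 (T x) (T y) = p1 x y \<and> q2 (T x) (T y) = p2 x y))"

text \<open>\<open>\<K>\<^bsub>2k-1\<^esub>\<close>, for \<open>k \<ge> 1\<close>: the vector \<open>x\<close> stands for \<open>\<Sum>j\<le>2k-2. x j w\<^sub>j\<close>.\<close>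

definition kronecker_pair :: "nat \<Rightarrow> nat pairing_pair" where
  "kronecker_pair k =
    ({x. \<forall>j\<ge>2 * k - 1. x j = 0},
     \<lambda>x y. \<Sum>l<k - 1. x (2*l) * y (2*l + 1) - x (2*l + 1) * y (2*l),
     \<lambda>x y. \<Sum>l<k - 1. x (2*l + 1) * y (2*l + 2) - x (2*l + 2) * y (2*l + 1))"

definition direct_sum_pairs :: "'i pairing_pair list \<Rightarrow> (nat \<times> 'i) pairing_pair" where
  "direct_sum_pairs Ps =
    ({x. (\<forall>s<length Ps. (\<lambda>i. x (s, i)) \<in> fst (Ps ! s)) \<and> (\<forall>s\<ge>length Ps. \<forall>i. x (s, i) = 0)},
     \<lambda>x y. \<Sum>s<length Ps. fst (snd (Ps ! s)) (\<lambda>i. x (s, i)) (\<lambda>i. y (s, i)),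
     \<lambda>x y. \<Sum>s<length Ps. snd (snd (Ps ! s)) (\<lambda>i. x (s, i)) (\<lambda>i. y (s, i)))"

text \<open>The complexification of a real space of functions, and the complex bilinear extension of a
  pairing on it.\<close>

definition complexify_space :: "('i \<Rightarrow> real) set \<Rightarrow> ('i \<Rightarrow> complex) set" where
  "complexify_space V = {x. (\<lambda>i. Re (x i)) \<in> V \<and> (\<lambda>i. Im (x i)) \<in> V}"

definition complexify_pairing ::
  "(('i \<Rightarrow> real) \<Rightarrow> ('i \<Rightarrow> real) \<Rightarrow> real) \<Rightarrow> ('i \<Rightarrow> complex) \<Rightarrow> ('i \<Rightarrow> complex) \<Rightarrow> complex" where
  "complexify_pairing p x y =
     (let a = (\<lambda>i. Re (x i)); b = (\<lambda>i. Im (x i)); c = (\<lambda>i. Re (y i)); d = (\<lambda>i. Im (y i))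
      in Complex (p a c - p b d) (p a d + p b c))"

definition cotangent_pair ::
  "'a topology \<Rightarrow> ('a, 'e::euclidean_space) chart set \<Rightarrow> 'a bracket \<Rightarrow> 'a bracket \<Rightarrow> 'a \<Rightarrow>
    ('a, 'e) tangent_rep pairing_pair" where
  "cotangent_pair X A B1 B2 m =
     (complexify_space (cotangent_space X A m),
      complexify_pairing (covector_pairing X A B1 m),
      complexify_pairing (covector_pairing X A B2 m))"

text \<open>Homogeneity on an open subset \<open>U\<close>; the type is the list \<open>ds\<close> of the dimensions \<open>2k\<^sub>i-1\<close>.\<close>

definition homogeneous_on ::
  "'a topology \<Rightarrow> ('a, 'e::euclidean_space) chart set \<Rightarrow> 'a bracket \<Rightarrow> 'a bracket \<Rightarrow> 'a set \<Rightarrow>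
    nat list \<Rightarrow> bool" where
  "homogeneous_on X A B1 B2 U ds \<longleftrightarrow> (\<exists>ks. (\<forall>k\<in>set ks. k \<ge> 1) \<and> ds = map (\<lambda>k. 2 * k - 1) ks \<and>
     (\<forall>m\<in>U. pair_isomorphic (cotangent_pair X A B1 B2 m)
        (direct_sum_pairs (map kronecker_pair ks))))"

end

theory Submission
  imports Defs
begin

text \<open>Hadamard's lemma and bump functions turn a bracket into a bivector field in a chart around \<open>m\<^sub>0\<close>.
  If \<open>\<lambda>\<^sub>1{,}\<^sub>1 + \<lambda>\<^sub>2{,}\<^sub>2\<close> had corank at least two on an open set, its Hamiltonian distribution would be
  involutive and of constant rank near a point of maximal rank, and Frobenius' theorem would give two
  independent Casimir functions there. So the corank is at most one on a dense open set near \<open>m\<^sub>0\<close>. At such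
  points \<open>W\<^sub>1(m)\<close> is isotropic for both pairings, which forces \<open>dim M = 2k - 1\<close> and \<open>dim W\<^sub>1(m) = k\<close>. Take a
  basis of \<open>W\<^sub>1(m)\<close> of the form \<open>v\<^sub>i = dF\<close> at \<open>\<lambda> = l\<^sub>i\<close>, so that \<open>(v\<^sub>i,\<cdot>)\<^sub>2 = - l\<^sub>i (v\<^sub>i,\<cdot>)\<^sub>1\<close>. The functionals \<open>(v\<^sub>i,\<cdot>)\<^sub>1\<close> satisfy
  a single linear relation, and by continuity in \<open>\<lambda>\<close> none of its coefficients vanishes. This determines the pair of
  pairings, and polynomials with the roots \<open>l\<^sub>i\<close> produce a Kronecker basis.\<close>


section \<open>Calculus of smooth maps\<close>

text \<open>The Casimir condition concerns functions on open sets, while the algebra needs a corank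
  bound at a point. Rank is only lower semicontinuous, so the corank may jump up at
  \<open>m0\<close> itself; \<open>m0\<close> is therefore reached only as a limit of good points,
  and the bound on \<open>W_1\<close> must be carried to them. Joint continuity of the differentials
  in parameter and point is not given, so this is done with finitely many fixed parameters. Isotropy
  comes from comparing two pencil members: covectors \<open>x\<close>, \<open>y\<close> attached to
  \<open>l\<close>, \<open>m\<close> satisfy \<open>l (x,y)_1 = m (x,y)_1\<close> by skew-symmetry.
  Continuity in the parameter excludes a discontinuous family that moves in a smaller Kronecker
  block and picks up eigenvectors of Jordan blocks at isolated parameters. After normalizing the
  relation, \<open>\<Sum>i. (\<Prod>j\<noteq>i. (x - j)) v i\<close> is a polynomial kernel vector
  of \<open>x P1 + P2\<close>. With \<open>p = \<Prod>j. (x - j)\<close> the product over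
  \<open>j \<noteq> i\<close> is \<open>(p(x) - p(i)) / (x - i)\<close>, whose coefficients in
  \<open>x\<close> are the Horner polynomials of \<open>p\<close> at \<open>i\<close>; this is the
  origin of the even Kronecker vectors. All nodes are real, so the basis is real and
  complexification is a formal last step.\<close>

lemma Ck_on_cong:
  assumes "open S" "\<And>x. x \<in> S \<Longrightarrow> f x = g x" "Ck_on k S f"
  shows "Ck_on k S g"
  using assms(2,3)
proof (induction k arbitrary: f g)
  case 0
  then show ?case using continuous_on_cong[of S S f g] by simp
next
  case (Suc k)
  have d: "(g has_derivative frechet_derivative f (at x)) (at x)" if "x \<in> S" for x
    using Suc.prems that assms(1)
    by (metis Ck_on.simps(2) frechet_derivative_works has_derivative_transform_within_open)
  have e: "frechet_derivative g (at x) = frechet_derivative f (at x)" if "x \<in> S" for x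
    using frechet_derivative_at[OF d[OF that]] by simp
  show ?case
    using Suc.prems(2) d Suc.IH[of "\<lambda>x. frechet_derivative f (at x) v" "\<lambda>x. frechet_derivative g (at x) v" for v]
    by (metis Ck_on.simps(2) differentiable_def e)
qed

lemma Ck_on_SucI:
  assumes "open S" "\<And>x. x \<in> S \<Longrightarrow> (f has_derivative f' x) (at x)"
    and "\<And>v. Ck_on k S (\<lambda>x. f' x v)"
  shows "Ck_on (Suc k) S f"
proof -
  have "frechet_derivative f (at x) = f' x" if "x \<in> S" for x
    using frechet_derivative_at[OF assms(2)[OF that]] by simp
  then have "Ck_on k S (\<lambda>x. frechet_derivative f (at x) v)" for v
    by (intro Ck_on_cong[OF assms(1) _ assms(3)]) auto
  then show ?thesis using assms(2) by (auto simp: differentiable_def)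
qed

lemma Ck_on_SucD:
  assumes "Ck_on (Suc k) S f"
  shows "x \<in> S \<Longrightarrow> (f has_derivative frechet_derivative f (at x)) (at x)"
    and "Ck_on k S (\<lambda>x. frechet_derivative f (at x) v)"
  using assms by (auto simp: frechet_derivative_works[symmetric])

lemma Ck_on_pred: "Ck_on (Suc k) S f \<Longrightarrow> Ck_on k S f"
proof (induction k arbitrary: f)
  case 0
  then show ?case
    by (auto intro!: continuous_at_imp_continuous_on differentiable_imp_continuous_within)
next
  case (Suc k)
  show ?case unfolding Ck_on.simps(2)[of k]
    using Suc.prems Suc.IH[of "\<lambda>x. frechet_derivative f (at x) v" for v]
    unfolding Ck_on.simps(2)[of "Suc k"] by blast
qed

lemma Ck_on_imp_continuous_on: "Ck_on k S f \<Longrightarrow> continuous_on S f"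
  by (induction k) (auto dest: Ck_on_pred simp del: Ck_on.simps(2))

lemma Ck_on_subset: "Ck_on k S f \<Longrightarrow> T \<subseteq> S \<Longrightarrow> Ck_on k T f"
  by (induction k arbitrary: f) (auto intro: continuous_on_subset)

lemma Ck_on_local:
  assumes "\<And>x. x \<in> S \<Longrightarrow> \<exists>T. open T \<and> x \<in> T \<and> Ck_on k T f"
  shows "Ck_on k S f"
  using assms
proof (induction k arbitrary: f)
  case 0
  then show ?case
    by (metis Ck_on.simps(1) continuous_at_imp_continuous_on continuous_on_eq_continuous_at)
next
  case (Suc k)
  show ?case unfolding Ck_on.simps
  proof (intro conjI ballI allI)
    fix x assume "x \<in> S" then show "f differentiable at x" using Suc.prems by fastforce
  next
    fix v show "Ck_on k S (\<lambda>x. frechet_derivative f (at x) v)"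
      by (rule Suc.IH) (metis Ck_on.simps(2) Suc.prems)
  qed
qed

lemma Ck_on_const: "Ck_on k S (\<lambda>x. c)"
  by (induction k arbitrary: c) auto

lemma Ck_on_linear_comp:
  assumes "bounded_linear L" "open S" "Ck_on k S f"
  shows "Ck_on k S (\<lambda>x. L (f x))"
  using assms(3)
proof (induction k arbitrary: f)
  case 0
  then show ?case using assms by (auto intro: bounded_linear.continuous_on)
next
  case (Suc k)
  note s = Ck_on_SucD[OF Suc.prems]
  show ?case
    by (rule Ck_on_SucI[OF assms(2) bounded_linear.has_derivative[OF assms(1) s(1)] Suc.IH[OF s(2)]])
qed

lemma Ck_on_bounded_linear: "bounded_linear L \<Longrightarrow> open S \<Longrightarrow> Ck_on k S L"
proof (cases k)
  case 0 then show "bounded_linear L \<Longrightarrow> Ck_on k S L"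
    by (simp add: linear_continuous_on)
next
  case (Suc n) 
  assume a: "bounded_linear L" "open S"
  show "Ck_on k S L" unfolding Suc
    by (rule Ck_on_SucI[OF a(2) bounded_linear_imp_has_derivative[OF a(1)]]) (rule Ck_on_const)
qed

lemma Ck_on_add:
  assumes "open S" "Ck_on k S f" "Ck_on k S g"
  shows "Ck_on k S (\<lambda>x. f x + g x)"
  using assms(2,3)
proof (induction k arbitrary: f g)
  case 0
  then show ?case by (auto intro: continuous_on_add)
next
  case (Suc k)
  note s = Ck_on_SucD[OF Suc.prems(1)] Ck_on_SucD[OF Suc.prems(2)]
  show ?case
    by (rule Ck_on_SucI[OF assms(1) has_derivative_add[OF s(1,3)] Suc.IH[OF s(2,4)]])
qed

lemma Ck_on_sum:
  assumes "open S" "\<And>i. i \<in> I \<Longrightarrow> Ck_on k S (f i)"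
  shows "Ck_on k S (\<lambda>x. \<Sum>i\<in>I. f i x)"
  using assms(2)
  by (induction I rule: infinite_finite_induct) (auto intro: Ck_on_const Ck_on_add[OF assms(1)])

lemma (in bounded_bilinear) Ck_on:
  assumes "open S" "Ck_on k S f" "Ck_on k S g"
  shows "Ck_on k S (\<lambda>x. prod (f x) (g x))"
  using assms(2,3)
proof (induction k arbitrary: f g)
  case 0
  then show ?case by (auto intro: continuous_on)
next
  case (Suc k)
  note s = Ck_on_SucD[OF Suc.prems(1)] Ck_on_SucD[OF Suc.prems(2)]
  show ?case
    by (rule Ck_on_SucI[OF assms(1), where f' = "\<lambda>x v. prod (f x) (frechet_derivative g (at x) v) + prod (frechet_derivative f (at x) v) (g x)"])
       (auto intro!: FDERIV s Ck_on_add[OF assms(1)] Suc.IH Ck_on_pred[OF Suc.prems(1)] Ck_on_pred[OF Suc.prems(2)])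
qed

lemmas Ck_on_scaleR = bounded_bilinear.Ck_on[OF bounded_bilinear_scaleR]
  and Ck_on_mult = bounded_bilinear.Ck_on[OF bounded_bilinear_mult]
  and Ck_on_inner = bounded_bilinear.Ck_on[OF bounded_bilinear_inner]
  and Ck_on_blinfun_apply = bounded_bilinear.Ck_on[OF bounded_bilinear_blinfun_apply]
  and Ck_on_blinfun_compose = bounded_bilinear.Ck_on[OF bounded_bilinear_blinfun_compose]

lemma Ck_on_minus: "open S \<Longrightarrow> Ck_on k S f \<Longrightarrow> Ck_on k S (\<lambda>x. - f x)"
  by (rule Ck_on_linear_comp[OF bounded_linear_minus[OF bounded_linear_ident]])

lemma Ck_on_diff: "open S \<Longrightarrow> Ck_on k S f \<Longrightarrow> Ck_on k S g \<Longrightarrow> Ck_on k S (\<lambda>x. f x - g x)"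
  using Ck_on_add[of S k f "\<lambda>x. - g x"] Ck_on_minus[of S k g] by simp

lemma linear_eq_sum_Basis:
  fixes L :: "'a::euclidean_space \<Rightarrow> 'b::real_vector"
  assumes "linear L"
  shows "L v = (\<Sum>b\<in>Basis. (v \<bullet> b) *\<^sub>R L b)"
  by (metis (no_types, lifting) assms euclidean_representation linear_scale linear_sum sum.cong)

text \<open>Expanding the outer derivative over \<open>Basis\<close> writes the chain rule as a sum
  of products of scalar components of the derivative of \<open>g\<close> with directional
  derivatives of \<open>f\<close> in fixed directions. The induction runs over all \<open>f\<close>
  with \<open>g\<close> fixed and never leaves functions for operator-valued maps.\<close>

lemma Ck_on_compose:
  fixes f :: "'a::euclidean_space \<Rightarrow> 'b::real_normed_vector"
  assumes "open S" "open T" "\<And>x. x \<in> S \<Longrightarrow> g x \<in> T" "Ck_on k T f" "Ck_on k S g"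
  shows "Ck_on k S (\<lambda>x. f (g x))"
  using assms(4,5)
proof (induction k arbitrary: f)
  case 0
  then show ?case using continuous_on_compose2[of T f S g] assms(3) by auto
next
  case (Suc k)
  note s = Ck_on_SucD[OF Suc.prems(1)] Ck_on_SucD[OF Suc.prems(2)]
  show ?case
  proof (rule Ck_on_SucI[OF assms(1)])
    fix x assume x: "x \<in> S"
    have l: "linear (frechet_derivative f (at (g x)))"
      using s(1)[OF assms(3)[OF x]] has_derivative_linear by blast
    have "((\<lambda>x. f (g x)) has_derivative (\<lambda>v. frechet_derivative f (at (g x)) (frechet_derivative g (at x) v))) (at x)"
      by (rule has_derivative_compose[OF s(3)[OF x] s(1)[OF assms(3)[OF x]]])
    then show "((\<lambda>x. f (g x)) has_derivative (\<lambda>v. \<Sum>b\<in>Basis. (frechet_derivative g (at x) v \<bullet> b) *\<^sub>R frechet_derivative f (at (g x)) b)) (at x)"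
      by (subst (asm) linear_eq_sum_Basis[OF l])
  next
    fix v
    show "Ck_on k S (\<lambda>x. \<Sum>b\<in>Basis. (frechet_derivative g (at x) v \<bullet> b) *\<^sub>R frechet_derivative f (at (g x)) b)"
      by (intro Ck_on_sum Ck_on_scaleR Ck_on_inner assms(1) s Ck_on_const Suc.IH Ck_on_pred[OF Suc.prems(2)])
  qed
qed

text \<open>A product rule whose first factor is merely continuous: its increment is multiplied by
  \<open>w\<close>, which is of the order of \<open>norm (y - x)\<close>. It serves the operator
  inverse, whose differentiability is still to be shown.\<close>

lemma (in bounded_bilinear) has_derivative_prod_zero:
  assumes u: "isCont u x" and w: "(w has_derivative w') (at x)" and w0: "w x = 0"
  shows "((\<lambda>y. prod (u y) (w y)) has_derivative (\<lambda>h. prod (u x) (w' h))) (at x)"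
proof -
  obtain K where K: "K > 0" "\<And>a b. norm (prod a b) \<le> norm a * norm b * K"
    using pos_bounded by blast
  have bl: "bounded_linear w'" using w by (rule has_derivative_bounded_linear)
  then obtain L where L: "L > 0" "\<And>h. norm (w' h) \<le> norm h * L"
    using bounded_linear.pos_bounded by blast
  have 1: "((\<lambda>y. prod (u x) (w y)) has_derivative (\<lambda>h. prod (u x) (w' h))) (at x)"
    by (rule bounded_linear.has_derivative[OF bounded_linear_right w])
  have 2: "((\<lambda>y. prod (u y - u x) (w y)) has_derivative (\<lambda>h. 0)) (at x)"
    unfolding has_derivative_at_alt
  proof (intro conjI allI impI)
    fix e :: real assume e: "e > 0"
    obtain d1 where d1: "d1 > 0" "\<And>y. norm (y - x) < d1 \<Longrightarrow> norm (w y - w x - w' (y - x)) \<le> 1 * norm (y - x)"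
      using w unfolding has_derivative_at_alt by (metis zero_less_one)
    \<comment> \<open>\<open>norm (w y)\<close> is at most \<open>1 + L\<close> times the distance
      and \<open>K\<close> bounds the bilinear map, so this tolerance for \<open>u\<close> yields
      exactly \<open>e\<close>.\<close>
    define e' where "e' = e / ((1 + L) * K)"
    have e': "e' > 0" using e K L by (simp add: e'_def)
    obtain d2 where d2: "d2 > 0" "\<And>y. norm (y - x) < d2 \<Longrightarrow> norm (u y - u x) < e'"
      using u e' unfolding continuous_at_eps_delta by (metis dist_norm)
    show "\<exists>d>0. \<forall>y. norm (y - x) < d \<longrightarrow> norm (prod (u y - u x) (w y) - prod (u x - u x) (w x) - 0) \<le> e * norm (y - x)"
    proof (intro exI[of _ "min d1 d2"] conjI allI impI)
      fix y assume y: "norm (y - x) < min d1 d2"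
      have "norm (w y) \<le> norm (w y - w x - w' (y - x)) + norm (w' (y - x))"
        using w0 norm_triangle_ineq[of "w y - w x - w' (y - x)" "w' (y - x)"] by simp
      also have "\<dots> \<le> norm (y - x) * (1 + L)"
        using d1(2)[of y] L(2)[of "y - x"] y by (simp add: algebra_simps)
      finally have wy: "norm (w y) \<le> norm (y - x) * (1 + L)" .
      have "norm (prod (u y - u x) (w y)) \<le> norm (u y - u x) * norm (w y) * K" by (rule K)
      also have "\<dots> \<le> e' * (norm (y - x) * (1 + L)) * K"
        using d2(2)[of y] y wy K e' by (intro mult_right_mono mult_mono) auto
      also have "\<dots> = e * norm (y - x)"
      proof -
        have "(1 + L) * K \<noteq> 0" using K L by simp
        then show ?thesis by (simp add: e'_def)
      qed
      finally show "norm (prod (u y - u x) (w y) - prod (u x - u x) (w x) - 0) \<le> e * norm (y - x)"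
        using w0 by (simp add: zero_right)
    qed (use d1 d2 in auto)
  qed simp
  have "((\<lambda>y. prod (u y - u x) (w y) + prod (u x) (w y)) has_derivative (\<lambda>h. 0 + prod (u x) (w' h))) (at x)"
    by (rule has_derivative_add[OF 2 1])
  then show ?thesis by (simp add: diff_left)
qed

section \<open>Inversion of smooth operator-valued maps\<close>

context
  fixes S :: "'z::real_normed_vector set" and B C :: "'z \<Rightarrow> 'w::real_normed_vector \<Rightarrow>\<^sub>L 'w"
  assumes op: "open S"
    and CB: "\<And>x. x \<in> S \<Longrightarrow> C x o\<^sub>L B x = id_blinfun"
    and BC: "\<And>x. x \<in> S \<Longrightarrow> B x o\<^sub>L C x = id_blinfun"
begin

text \<open>The resolvent identity. Its inner factor \<open>B x - B y\<close> vanishes at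
  \<open>y = x\<close>, which is the shape that \<open>has_derivative_prod_zero\<close> asks
  for.\<close>

lemma blinfun_inverse_diff:
  assumes "x \<in> S" "y \<in> S"
  shows "C y = C x + (C y o\<^sub>L ((B x - B y) o\<^sub>L C x))"
proof (rule blinfun_eqI)
  fix w
  have 1: "C y (B y (C x w)) = C x w"
    by (metis CB[OF assms(2)] blinfun_apply_blinfun_compose id_blinfun.rep_eq)
  have 2: "B x (C x w) = w"
    by (metis BC[OF assms(1)] blinfun_apply_blinfun_compose id_blinfun.rep_eq)
  show "C y w = (C x + (C y o\<^sub>L ((B x - B y) o\<^sub>L C x))) w"
    using 1 2 by (simp add: blinfun.bilinear_simps)
qed

lemma isCont_blinfun_inverse:
  assumes "continuous_on S B" "x \<in> S"
  shows "isCont C x"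
proof -
  have cB: "isCont B x" using assms op continuous_on_eq_continuous_at by blast
  have "((\<lambda>y. norm (B x - B y) * norm (C x)) \<longlongrightarrow> norm (B x - B x) * norm (C x)) (at x)"
    using cB by (intro tendsto_intros) (simp add: isCont_def)
  \<comment> \<open>The threshold \<open>1/2\<close> allows the unknown \<open>norm (C y)\<close> on
    the right to be absorbed into the left, giving
    \<open>norm (C y) \<le> 2 * norm (C x)\<close>.\<close>
  then have "\<forall>\<^sub>F y in at x. norm (B x - B y) * norm (C x) < 1/2"
    by (rule order_tendstoD) simp
  moreover have "\<forall>\<^sub>F y in at x. y \<in> S" using op assms(2) eventually_at_topological by blast
  ultimately have "\<forall>\<^sub>F y in at x. norm (C y - C x) \<le> 2 * norm (C x) * (norm (B x - B y) * norm (C x))"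
  proof eventually_elim
    case (elim y)
    let ?t = "norm (B x - B y) * norm (C x)"
    have a: "norm (C y - C x) \<le> norm (C y) * ?t"
    proof -
      have "norm (C y - C x) = norm (C y o\<^sub>L ((B x - B y) o\<^sub>L C x))"
        using blinfun_inverse_diff[OF assms(2) elim(2)] by (metis add_diff_cancel_left')
      also have "\<dots> \<le> norm (C y) * norm ((B x - B y) o\<^sub>L C x)" by (rule norm_blinfun_compose)
      also have "\<dots> \<le> norm (C y) * ?t" by (intro mult_left_mono norm_blinfun_compose) auto
      finally show ?thesis .
    qed
    have "norm (C y) \<le> norm (C x) + norm (C y - C x)" by (metis norm_triangle_sub)
    also have "\<dots> \<le> norm (C x) + norm (C y) * (1/2)"
      using a elim(1) mult_left_mono[of ?t "1/2" "norm (C y)"] by simp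
    finally have "norm (C y) \<le> 2 * norm (C x)" by simp
    then show ?case using a by (smt (verit) mult_nonneg_nonneg mult_right_mono norm_ge_zero)
  qed
  moreover have "((\<lambda>y. 2 * norm (C x) * (norm (B x - B y) * norm (C x))) \<longlongrightarrow> 2 * norm (C x) * (norm (B x - B x) * norm (C x))) (at x)"
    using cB by (intro tendsto_intros) (simp add: isCont_def)
  then have "((\<lambda>y. 2 * norm (C x) * (norm (B x - B y) * norm (C x))) \<longlongrightarrow> 0) (at x)" by simp
  ultimately have "((\<lambda>y. C y - C x) \<longlongrightarrow> 0) (at x)"
    by (rule Lim_null_comparison)
  then show ?thesis unfolding isCont_def by (simp add: LIM_zero_iff)
qed

lemma has_derivative_blinfun_inverse:
  assumes "continuous_on S B" "x \<in> S" "(B has_derivative B') (at x)"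
  shows "(C has_derivative (\<lambda>h. - (C x o\<^sub>L (B' h o\<^sub>L C x)))) (at x)"
proof -
  have w: "((\<lambda>y. (B x - B y) o\<^sub>L C x) has_derivative (\<lambda>h. (0 - B' h) o\<^sub>L C x)) (at x)"
    by (intro bounded_linear.has_derivative[OF bounded_bilinear.bounded_linear_left[OF bounded_bilinear_blinfun_compose]]
        has_derivative_diff has_derivative_const assms)
  have "((\<lambda>y. C y o\<^sub>L ((B x - B y) o\<^sub>L C x)) has_derivative (\<lambda>h. C x o\<^sub>L ((0 - B' h) o\<^sub>L C x))) (at x)"
    by (rule bounded_bilinear.has_derivative_prod_zero[OF bounded_bilinear_blinfun_compose isCont_blinfun_inverse[OF assms(1,2)] w])
      (simp add: blinfun_eqI)
  then have "((\<lambda>y. C x + (C y o\<^sub>L ((B x - B y) o\<^sub>L C x))) has_derivative (\<lambda>h. 0 + (C x o\<^sub>L ((0 - B' h) o\<^sub>L C x)))) (at x)"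
    by (intro has_derivative_add has_derivative_const)
  moreover have "(\<lambda>h. 0 + (C x o\<^sub>L ((0 - B' h) o\<^sub>L C x))) = (\<lambda>h. - (C x o\<^sub>L (B' h o\<^sub>L C x)))"
    by (auto simp: fun_eq_iff blinfun.bilinear_simps intro!: blinfun_eqI)
  ultimately show ?thesis
    using has_derivative_transform_within_open[OF _ op assms(2), of "\<lambda>y. C x + (C y o\<^sub>L ((B x - B y) o\<^sub>L C x))" _ UNIV C]
      blinfun_inverse_diff[OF assms(2)] by simp
qed

text \<open>The derivative \<open>- C B' C\<close> contains no derivative of \<open>C\<close>, so a
  given order of regularity of \<open>C\<close> and \<open>B'\<close> yields one more order for
  \<open>C\<close>.\<close>

lemma Ck_on_blinfun_inverse:
  assumes "Ck_on k S B"
  shows "Ck_on k S C"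
  using assms
proof (induction k)
  case 0
  then show ?case by (auto intro: continuous_at_imp_continuous_on isCont_blinfun_inverse)
next
  case (Suc k)
  note s = Ck_on_SucD[OF Suc.prems]
  have c: "Ck_on k S C" by (rule Suc.IH[OF Ck_on_pred[OF Suc.prems]])
  show ?case
    by (rule Ck_on_SucI[OF op has_derivative_blinfun_inverse[OF Ck_on_imp_continuous_on[OF Suc.prems] _ s(1)]])
      (auto intro!: Ck_on_minus Ck_on_blinfun_compose op c s)
qed

end

lemma Cinf_on_cong: "open S \<Longrightarrow> (\<And>x. x \<in> S \<Longrightarrow> f x = g x) \<Longrightarrow> Cinf_on S f \<Longrightarrow> Cinf_on S g"
  unfolding Cinf_on_def using Ck_on_cong by blast

lemma Cinf_on_subset: "Cinf_on S f \<Longrightarrow> T \<subseteq> S \<Longrightarrow> Cinf_on T f"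
  unfolding Cinf_on_def using Ck_on_subset by blast

lemma Cinf_on_local:
  assumes "\<And>x. x \<in> S \<Longrightarrow> \<exists>T. open T \<and> x \<in> T \<and> Cinf_on T f"
  shows "Cinf_on S f"
  using assms unfolding Cinf_on_def by (metis Ck_on_local)

lemma Cinf_on_has_derivative:
  assumes "Cinf_on S f" "x \<in> S"
  shows "(f has_derivative frechet_derivative f (at x)) (at x)"
  using assms unfolding Cinf_on_def by (metis Ck_on_SucD(1))

lemma Cinf_on_derivative:
  assumes "Cinf_on S f"
  shows "Cinf_on S (\<lambda>x. frechet_derivative f (at x) v)"
  using assms unfolding Cinf_on_def by (metis Ck_on_SucD(2))

lemma Cinf_on_continuous_on: "Cinf_on S f \<Longrightarrow> continuous_on S f"
  unfolding Cinf_on_def using Ck_on_imp_continuous_on by blast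

lemma Cinf_on_const: "Cinf_on S (\<lambda>x. c)"
  by (simp add: Cinf_on_def Ck_on_const)

lemma Cinf_on_linear: "bounded_linear L \<Longrightarrow> open S \<Longrightarrow> Cinf_on S L"
  by (simp add: Cinf_on_def Ck_on_bounded_linear)

lemma Cinf_on_linear_comp: "bounded_linear L \<Longrightarrow> open S \<Longrightarrow> Cinf_on S f \<Longrightarrow> Cinf_on S (\<lambda>x. L (f x))"
  by (simp add: Cinf_on_def Ck_on_linear_comp)

lemma Cinf_on_add: "open S \<Longrightarrow> Cinf_on S f \<Longrightarrow> Cinf_on S g \<Longrightarrow> Cinf_on S (\<lambda>x. f x + g x)"
  by (simp add: Cinf_on_def Ck_on_add)

lemma Cinf_on_diff: "open S \<Longrightarrow> Cinf_on S f \<Longrightarrow> Cinf_on S g \<Longrightarrow> Cinf_on S (\<lambda>x. f x - g x)"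
  by (simp add: Cinf_on_def Ck_on_diff)

lemma Cinf_on_sum: "open S \<Longrightarrow> (\<And>i. i \<in> I \<Longrightarrow> Cinf_on S (f i)) \<Longrightarrow> Cinf_on S (\<lambda>x. \<Sum>i\<in>I. f i x)"
  by (simp add: Cinf_on_def Ck_on_sum)

lemma Cinf_on_scaleR: "open S \<Longrightarrow> Cinf_on S f \<Longrightarrow> Cinf_on S g \<Longrightarrow> Cinf_on S (\<lambda>x. f x *\<^sub>R g x)"
  by (simp add: Cinf_on_def Ck_on_scaleR)

lemma Cinf_on_mult:
  fixes f g :: "_ \<Rightarrow> real"
  shows "open S \<Longrightarrow> Cinf_on S f \<Longrightarrow> Cinf_on S g \<Longrightarrow> Cinf_on S (\<lambda>x. f x * g x)"
  by (simp add: Cinf_on_def Ck_on_mult)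

lemma Cinf_on_inner: "open S \<Longrightarrow> Cinf_on S f \<Longrightarrow> Cinf_on S g \<Longrightarrow> Cinf_on S (\<lambda>x. f x \<bullet> g x)"
  by (simp add: Cinf_on_def Ck_on_inner)

lemma Cinf_on_blinfun_apply: "open S \<Longrightarrow> Cinf_on S f \<Longrightarrow> Cinf_on S g \<Longrightarrow> Cinf_on S (\<lambda>x. blinfun_apply (f x) (g x))"
  by (simp add: Cinf_on_def Ck_on_blinfun_apply)

lemma Cinf_on_blinfun_compose: "open S \<Longrightarrow> Cinf_on S f \<Longrightarrow> Cinf_on S g \<Longrightarrow> Cinf_on S (\<lambda>x. f x o\<^sub>L g x)"
  by (simp add: Cinf_on_def Ck_on_blinfun_compose)

lemma Cinf_on_compose:
  fixes f :: "'a::euclidean_space \<Rightarrow> 'b::real_normed_vector"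
  shows "open S \<Longrightarrow> open T \<Longrightarrow> (\<And>x. x \<in> S \<Longrightarrow> g x \<in> T) \<Longrightarrow> Cinf_on T f \<Longrightarrow> Cinf_on S g \<Longrightarrow> Cinf_on S (\<lambda>x. f (g x))"
  unfolding Cinf_on_def using Ck_on_compose by blast

section \<open>Bump functions and test functions\<close>

text \<open>The family \<open>p(1/x) exp(-1/x)\<close>, extended by \<open>0\<close>, is closed
  under differentiation, so smoothness of its member with \<open>p = 1\<close> follows by one
  induction over all \<open>p\<close>.\<close>

definition exp_flat :: "real poly \<Rightarrow> real \<Rightarrow> real" where
  "exp_flat p x = (if x > 0 then poly p (1 / x) * exp (- (1 / x)) else 0)"

lemma poly_mult_exp_minus_tendsto_0: "((\<lambda>t::real. poly p t * exp (- t)) \<longlongrightarrow> 0) at_top"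
proof -
  have "((\<lambda>t. \<Sum>i\<le>degree p. coeff p i * (t ^ i / exp t)) \<longlongrightarrow> (\<Sum>i\<le>degree p. coeff p i * 0)) at_top"
    by (intro tendsto_intros tendsto_power_div_exp_0)
  moreover have "(\<Sum>i\<le>degree p. coeff p i * (t ^ i / exp t)) = poly p t * exp (- t)" for t
    by (simp add: poly_altdef exp_minus sum_distrib_right divide_inverse mult.assoc)
  ultimately show ?thesis by simp
qed

text \<open>With \<open>t = 1/x\<close> one has \<open>d/dx = - t^2 d/dt\<close>, which turns
  \<open>p(t) exp(-t)\<close> into \<open>t^2 (p - p') exp(-t)\<close>; \<open>[:0, 0, 1:]\<close>
  is the polynomial \<open>t^2\<close>.\<close>

lemma exp_flat_has_field_derivative:
  "(exp_flat p has_field_derivative exp_flat ([:0, 0, 1:] * (p - pderiv p)) x) (at x)"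
proof -
  consider "x > 0" | "x < 0" | "x = 0" by linarith
  then show ?thesis
  proof cases
    case 1
    have "((\<lambda>x. poly p (1 / x) * exp (- (1 / x))) has_field_derivative
        exp_flat ([:0, 0, 1:] * (p - pderiv p)) x) (at x)"
      using 1 by (auto intro!: derivative_eq_intros DERIV_chain2[OF poly_DERIV]
          simp: exp_flat_def field_simps power2_eq_square)
    then show ?thesis
      by (rule DERIV_cong_ev[THEN iffD1, rotated -1, OF _ refl _ refl])
        (use eventually_gt_at_top 1 in \<open>auto simp: exp_flat_def eventually_nhds intro!: exI[of _ "{0<..}"]\<close>)
  next
    case 2
    have "((\<lambda>x. 0) has_field_derivative exp_flat ([:0, 0, 1:] * (p - pderiv p)) x) (at x)"
      using 2 by (simp add: exp_flat_def)
    then show ?thesis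
      by (rule DERIV_cong_ev[THEN iffD1, rotated -1, OF _ refl _ refl])
        (use 2 in \<open>auto simp: exp_flat_def eventually_nhds intro!: exI[of _ "{..<0}"]\<close>)
  next
    case 3
    have r: "((\<lambda>h. exp_flat p h / h) \<longlongrightarrow> 0) (at_right 0)"
    proof -
      \<comment> \<open>\<open>pCons 0 p\<close> supplies the factor \<open>1/h\<close> of the
        difference quotient as a further power of \<open>t = 1/h\<close>.\<close>
      have "((\<lambda>h. poly (pCons 0 p) (inverse h) * exp (- (inverse h))) \<longlongrightarrow> 0) (at_right 0)"
        using filterlim_compose[OF poly_mult_exp_minus_tendsto_0 filterlim_inverse_at_top_right] by blast
      moreover have "\<forall>\<^sub>F h in at_right 0. poly (pCons 0 p) (inverse h) * exp (- (inverse h)) = exp_flat p h / h"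
        by (rule eventually_at_rightI[of 0 1]) (auto simp: exp_flat_def field_simps)
      ultimately show ?thesis by (rule Lim_transform_eventually)
    qed
    have l: "((\<lambda>h. exp_flat p h / h) \<longlongrightarrow> 0) (at_left 0)"
      by (rule Lim_transform_eventually[OF tendsto_const], rule eventually_at_leftI[of "-1"])
        (auto simp: exp_flat_def)
    have "((\<lambda>h. exp_flat p h / h) \<longlongrightarrow> 0) (at 0)"
      using filterlim_split_at[OF l r] by simp
    then show ?thesis using 3 by (simp add: has_field_derivative_def DERIV_def[unfolded has_field_derivative_def] exp_flat_def)
  qed
qed

lemma Ck_on_exp_flat: "Ck_on k UNIV (exp_flat p)"
proof (induction k arbitrary: p)
  case 0
  show ?case using DERIV_continuous_on[OF has_field_derivative_at_within[OF exp_flat_has_field_derivative]] by simp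
next
  case (Suc k)
  show ?case
  proof (rule Ck_on_SucI)
    show "(exp_flat p has_derivative (\<lambda>h. exp_flat ([:0, 0, 1:] * (p - pderiv p)) x * h)) (at x)" for x
      using exp_flat_has_field_derivative[of p x] unfolding has_field_derivative_def .
    show "Ck_on k UNIV (\<lambda>x. exp_flat ([:0, 0, 1:] * (p - pderiv p)) x * v)" for v
      by (intro Ck_on_mult Suc.IH Ck_on_const) auto
  qed auto
qed

lemma Cinf_exp_flat: "Cinf_on UNIV (exp_flat p)"
  by (simp add: Cinf_on_def Ck_on_exp_flat)

lemma exp_flat_one: "exp_flat 1 x = (if x > 0 then exp (- (1 / x)) else 0)"
  by (simp add: exp_flat_def)

text \<open>With \<open>s = exp_flat 1\<close> and \<open>h x = s (b\<^sup>2 - |x - p|\<^sup>2)\<close>, which is at least \<open>c > 0\<close> for \<open>|x - p| \<le> a\<close>,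
  the function \<open>s (c - h x)\<close> vanishes exactly where \<open>h \<ge> c\<close> and is the constant \<open>s c\<close> for \<open>|x - p| \<ge> b\<close>.\<close>

lemma smooth_bump_exists:
  fixes p :: "'a::euclidean_space"
  assumes "0 < a" "a < b"
  obtains \<eta> :: "'a \<Rightarrow> real" where "Cinf_on UNIV \<eta>" "\<And>x. dist p x \<le> a \<Longrightarrow> \<eta> x = 1" "\<And>x. dist p x \<ge> b \<Longrightarrow> \<eta> x = 0"
proof -
  define s where "s = exp_flat 1"
  define h where "h x = s (b\<^sup>2 - (x - p) \<bullet> (x - p))" for x :: 'a
  define c where "c = s (b\<^sup>2 - a\<^sup>2)"
  have ab: "a\<^sup>2 < b\<^sup>2" using assms by (simp add: power_strict_mono)
  have sc: "s c > 0" "c > 0" using ab by (auto simp: c_def s_def exp_flat_one)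
  have s_smooth: "Cinf_on UNIV s" unfolding s_def by (rule Cinf_exp_flat)
  have smono: "s x \<le> s y" if "x \<le> y" for x y
    using that by (auto simp: s_def exp_flat_one frac_le)
  have idC: "Cinf_on UNIV (\<lambda>x::'a. x - p)"
    by (intro Cinf_on_diff Cinf_on_linear Cinf_on_const bounded_linear_ident) auto
  have "Cinf_on UNIV h" unfolding h_def
    by (rule Cinf_on_compose[OF _ _ _ s_smooth]) (intro Cinf_on_diff Cinf_on_const Cinf_on_inner idC | simp)+
  then have sm: "Cinf_on UNIV (\<lambda>x. 1 - s (c - h x) * inverse (s c))"
    by (intro Cinf_on_diff Cinf_on_mult Cinf_on_const Cinf_on_compose[OF _ _ _ s_smooth]) auto
  show thesis
  proof (rule that[OF sm])
    fix x assume "dist p x \<le> a"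
    then have "(x - p) \<bullet> (x - p) \<le> a\<^sup>2"
      by (metis dist_commute dist_norm norm_ge_zero power2_norm_eq_inner power_mono)
    then have "c \<le> h x" unfolding c_def h_def by (intro smono) simp
    then show "1 - s (c - h x) * inverse (s c) = 1" by (simp add: s_def exp_flat_one)
  next
    fix x assume "b \<le> dist p x"
    then have "b\<^sup>2 \<le> (x - p) \<bullet> (x - p)"
      using assms by (metis dist_commute dist_norm less_eq_real_def order_less_trans power2_norm_eq_inner power_mono)
    then have "h x = 0" by (simp add: h_def s_def exp_flat_one)
    then show "1 - s (c - h x) * inverse (s c) = 0" using sc by simp
  qed
qed

text \<open>Bounded support makes every derivative bounded on the whole space. The estimates on path
  space have to be uniform in time and cannot depend on where a path runs.\<close>

definition test_fun :: "('a::euclidean_space \<Rightarrow> 'b::real_normed_vector) \<Rightarrow> bool" where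
  "test_fun g \<longleftrightarrow> Cinf_on UNIV g \<and> (\<exists>r. \<forall>x. r < norm x \<longrightarrow> g x = 0)"

lemma test_fun_Cinf: "test_fun g \<Longrightarrow> Cinf_on UNIV g"
  by (simp add: test_fun_def)

lemma test_fun_has_derivative: "test_fun g \<Longrightarrow> (g has_derivative frechet_derivative g (at x)) (at x)"
  by (rule Cinf_on_has_derivative[of UNIV]) (auto simp: test_fun_def)

lemma test_fun_derivative:
  assumes "test_fun g"
  shows "test_fun (\<lambda>x. frechet_derivative g (at x) v)"
proof -
  obtain r where r: "\<And>x. r < norm x \<Longrightarrow> g x = 0" using assms by (auto simp: test_fun_def)
  have "frechet_derivative g (at x) v = 0" if x: "r < norm x" for x
  proof -
    have "open {x::'a. r < norm x}" by (rule open_Collect_less) (auto intro: continuous_intros)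
    then have "(g has_derivative (\<lambda>_. 0)) (at x)"
      using has_derivative_transform_within_open[of "\<lambda>_. 0" "\<lambda>_. 0" x UNIV "{x. r < norm x}" g] x r by auto
    then show ?thesis by (metis frechet_derivative_at)
  qed
  then show ?thesis using assms Cinf_on_derivative unfolding test_fun_def by blast
qed

lemma test_fun_bounded:
  assumes "test_fun g"
  obtains B where "B > 0" "\<And>x. norm (g x) \<le> B"
proof -
  obtain r where r: "\<And>x. r < norm x \<Longrightarrow> g x = 0" using assms by (auto simp: test_fun_def)
  have "continuous_on (cball 0 r) g"
    using Cinf_on_continuous_on[OF test_fun_Cinf[OF assms]] continuous_on_subset by blast
  then have "bounded (g ` cball 0 r)"
    using compact_imp_bounded compact_continuous_image compact_cball by blast
  then obtain B where B: "B > 0" "\<And>x. x \<in> cball 0 r \<Longrightarrow> norm (g x) \<le> B" unfolding bounded_pos by blast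
  show thesis
  proof (rule that[OF B(1)])
    show "norm (g x) \<le> B" for x
      using B(1) B(2)[of x] r[of x] by (cases "r < norm x") auto
  qed
qed

lemma norm_sum_Basis_le:
  fixes f :: "'a::euclidean_space \<Rightarrow> 'b::real_normed_vector"
  assumes "\<And>b. b \<in> Basis \<Longrightarrow> norm (f b) \<le> B"
  shows "norm (\<Sum>b\<in>Basis. (v \<bullet> b) *\<^sub>R f b) \<le> norm v * (real DIM('a) * B)"
proof -
  have "norm (\<Sum>b\<in>Basis. (v \<bullet> b) *\<^sub>R f b) \<le> (\<Sum>b\<in>(Basis::'a set). norm v * B)"
    using assms by (intro sum_norm_le) (auto simp: Basis_le_norm intro!: mult_mono order_trans[OF norm_ge_zero assms])
  then show ?thesis by (simp add: mult.left_commute)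
qed

lemma test_fun_lipschitz:
  assumes "test_fun g"
  obtains L where "L > 0" "\<And>x y. norm (g x - g y) \<le> L * norm (x - y)"
    "\<And>x v. norm (frechet_derivative g (at x) v) \<le> L * norm v"
proof -
  have "\<exists>B. B > 0 \<and> (\<forall>x. norm (frechet_derivative g (at x) b) \<le> B)" for b
    using test_fun_bounded[OF test_fun_derivative[OF assms]] by metis
  then obtain B where B: "\<And>b. B b > 0" "\<And>b x. norm (frechet_derivative g (at x) b) \<le> B b" by metis
  define M where "M = Max (B ` Basis)"
  have M: "norm (frechet_derivative g (at x) b) \<le> M" if "b \<in> Basis" for b x
    using B(2)[of x b] that unfolding M_def by (meson Max_ge finite_Basis finite_imageI imageI order_trans)
  have Mp: "M > 0" using B(1) unfolding M_def using SOME_Basis by (subst Max_gr_iff) auto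
  let ?L = "real DIM('a) * M"
  have d: "norm (frechet_derivative g (at x) v) \<le> ?L * norm v" for x v
    using norm_sum_Basis_le[of "frechet_derivative g (at x)" M v] M
    by (subst linear_eq_sum_Basis[OF has_derivative_linear[OF test_fun_has_derivative[OF assms]]]) (auto simp: mult.commute)
  show thesis
  proof (rule that[OF _ _ d])
    show "?L > 0" using Mp by simp
    show "norm (g x - g y) \<le> ?L * norm (x - y)" for x y
      by (rule differentiable_bound[where S = UNIV and f' = "\<lambda>x. frechet_derivative g (at x)"])
        (use Mp d in \<open>auto intro!: test_fun_has_derivative[OF assms] onorm_bound\<close>)
  qed
qed

text \<open>The first derivatives are Lipschitz, and one \<open>C\<close> serves every base point.
  Pointwise differentiability would not suffice in the sup norm of paths, where the remainder must
  be small at all times simultaneously.\<close>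

lemma test_fun_quadratic_remainder:
  assumes "test_fun g"
  obtains C where "C > 0" "\<And>x h. norm (g (x + h) - g x - frechet_derivative g (at x) h) \<le> C * (norm h * norm h)"
proof -
  have "\<exists>L. L > 0 \<and> (\<forall>x y. norm (frechet_derivative g (at x) b - frechet_derivative g (at y) b) \<le> L * norm (x - y))" for b
    using test_fun_lipschitz[OF test_fun_derivative[OF assms]] by metis
  then obtain L where L: "\<And>b. L b > 0"
    "\<And>b x y. norm (frechet_derivative g (at x) b - frechet_derivative g (at y) b) \<le> L b * norm (x - y)" by metis
  define M where "M = Max (L ` Basis)"
  have LM: "L b \<le> M" if "b \<in> Basis" for b
    using that unfolding M_def by simp
  have Mp: "M > 0" using L(1) unfolding M_def using SOME_Basis by (subst Max_gr_iff) auto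
  have lin: "linear (\<lambda>v. frechet_derivative g (at x) v - frechet_derivative g (at y) v)" for x y
    by (intro linear_compose_sub has_derivative_linear[OF test_fun_has_derivative[OF assms]])
  have M: "norm (frechet_derivative g (at x) v - frechet_derivative g (at y) v) \<le> real DIM('a) * (M * norm (x - y)) * norm v" for x y v
  proof -
    have "norm (\<Sum>b\<in>Basis. (v \<bullet> b) *\<^sub>R (frechet_derivative g (at x) b - frechet_derivative g (at y) b)) \<le> norm v * (real DIM('a) * (M * norm (x - y)))"
      by (rule norm_sum_Basis_le) (meson L(2) LM mult_right_mono norm_ge_zero order_trans)
    then show ?thesis by (subst linear_eq_sum_Basis[OF lin]) (simp add: mult.commute)
  qed
  show thesis
  proof (rule that)
    show "real DIM('a) * M > 0" using Mp by simp
    fix x h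
    have "norm (g (x + h) - g x - frechet_derivative g (at x) ((x + h) - x)) \<le> norm ((x + h) - x) * (real DIM('a) * (M * norm h))"
    proof (rule differentiable_bound_linearization[where S = "closed_segment x (x + h)" and f' = "\<lambda>x. frechet_derivative g (at x)"])
      show "x + t *\<^sub>R (x + h - x) \<in> closed_segment x (x + h)" if "t \<in> {0..1}" for t
        using that by (auto simp: in_segment algebra_simps intro!: exI[of _ t])
      show "(g has_derivative frechet_derivative g (at y)) (at y within closed_segment x (x + h))" for y
        by (rule has_derivative_at_withinI[OF test_fun_has_derivative[OF assms]])
      show "onorm (frechet_derivative g (at y) - frechet_derivative g (at x)) \<le> real DIM('a) * (M * norm h)"
        if y: "y \<in> closed_segment x (x + h)" for y
      proof (rule onorm_bound)
        have "norm (y - x) \<le> norm h" using segment_bound(1)[OF y] by simp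
        then have "real DIM('a) * (M * norm (y - x)) \<le> real DIM('a) * (M * norm h)"
          using Mp by (intro mult_left_mono) auto
        then show "norm ((frechet_derivative g (at y) - frechet_derivative g (at x)) v) \<le> real DIM('a) * (M * norm h) * norm v" for v
          using order_trans[OF M[of y v x] mult_right_mono[OF _ norm_ge_zero]] by simp
        show "0 \<le> real DIM('a) * (M * norm h)" using Mp by simp
      qed
    qed auto
    then show "norm (g (x + h) - g x - frechet_derivative g (at x) h) \<le> real DIM('a) * M * (norm h * norm h)"
      by (simp add: algebra_simps)
  qed
qed

section \<open>Smooth dependence of flows and Hadamard's lemma\<close>

text \<open>Flows are studied in the Banach space of bounded continuous paths. There the flow equation is a
  contraction, and the derivative of its solution is the inverse of a smoothly varying bounded linear map.\<close>

lemma Bcontfun_apply: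
  assumes "continuous_on UNIV f" "\<And>s. norm (f s) \<le> B"
  shows "apply_bcontfun (Bcontfun f) = f"
  by (rule Bcontfun_inverse) (rule bcontfun_normI[OF assms])

text \<open>The superposition (Nemytskii) operator. \<open>Bcontfun\<close> is meaningful here only
  if \<open>g\<close> along \<open>y\<close> is bounded and continuous, which
  \<open>test_fun g\<close> ensures.\<close>

definition path_comp :: "('z::euclidean_space \<Rightarrow> 'w::real_normed_vector) \<Rightarrow> (real \<Rightarrow>\<^sub>C 'z) \<Rightarrow> (real \<Rightarrow>\<^sub>C 'w)" where
  "path_comp g y = Bcontfun (\<lambda>s. g (y s))"

lemma path_comp_apply:
  assumes "test_fun g"
  shows "path_comp g y s = g (y s)"
proof -
  obtain B where "\<And>x. norm (g x) \<le> B" using test_fun_bounded[OF assms] by metis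
  moreover have "continuous_on UNIV (\<lambda>s. g (y s))"
    by (rule continuous_on_compose2[OF Cinf_on_continuous_on[OF test_fun_Cinf[OF assms]]]) auto
  ultimately show ?thesis unfolding path_comp_def by (subst Bcontfun_apply) auto
qed

lemma apply_path_comp: "test_fun g \<Longrightarrow> apply_bcontfun (path_comp g y) = (\<lambda>s. g (y s))"
  by (rule ext) (rule path_comp_apply)

text \<open>With \<open>b\<close> a basis vector and \<open>n\<close> a partial derivative of a
  field along a path, these are the summands of the derivative of a superposition operator. Each is
  bounded bilinear in \<open>w\<close> and \<open>n\<close>, so the generic product rule
  applies.\<close>

definition path_mult :: "'z::euclidean_space \<Rightarrow> (real \<Rightarrow>\<^sub>C 'z) \<Rightarrow> (real \<Rightarrow>\<^sub>C 'w::real_normed_vector) \<Rightarrow> (real \<Rightarrow>\<^sub>C 'w)" where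
  "path_mult b w n = Bcontfun (\<lambda>s. (w s \<bullet> b) *\<^sub>R n s)"

lemma path_mult_bound:
  fixes w :: "real \<Rightarrow>\<^sub>C 'z::euclidean_space" and n :: "real \<Rightarrow>\<^sub>C 'w::real_normed_vector"
  shows "norm ((w s \<bullet> b) *\<^sub>R n s) \<le> norm w * norm n * norm b"
proof -
  have "\<bar>w s \<bullet> b\<bar> \<le> norm w * norm b"
    by (meson Cauchy_Schwarz_ineq2 mult_right_mono norm_bounded norm_ge_zero order_trans)
  then show ?thesis
    using mult_mono[of "\<bar>w s \<bullet> b\<bar>" "norm w * norm b" "norm (n s)" "norm n"] norm_bounded[of n s]
    by (simp add: ac_simps)
qed

lemma path_mult_apply: "path_mult b w n s = (w s \<bullet> b) *\<^sub>R n s"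
  unfolding path_mult_def by (subst Bcontfun_apply[OF _ path_mult_bound]) (auto intro!: continuous_intros)

lemma bounded_bilinear_path_mult:
  "bounded_bilinear (path_mult b :: (real \<Rightarrow>\<^sub>C 'z::euclidean_space) \<Rightarrow> (real \<Rightarrow>\<^sub>C 'w::real_normed_vector) \<Rightarrow> _)"
proof -
  have "norm (path_mult b w n) \<le> norm w * norm n * norm b" for w :: "real \<Rightarrow>\<^sub>C 'z" and n :: "real \<Rightarrow>\<^sub>C 'w"
    by (rule norm_bound) (simp only: path_mult_apply path_mult_bound)
  then show ?thesis
    by unfold_locales
      (auto intro!: bcontfun_eqI exI[of _ "norm b"]
        simp: path_mult_apply inner_add_left scaleR_add_left scaleR_add_right)
qed

lemma path_comp_dist:
  assumes "test_fun g" "\<And>x y. norm (g x - g y) \<le> L * norm (x - y)" "L \<ge> 0"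
  shows "norm (path_comp g y - path_comp g y') \<le> L * norm (y - y')"
proof (rule norm_bound)
  fix s
  have "norm (g (y s) - g (y' s)) \<le> L * norm (y s - y' s)" by (rule assms)
  also have "\<dots> \<le> L * norm (y - y')"
    using norm_bounded[of "y - y'" s] assms(3) by (intro mult_left_mono) auto
  finally show "norm ((path_comp g y - path_comp g y') s) \<le> L * norm (y - y')"
    by (simp add: path_comp_apply[OF assms(1)])
qed

lemma continuous_path_comp:
  assumes "test_fun g"
  shows "continuous_on UNIV (path_comp g)"
proof -
  obtain L where L: "L > 0" "\<And>x y. norm (g x - g y) \<le> L * norm (x - y)"
    using test_fun_lipschitz[OF assms] by metis
  have "L-lipschitz_on UNIV (path_comp g)"
    by (rule lipschitz_onI) (use L path_comp_dist[OF assms L(2)] in \<open>auto simp: dist_norm\<close>)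
  then show ?thesis by (rule lipschitz_on_continuous_on)
qed

definition path_comp_deriv :: "('z::euclidean_space \<Rightarrow> 'w::real_normed_vector) \<Rightarrow> (real \<Rightarrow>\<^sub>C 'z) \<Rightarrow> (real \<Rightarrow>\<^sub>C 'z) \<Rightarrow> (real \<Rightarrow>\<^sub>C 'w)" where
  "path_comp_deriv g y w = (\<Sum>b\<in>Basis. path_mult b w (path_comp (\<lambda>x. frechet_derivative g (at x) b) y))"

lemma apply_bcontfun_sum: "apply_bcontfun (\<Sum>i\<in>I. f i) s = (\<Sum>i\<in>I. apply_bcontfun (f i) s)"
  by (induction I rule: infinite_finite_induct) auto

lemma path_comp_deriv_apply:
  assumes "test_fun g"
  shows "path_comp_deriv g y w s = frechet_derivative g (at (y s)) (w s)"
  by (subst linear_eq_sum_Basis[OF has_derivative_linear[OF test_fun_has_derivative[OF assms]], of "y s"])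
    (simp add: path_comp_deriv_def apply_bcontfun_sum path_mult_apply path_comp_apply test_fun_derivative assms)

lemma bounded_linear_path_comp_deriv: "bounded_linear (path_comp_deriv g y)"
  unfolding path_comp_deriv_def[abs_def]
  by (intro bounded_linear_sum bounded_bilinear.bounded_linear_left[OF bounded_bilinear_path_mult])

lemma has_derivative_path_comp:
  assumes g: "test_fun g"
  shows "(path_comp g has_derivative path_comp_deriv g y) (at y)"
  unfolding has_derivative_at_alt
proof (intro conjI allI impI bounded_linear_path_comp_deriv)
  fix e :: real assume e: "e > 0"
  obtain C where C: "C > 0" "\<And>x h. norm (g (x + h) - g x - frechet_derivative g (at x) h) \<le> C * (norm h * norm h)"
    using test_fun_quadratic_remainder[OF g] by metis
  show "\<exists>d>0. \<forall>y'. norm (y' - y) < d \<longrightarrow> norm (path_comp g y' - path_comp g y - path_comp_deriv g y (y' - y)) \<le> e * norm (y' - y)"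
  proof (intro exI[of _ "e / C"] conjI allI impI)
    fix y' assume d: "norm (y' - y) < e / C"
    have "norm (path_comp g y' - path_comp g y - path_comp_deriv g y (y' - y)) \<le> C * (norm (y' - y) * norm (y' - y))"
    proof (rule norm_bound)
      fix s
      have "norm (g (y s + (y' s - y s)) - g (y s) - frechet_derivative g (at (y s)) (y' s - y s)) \<le> C * (norm (y' s - y s) * norm (y' s - y s))"
        by (rule C)
      also have "\<dots> \<le> C * (norm (y' - y) * norm (y' - y))"
        using norm_bounded[of "y' - y" s] C(1) by (intro mult_left_mono mult_mono) auto
      finally show "norm ((path_comp g y' - path_comp g y - path_comp_deriv g y (y' - y)) s) \<le> C * (norm (y' - y) * norm (y' - y))"
        by (simp add: path_comp_apply[OF g] path_comp_deriv_apply[OF g])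
    qed
    also have "\<dots> \<le> e * norm (y' - y)"
      using d C(1) mult_right_mono[of "C * norm (y' - y)" e "norm (y' - y)"] by (simp add: field_simps)
    finally show "norm (path_comp g y' - path_comp g y - path_comp_deriv g y (y' - y)) \<le> e * norm (y' - y)" .
  qed (use e C in auto)
qed

text \<open>The derivative of \<open>path_comp g\<close> is assembled from superposition operators
  of the partial derivatives of \<open>g\<close>, which are test functions again; hence the
  induction over all \<open>g\<close>.\<close>

lemma Ck_on_path_comp:
  fixes y :: "'a::real_normed_vector \<Rightarrow> (real \<Rightarrow>\<^sub>C 'z::euclidean_space)"
  assumes "open S" "Ck_on k S y" "test_fun g"
  shows "Ck_on k S (\<lambda>x. path_comp g (y x))"
  using assms(2,3)
proof (induction k arbitrary: g)
  case 0
  then show ?case using continuous_on_compose2[OF continuous_path_comp[of g], of S y] by auto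
next
  case (Suc k)
  note s = Ck_on_SucD[OF Suc.prems(1)]
  show ?case
  proof (rule Ck_on_SucI[OF assms(1)])
    show "((\<lambda>x. path_comp g (y x)) has_derivative (\<lambda>v. path_comp_deriv g (y x) (frechet_derivative y (at x) v))) (at x)" if "x \<in> S" for x
      by (rule has_derivative_compose[OF s(1)[OF that] has_derivative_path_comp[OF Suc.prems(2)]])
    show "Ck_on k S (\<lambda>x. path_comp_deriv g (y x) (frechet_derivative y (at x) v))" for v
      unfolding path_comp_deriv_def
      by (intro Ck_on_sum assms(1) bounded_bilinear.Ck_on[OF bounded_bilinear_path_mult] s(2)
          Suc.IH[OF Ck_on_pred[OF Suc.prems(1)]] test_fun_derivative[OF Suc.prems(2)])
  qed
qed

section \<open>Integration of paths over the unit interval\<close>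

abbreviation clip :: "real \<Rightarrow> real" where "clip s \<equiv> max 0 (min 1 s)"

text \<open>Clipping the time to \<open>[0,1]\<close> keeps the integral bounded on the whole real
  line, so integration is an operator of norm at most one from the path space to itself.\<close>

definition path_int :: "(real \<Rightarrow>\<^sub>C 'w::euclidean_space) \<Rightarrow> (real \<Rightarrow>\<^sub>C 'w)" where
  "path_int g = Bcontfun (\<lambda>s. integral {0..clip s} g)"

lemma path_integrable: "apply_bcontfun g integrable_on {a..b::real}" for g :: "real \<Rightarrow>\<^sub>C 'w::euclidean_space"
  by (intro integrable_continuous_real) auto

lemma path_int_bound: "norm (integral {0..clip s} (apply_bcontfun g)) \<le> norm g" for g :: "real \<Rightarrow>\<^sub>C 'w::euclidean_space"
proof -
  have "norm (integral {0..clip s} g) \<le> norm g * (clip s - 0)"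
    by (rule integral_bound) (auto intro: norm_bounded)
  also have "\<dots> \<le> norm g * 1" by (intro mult_left_mono) auto
  finally show ?thesis by simp
qed

lemma path_int_apply: "path_int g s = integral {0..clip s} g"
proof -
  have c: "continuous_on {0..1} (\<lambda>s. integral {0..s} g)"
    by (rule indefinite_integral_continuous_1[OF path_integrable])
  have "continuous_on UNIV (\<lambda>s. integral {0..clip s} g)"
    by (rule continuous_on_compose2[OF c]) (auto intro!: continuous_intros)
  then show ?thesis unfolding path_int_def by (subst Bcontfun_apply) (auto intro: path_int_bound)
qed

lemma bounded_linear_path_int: "bounded_linear (path_int :: (real \<Rightarrow>\<^sub>C 'w::euclidean_space) \<Rightarrow> _)"
proof (rule bounded_linear_intro[where K = 1])
  show "path_int (x + y) = path_int x + path_int y" for x y :: "real \<Rightarrow>\<^sub>C 'w"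
    by (rule bcontfun_eqI) (simp add: path_int_apply integral_add path_integrable plus_bcontfun.rep_eq)
  show "path_int (r *\<^sub>R x) = r *\<^sub>R path_int x" for r and x :: "real \<Rightarrow>\<^sub>C 'w"
    by (rule bcontfun_eqI) (simp add: path_int_apply scaleR_bcontfun.rep_eq)
  show "norm (path_int x) \<le> norm x * 1" for x :: "real \<Rightarrow>\<^sub>C 'w"
    by (rule norm_bound) (simp add: path_int_apply path_int_bound)
qed

lemma norm_path_int_le: "norm (path_int g) \<le> norm g"
  by (rule norm_bound) (simp add: path_int_apply path_int_bound)

lemma bounded_linear_const_bcontfun: "bounded_linear (const_bcontfun :: 'w::real_normed_vector \<Rightarrow> (real \<Rightarrow>\<^sub>C 'w))"
proof (rule bounded_linear_intro[where K = 1])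
  show "norm (const_bcontfun x :: real \<Rightarrow>\<^sub>C 'w) \<le> norm x * 1" for x :: 'w
    by (rule norm_bound) (simp add: const_bcontfun.rep_eq)
qed (auto intro!: bcontfun_eqI simp: const_bcontfun.rep_eq plus_bcontfun.rep_eq scaleR_bcontfun.rep_eq)

lemma bounded_linear_apply_bcontfun: "bounded_linear (\<lambda>g :: real \<Rightarrow>\<^sub>C 'w::real_normed_vector. g s)"
  by (rule bounded_linear_intro[where K = 1]) (auto simp: norm_bounded)

text \<open>The equation \<open>c + A w = w\<close> is solved by Banach's fixed point theorem. The
  estimate \<open>norm w \<le> 2 * norm (w - A w)\<close> then gives injectivity, and with it
  linearity and boundedness of the solution operator.\<close>

lemma blinfun_id_minus_inverse:
  fixes A :: "'w::{real_normed_vector, complete_space} \<Rightarrow>\<^sub>L 'w"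
  assumes A: "norm A \<le> 1 / 2"
  obtains C where "C o\<^sub>L (id_blinfun - A) = id_blinfun" "(id_blinfun - A) o\<^sub>L C = id_blinfun"
proof -
  have Aw: "norm (A w) \<le> 1 / 2 * norm w" for w
    by (metis A mult_right_mono norm_blinfun norm_ge_zero order_trans)
  have lower: "norm w \<le> 2 * norm (w - A w)" for w
    using Aw[of w] norm_triangle_sub[of w "A w"] by simp
  have "\<exists>!w. c + A w = w" for c
    by (rule banach_fix_type[of "1/2"])
      (use Aw in \<open>auto simp: dist_norm blinfun.diff_right[symmetric]\<close>)
  then obtain G where G: "\<And>c. G c - A (G c) = c" by (metis add_diff_cancel_right')
  have inj: "w = w'" if "w - A w = w' - A w'" for w w'
    using lower[of "w - w'"] that by (simp add: blinfun.diff_right algebra_simps)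
  have bl: "bounded_linear G"
  proof (rule bounded_linear_intro[where K = 2])
    show "G (x + y) = G x + G y" for x y
      by (rule inj) (simp only: blinfun.add_right add_diff_add G)
    show "G (r *\<^sub>R x) = r *\<^sub>R G x" for r x
      by (rule inj) (use G in \<open>simp add: blinfun.scaleR_right scaleR_diff_right[symmetric]\<close>)
    show "norm (G x) \<le> norm x * 2" for x using lower[of "G x"] G[of x] by simp
  qed
  have GA: "G (w - A w) = w" for w by (rule inj) (simp only: G)
  show thesis
    by (rule that[of "Blinfun G"])
      (auto intro!: blinfun_eqI simp: bounded_linear_Blinfun_apply[OF bl] blinfun.diff_left G GA)
qed


section \<open>Flow of a contracting field and its derivative\<close>

context
  fixes Z :: "'z::euclidean_space \<Rightarrow> 'z"
  assumes Z: "test_fun Z"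
    and Z_half: "\<And>x h. norm (frechet_derivative Z (at x) h) \<le> 1 / 2 * norm h"
begin

lemma flow_field_lipschitz: "norm (Z x - Z y) \<le> 1 / 2 * norm (x - y)"
proof (rule differentiable_bound[where S = UNIV and f' = "\<lambda>x. frechet_derivative Z (at x)"])
  show "onorm (frechet_derivative Z (at x)) \<le> 1 / 2" for x
    by (rule onorm_bound[OF _ Z_half]) simp
qed (auto intro: test_fun_has_derivative[OF Z])

lemma path_int_comp_dist: "norm (path_int (path_comp Z y) - path_int (path_comp Z y')) \<le> 1 / 2 * norm (y - y')"
proof -
  have "norm (path_int (path_comp Z y - path_comp Z y')) \<le> 1 / 2 * norm (y - y')"
    by (rule order_trans[OF norm_path_int_le path_comp_dist[OF Z flow_field_lipschitz]]) simp
  then show ?thesis by (simp add: bounded_linear.linear[OF bounded_linear_path_int] linear_diff)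
qed

text \<open>The inhomogeneity \<open>c\<close> is an arbitrary path although flows only use constant
  ones: the solution map is then a two-sided inverse of \<open>y - path_int (path_comp Z y)\<close>
  on a single Banach space and can be differentiated as an inverse function.\<close>

definition flow_path_from :: "(real \<Rightarrow>\<^sub>C 'z) \<Rightarrow> (real \<Rightarrow>\<^sub>C 'z)" where
  "flow_path_from c = (THE y. c + path_int (path_comp Z y) = y)"

lemma flow_path_from_ex1: "\<exists>!y. c + path_int (path_comp Z y) = y"
  by (rule banach_fix_type[of "1/2"]) (use path_int_comp_dist in \<open>auto simp: dist_norm\<close>)

lemma flow_path_from_eq: "c + path_int (path_comp Z (flow_path_from c)) = flow_path_from c"
  unfolding flow_path_from_def by (rule theI'[OF flow_path_from_ex1])

lemma flow_path_from_unique: "c + path_int (path_comp Z y) = y \<Longrightarrow> flow_path_from c = y"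
  using flow_path_from_ex1 flow_path_from_eq by blast

lemma flow_path_from_dist: "norm (flow_path_from c - flow_path_from c') \<le> 2 * norm (c - c')"
proof -
  let ?y = "flow_path_from c" and ?y' = "flow_path_from c'"
  have "?y - ?y' = (c - c') + (path_int (path_comp Z ?y) - path_int (path_comp Z ?y'))"
    using flow_path_from_eq[of c] flow_path_from_eq[of c'] by (metis add_diff_add)
  then have "norm (?y - ?y') \<le> norm (c - c') + 1 / 2 * norm (?y - ?y')"
    using path_int_comp_dist[of ?y ?y'] norm_triangle_ineq[of "c - c'" "path_int (path_comp Z ?y) - path_int (path_comp Z ?y')"] by simp
  then show ?thesis by simp
qed

text \<open>The linearized flow equation along \<open>y\<close> is \<open>w = c + flow_lin y w\<close>.\<close>

definition flow_lin :: "(real \<Rightarrow>\<^sub>C 'z) \<Rightarrow> (real \<Rightarrow>\<^sub>C 'z) \<Rightarrow>\<^sub>L (real \<Rightarrow>\<^sub>C 'z)" where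
  "flow_lin y = (\<Sum>b\<in>Basis. Blinfun path_int o\<^sub>L
     bounded_bilinear.prod_left (path_mult b) (path_comp (\<lambda>x. frechet_derivative Z (at x) b) y))"

lemma flow_lin_apply: "flow_lin y w = path_int (path_comp_deriv Z y w)"
proof -
  have "path_int (path_comp_deriv Z y w) = (\<Sum>b\<in>Basis. path_int (path_mult b w (path_comp (\<lambda>x. frechet_derivative Z (at x) b) y)))"
    unfolding path_comp_deriv_def by (rule linear_sum[OF bounded_linear.linear[OF bounded_linear_path_int]])
  then show ?thesis
    by (simp add: flow_lin_def blinfun.sum_left bounded_linear_Blinfun_apply[OF bounded_linear_path_int]
        bounded_bilinear.prod_left.rep_eq[OF bounded_bilinear_path_mult])
qed

lemma norm_flow_lin: "norm (flow_lin y) \<le> 1 / 2"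
proof (rule norm_blinfun_bound)
  fix w
  have "norm (path_comp_deriv Z y w) \<le> 1 / 2 * norm w"
  proof (rule norm_bound)
    fix s show "norm (path_comp_deriv Z y w s) \<le> 1 / 2 * norm w"
      using order_trans[OF Z_half mult_left_mono[OF norm_bounded]]
      by (simp add: path_comp_deriv_apply[OF Z])
  qed
  then show "norm (flow_lin y w) \<le> 1 / 2 * norm w"
    unfolding flow_lin_apply using norm_path_int_le order_trans by blast
qed simp

lemma Ck_on_flow_lin:
  assumes "open S" "Ck_on k S y"
  shows "Ck_on k S (\<lambda>x. flow_lin (y x))"
  unfolding flow_lin_def
  by (intro Ck_on_sum assms(1) Ck_on_blinfun_compose Ck_on_const
      Ck_on_linear_comp[OF bounded_bilinear.bounded_linear_prod_left[OF bounded_bilinear_path_mult]]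
      Ck_on_path_comp test_fun_derivative[OF Z] assms(2))

definition flow_lin_inverse :: "(real \<Rightarrow>\<^sub>C 'z) \<Rightarrow> (real \<Rightarrow>\<^sub>C 'z) \<Rightarrow>\<^sub>L (real \<Rightarrow>\<^sub>C 'z)" where
  "flow_lin_inverse y = (SOME C. C o\<^sub>L (id_blinfun - flow_lin y) = id_blinfun \<and> (id_blinfun - flow_lin y) o\<^sub>L C = id_blinfun)"

lemma flow_lin_inverse:
  "flow_lin_inverse y o\<^sub>L (id_blinfun - flow_lin y) = id_blinfun"
  "(id_blinfun - flow_lin y) o\<^sub>L flow_lin_inverse y = id_blinfun"
proof -
  have "\<exists>C. C o\<^sub>L (id_blinfun - flow_lin y) = id_blinfun \<and> (id_blinfun - flow_lin y) o\<^sub>L C = id_blinfun"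
    using blinfun_id_minus_inverse[OF norm_flow_lin] by metis
  from someI_ex[OF this] show "flow_lin_inverse y o\<^sub>L (id_blinfun - flow_lin y) = id_blinfun"
    "(id_blinfun - flow_lin y) o\<^sub>L flow_lin_inverse y = id_blinfun"
    unfolding flow_lin_inverse_def by auto
qed

lemma flow_lin_inverse_unique:
  assumes "w = c + flow_lin y w"
  shows "flow_lin_inverse y c = w"
proof -
  have "c = (id_blinfun - flow_lin y) w" using assms by (simp add: blinfun.diff_left algebra_simps)
  then have "flow_lin_inverse y c = (flow_lin_inverse y o\<^sub>L (id_blinfun - flow_lin y)) w" by simp
  then show ?thesis by (simp add: flow_lin_inverse)
qed

text \<open>The map being inverted has the derivative \<open>id_blinfun - flow_lin y\<close>,
  invertible because \<open>norm (flow_lin y) \<le> 1/2\<close>; the required continuity of the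
  inverse is its Lipschitz bound \<open>2\<close>.\<close>

lemma flow_path_from_has_derivative:
  "(flow_path_from has_derivative flow_lin_inverse (flow_path_from c)) (at c)"
proof (rule has_derivative_inverse_basic[where f = "\<lambda>y. y - path_int (path_comp Z y)" and T = UNIV])
  let ?y = "flow_path_from c"
  show "((\<lambda>y. y - path_int (path_comp Z y)) has_derivative (id_blinfun - flow_lin ?y)) (at ?y)"
    unfolding blinfun.diff_left id_blinfun.rep_eq flow_lin_apply
    by (intro has_derivative_diff has_derivative_ident bounded_linear.has_derivative[OF bounded_linear_path_int] has_derivative_path_comp Z)
  show "bounded_linear (flow_lin_inverse ?y)" by (rule blinfun.bounded_linear_right)
  show "flow_lin_inverse ?y \<circ> (id_blinfun - flow_lin ?y) = id"
    using flow_lin_inverse(1)[of ?y] by (metis blinfun_compose.rep_eq eq_id_iff id_blinfun.rep_eq)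
  have "2-lipschitz_on UNIV flow_path_from"
    by (rule lipschitz_onI) (use flow_path_from_dist in \<open>auto simp: dist_norm\<close>)
  then show "isCont flow_path_from c"
    using lipschitz_on_continuous_on continuous_on_eq_continuous_at by blast
  show "flow_path_from z - path_int (path_comp Z (flow_path_from z)) = z" for z
    using flow_path_from_eq[of z] by (simp add: algebra_simps)
qed auto

definition flow_path :: "'z \<Rightarrow> (real \<Rightarrow>\<^sub>C 'z)" where
  "flow_path z = flow_path_from (const_bcontfun z)"

lemma flow_path_has_derivative:
  "(flow_path has_derivative (\<lambda>v. flow_lin_inverse (flow_path z) (const_bcontfun v))) (at z)"
  unfolding flow_path_def[abs_def]
  by (rule has_derivative_compose[OF bounded_linear_imp_has_derivative[OF bounded_linear_const_bcontfun] flow_path_from_has_derivative])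

text \<open>Bootstrapping: the derivative of \<open>flow_path\<close> is a smooth expression in
  \<open>flow_path\<close> itself, so each order of regularity yields the next.\<close>

lemma Ck_on_flow_path: "Ck_on k UNIV flow_path"
proof (induction k)
  case 0
  show ?case using flow_path_has_derivative has_derivative_continuous
    by (fastforce intro!: continuous_at_imp_continuous_on)
next
  case (Suc k)
  have "Ck_on k UNIV (\<lambda>z. flow_lin_inverse (flow_path z))"
    by (rule Ck_on_blinfun_inverse[where B = "\<lambda>z. id_blinfun - flow_lin (flow_path z)"])
      (auto intro!: Ck_on_diff Ck_on_const Ck_on_flow_lin Suc.IH flow_lin_inverse)
  then show ?case
    by (intro Ck_on_SucI[OF open_UNIV flow_path_has_derivative] Ck_on_blinfun_apply Ck_on_const open_UNIV)
qed

lemma flow_path_dist: "norm (flow_path z s - flow_path z' s) \<le> 2 * norm (z - z')"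
proof -
  have "norm ((flow_path z - flow_path z') s) \<le> 2 * norm (const_bcontfun z - const_bcontfun z' :: real \<Rightarrow>\<^sub>C 'z)"
    unfolding flow_path_def by (rule order_trans[OF norm_bounded flow_path_from_dist])
  also have "norm (const_bcontfun z - const_bcontfun z' :: real \<Rightarrow>\<^sub>C 'z) \<le> norm (z - z')"
    by (rule norm_bound) (simp add: const_bcontfun.rep_eq)
  finally show ?thesis by simp
qed

lemma flow_path_integral: "flow_path z s = z + integral {0..clip s} (\<lambda>r. Z (flow_path z r))"
proof -
  have "flow_path z = const_bcontfun z + path_int (path_comp Z (flow_path z))"
    unfolding flow_path_def by (rule flow_path_from_eq[symmetric])
  then have "flow_path z s = (const_bcontfun z + path_int (path_comp Z (flow_path z))) s" by simp
  also have "\<dots> = z + integral {0..clip s} (\<lambda>r. Z (flow_path z r))"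
    by (simp add: const_bcontfun.rep_eq path_int_apply apply_path_comp[OF Z])
  finally show ?thesis .
qed

lemma flow_path_0: "flow_path z 0 = z"
  by (subst flow_path_integral) simp

lemma flow_path_fixed:
  assumes "Z z = 0"
  shows "flow_path z s = z"
proof -
  have "flow_path z = const_bcontfun z" unfolding flow_path_def
    by (rule flow_path_from_unique, rule bcontfun_eqI)
      (simp add: const_bcontfun.rep_eq path_int_apply apply_path_comp[OF Z] assms)
  then show ?thesis by (simp add: const_bcontfun.rep_eq)
qed

lemma flow_path_has_vector_derivative:
  assumes "s \<in> {0..1}"
  shows "(flow_path z has_vector_derivative Z (flow_path z s)) (at s within {0..1})"
proof -
  have c: "continuous_on {0..1} (\<lambda>r. Z (flow_path z r))"
    by (rule continuous_on_compose2[OF Cinf_on_continuous_on[OF test_fun_Cinf[OF Z]]]) auto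
  have "((\<lambda>u. z + integral {0..u} (\<lambda>r. Z (flow_path z r))) has_vector_derivative 0 + Z (flow_path z s)) (at s within {0..1})"
    by (intro has_vector_derivative_add has_vector_derivative_const integral_has_vector_derivative[OF c assms])
  then have "((\<lambda>u. z + integral {0..u} (\<lambda>r. Z (flow_path z r))) has_vector_derivative Z (flow_path z s)) (at s within {0..1})" by simp
  then show ?thesis
    by (rule has_vector_derivative_transform[OF assms, rotated]) (subst flow_path_integral, simp)
qed

lemma Cinf_flow_map: "Cinf_on UNIV (\<lambda>z. flow_path z s)"
  unfolding Cinf_on_def by (auto intro: Ck_on_linear_comp[OF bounded_linear_apply_bcontfun] Ck_on_flow_path)

text \<open>The derivative of the time-one map is computed from the variational equation: a solution
  \<open>c\<close> of the linearized equation carries the initial displacement \<open>c 0\<close> to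
  \<open>c 1\<close>.\<close>

lemma flow_map_derivative:
  fixes c :: "real \<Rightarrow> 'z"
  assumes c: "\<And>s. s \<in> {0..1} \<Longrightarrow>
    (c has_vector_derivative frechet_derivative Z (at (flow_path z s)) (c s)) (at s within {0..1})"
  shows "((\<lambda>z. flow_path z 1) has_derivative (\<lambda>v. flow_lin_inverse (flow_path z) (const_bcontfun v) 1)) (at z)"
    and "flow_lin_inverse (flow_path z) (const_bcontfun (c 0)) 1 = c 1"
proof -
  show "((\<lambda>z. flow_path z 1) has_derivative (\<lambda>v. flow_lin_inverse (flow_path z) (const_bcontfun v) 1)) (at z)"
    by (rule bounded_linear.has_derivative[OF bounded_linear_apply_bcontfun flow_path_has_derivative])
  have cc: "continuous_on {0..1} c"
    using continuous_on_vector_derivative[OF c] by blast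
  \<comment> \<open>Clipping extends \<open>c\<close> from \<open>[0,1]\<close> to a bounded
    continuous path. It solves the linearized integral equation, whose solutions are unique.\<close>
  define w where "w = Bcontfun (\<lambda>s. c (clip s))"
  have "bounded (c ` {0..1})"
    using compact_imp_bounded[OF compact_continuous_image[OF cc]] by simp
  then obtain B where "\<And>s. s \<in> {0..1} \<Longrightarrow> norm (c s) \<le> B" unfolding bounded_iff by blast
  moreover have "continuous_on UNIV (\<lambda>s. c (clip s))"
    by (rule continuous_on_compose2[OF cc]) (auto intro!: continuous_intros)
  ultimately have w: "apply_bcontfun w s = c (clip s)" for s
    unfolding w_def by (subst Bcontfun_apply[where B = B]) auto
  have "w = const_bcontfun (c 0) + flow_lin (flow_path z) w"
  proof (rule bcontfun_eqI)
    fix s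
    have "((\<lambda>s. frechet_derivative Z (at (flow_path z s)) (c s)) has_integral c (clip s) - c 0) {0..clip s}"
      by (rule fundamental_theorem_of_calculus)
        (auto intro!: has_vector_derivative_within_subset[OF c, of _ "{0..clip s}"])
    then have "((\<lambda>s. frechet_derivative Z (at (flow_path z s)) (w s)) has_integral c (clip s) - c 0) {0..clip s}"
      by (rule has_integral_eq[rotated]) (auto simp: w)
    then have "integral {0..clip s} (path_comp_deriv Z (flow_path z) w) = c (clip s) - c 0"
      by (simp add: integral_unique path_comp_deriv_apply[OF Z, abs_def]
          ext[of "apply_bcontfun (path_comp_deriv Z (flow_path z) w)", OF path_comp_deriv_apply[OF Z]])
    then show "w s = (const_bcontfun (c 0) + flow_lin (flow_path z) w) s"
      by (simp add: flow_lin_apply path_int_apply const_bcontfun.rep_eq w)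
  qed
  then have "flow_lin_inverse (flow_path z) (const_bcontfun (c 0)) = w"
    by (rule flow_lin_inverse_unique)
  then show "flow_lin_inverse (flow_path z) (const_bcontfun (c 0)) 1 = c 1" by (simp add: w)
qed

end

text \<open>Hadamard's lemma: the factors are the integrals of the partial derivatives along the segments from \<open>p\<close>.\<close>

lemma hadamard_factors:
  fixes f :: "'a::euclidean_space \<Rightarrow> real"
  assumes f: "test_fun f"
  obtains g where "\<And>b. Cinf_on UNIV (g b)" "\<And>x. f x = f p + (\<Sum>b\<in>Basis. ((x - p) \<bullet> b) * g b x)"
    "\<And>b. g b p = frechet_derivative f (at p) b"
proof -
  \<comment> \<open>The segment from \<open>p\<close> to \<open>x\<close> is a path that depends
    affinely on \<open>x\<close>, so the path calculus gives smooth factors without differentiation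
    under the integral sign.\<close>
  define seg where "seg x = Bcontfun (\<lambda>s. clip s *\<^sub>R x)" for x :: 'a
  have seg_bound: "norm (clip s *\<^sub>R x) \<le> norm x" for s and x :: 'a
    by (simp add: mult_left_le_one_le)
  have seg: "seg x s = clip s *\<^sub>R x" for x s
    unfolding seg_def by (subst Bcontfun_apply[OF _ seg_bound]) (auto intro!: continuous_intros)
  have bl: "bounded_linear seg"
    by (rule bounded_linear_intro[where K = 1])
      (auto intro!: bcontfun_eqI norm_bound mult_left_le_one_le simp: seg scaleR_add_right)
  define y where "y x = const_bcontfun p + seg (x - p)" for x
  have y: "y x s = p + clip s *\<^sub>R (x - p)" for x s by (simp add: y_def seg const_bcontfun.rep_eq)
  have yC: "Ck_on k UNIV y" for k unfolding y_def
    by (intro Ck_on_add Ck_on_const Ck_on_linear_comp[OF bl] Ck_on_diff Ck_on_bounded_linear bounded_linear_ident open_UNIV)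
  define g where "g b x = path_int (path_comp (\<lambda>x. frechet_derivative f (at x) b) (y x)) 1" for b x
  have gi: "g b x = integral {0..1} (\<lambda>s. frechet_derivative f (at (p + s *\<^sub>R (x - p))) b)" for b x
    unfolding g_def path_int_apply
    by (simp add: apply_path_comp[OF test_fun_derivative[OF f]] y)
       (rule integral_cong, simp)
  have gint: "(\<lambda>s. frechet_derivative f (at (p + s *\<^sub>R (x - p))) b) integrable_on {0..1}" for b x
    by (intro integrable_continuous_real
        continuous_on_compose2[OF Cinf_on_continuous_on[OF test_fun_Cinf[OF test_fun_derivative[OF f]]]] continuous_intros) auto
  show thesis
  proof (rule that)
    show "Cinf_on UNIV (g b)" for b
      unfolding Cinf_on_def g_def
      by (intro allI Ck_on_linear_comp[OF bounded_linear_apply_bcontfun] Ck_on_linear_comp[OF bounded_linear_path_int]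
          Ck_on_path_comp test_fun_derivative[OF f] yC open_UNIV)
    show "g b p = frechet_derivative f (at p) b" for b by (simp add: gi)
    fix x
    have d: "((\<lambda>s. f (p + s *\<^sub>R (x - p))) has_vector_derivative frechet_derivative f (at (p + s *\<^sub>R (x - p))) (x - p)) (at s within {0..1})" for s
    proof -
      have "((\<lambda>s. p + s *\<^sub>R (x - p)) has_derivative (\<lambda>h. h *\<^sub>R (x - p))) (at s within {0..1})"
        by (auto intro!: derivative_eq_intros)
      from has_derivative_compose[OF this test_fun_has_derivative[OF f]]
      show ?thesis unfolding has_vector_derivative_def
        by (simp add: linear_scale[OF has_derivative_linear[OF test_fun_has_derivative[OF f]]])
    qed
    have "((\<lambda>s. frechet_derivative f (at (p + s *\<^sub>R (x - p))) (x - p)) has_integral f (p + 1 *\<^sub>R (x - p)) - f (p + 0 *\<^sub>R (x - p))) {0..1}"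
      by (rule fundamental_theorem_of_calculus) (auto intro: d)
    then have "f x - f p = integral {0..1} (\<lambda>s. frechet_derivative f (at (p + s *\<^sub>R (x - p))) (x - p))"
      by (simp add: integral_unique)
    also have "\<dots> = integral {0..1} (\<lambda>s. \<Sum>b\<in>Basis. ((x - p) \<bullet> b) * frechet_derivative f (at (p + s *\<^sub>R (x - p))) b)"
      by (subst linear_eq_sum_Basis[OF has_derivative_linear[OF test_fun_has_derivative[OF f]]]) simp
    also have "\<dots> = (\<Sum>b\<in>Basis. ((x - p) \<bullet> b) * g b x)"
      by (subst integral_sum) (auto simp: gi intro!: integrable_on_mult_right gint)
    finally show "f x = f p + (\<Sum>b\<in>Basis. ((x - p) \<bullet> b) * g b x)" by simp
  qed
qed

section \<open>Frobenius' theorem for bivector fields\<close>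

lemma orthogonal_projection_exists:
  fixes K :: "'e::euclidean_space set"
  assumes "subspace K"
  obtains pr :: "'e \<Rightarrow>\<^sub>L 'e" where "\<And>x. pr x \<in> K" "\<And>x y. y \<in> K \<Longrightarrow> (x - pr x) \<bullet> y = 0"
proof -
  obtain B where B: "B \<subseteq> K" "pairwise orthogonal B" "\<And>x. x \<in> B \<Longrightarrow> norm x = 1" "independent B" "span B = K"
    using orthonormal_basis_subspace[OF assms] by metis
  have fin: "finite B" using B(4) by (rule independent_imp_finite)
  define f where "f x = (\<Sum>b\<in>B. (x \<bullet> b) *\<^sub>R b)" for x
  have "linear f" unfolding f_def
    by (rule linearI) (simp_all add: inner_add_left scaleR_add_left sum.distrib scaleR_sum_right)
  then have bl: "bounded_linear f" by (rule linear_conv_bounded_linear[THEN iffD1])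
  have 1: "f x \<in> K" for x unfolding f_def
    using B(1) by (intro subspace_sum assms subspace_scale) auto
  have 2: "(x - f x) \<bullet> b = 0" if "b \<in> B" for x b
  proof -
    have "f x \<bullet> b = (\<Sum>b'\<in>B. if b' = b then x \<bullet> b else 0)"
      unfolding f_def inner_sum_left
    proof (rule sum.cong[OF refl])
      fix b' assume b': "b' \<in> B"
      show "(x \<bullet> b') *\<^sub>R b' \<bullet> b = (if b' = b then x \<bullet> b else 0)"
        using pairwiseD[OF B(2) b' that] B(3)[OF that]
        by (auto simp: orthogonal_def norm_eq_1)
    qed
    then show ?thesis using that fin by (simp add: inner_diff_left)
  qed
  have 3: "(x - f x) \<bullet> y = 0" if y: "y \<in> K" for x y
  proof -
    have "y \<in> span B" using y B(5) by simp
    then show ?thesis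
      by (induction rule: span_induct_alt) (auto simp: inner_add_right 2)
  qed
  show thesis
    by (rule that[of "Blinfun f"]) (simp_all add: bounded_linear_Blinfun_apply[OF bl] 1 3)
qed

text \<open>\<open>L x\<close> is \<open>L p\<close> composed with
  \<open>id_blinfun - Cp (L p - L x)\<close>, where \<open>Cp\<close> inverts \<open>L p\<close>;
  the second factor is invertible once its deviation from the identity has norm at most
  \<open>1/2\<close>.\<close>

lemma blinfun_inverse_near:
  fixes L :: "'x::metric_space \<Rightarrow> 'e::euclidean_space \<Rightarrow>\<^sub>L 'e"
  assumes op: "open S" "p \<in> S" and c: "continuous_on S L" and inj: "\<And>w. L p w = 0 \<Longrightarrow> w = 0"
  obtains r C where "r > 0" "ball p r \<subseteq> S"
    "\<And>x. x \<in> ball p r \<Longrightarrow> C x o\<^sub>L L x = id_blinfun" "\<And>x. x \<in> ball p r \<Longrightarrow> L x o\<^sub>L C x = id_blinfun"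
proof -
  have "inj (L p)"
    using inj linear_injective_0[OF bounded_linear.linear[OF blinfun.bounded_linear_right]] by blast
  then obtain g where g: "linear g" "\<And>x. g (L p x) = x" "\<And>x. L p (g x) = x"
    using linear_injective_isomorphism[OF bounded_linear.linear[OF blinfun.bounded_linear_right]] by metis
  then have bl: "bounded_linear g" by (simp add: linear_conv_bounded_linear)
  define Cp where "Cp = Blinfun g"
  have Cp: "Cp o\<^sub>L L p = id_blinfun" "L p o\<^sub>L Cp = id_blinfun"
    by (auto intro!: blinfun_eqI simp: Cp_def bounded_linear_Blinfun_apply[OF bl] g)
  have "continuous_on S (\<lambda>x. norm (Cp o\<^sub>L (L p - L x)))"
    by (intro continuous_on_norm continuous_on_diff continuous_on_const c
        bounded_bilinear.continuous_on[OF bounded_bilinear_blinfun_compose])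
  then have "isCont (\<lambda>x. norm (Cp o\<^sub>L (L p - L x))) p"
    using op continuous_on_eq_continuous_at by blast
  then have "\<exists>d>0. \<forall>x. dist x p < d \<longrightarrow> dist (norm (Cp o\<^sub>L (L p - L x))) (norm (Cp o\<^sub>L (L p - L p))) < 1/2"
    unfolding continuous_at_eps_delta by (metis half_gt_zero zero_less_one)
  then obtain d where d: "d > 0" "\<And>x. dist x p < d \<Longrightarrow> norm (Cp o\<^sub>L (L p - L x)) < 1/2"
    by (auto simp: dist_real_def)
  obtain d' where d': "d' > 0" "ball p d' \<subseteq> S" using op open_contains_ball by blast
  define r where "r = min d d'"
  have ex: "\<exists>C. C o\<^sub>L L x = id_blinfun \<and> L x o\<^sub>L C = id_blinfun" if x: "x \<in> ball p r" for x
  proof -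
    let ?A = "Cp o\<^sub>L (L p - L x)"
    have "norm ?A \<le> 1/2" using d(2)[of x] x by (auto simp: r_def dist_commute)
    then obtain M where M: "M o\<^sub>L (id_blinfun - ?A) = id_blinfun" "(id_blinfun - ?A) o\<^sub>L M = id_blinfun"
      by (rule blinfun_id_minus_inverse)
    have gA: "g (L p w) = w" "L p (g w) = w" for w by (fact g)+
    have e: "(id_blinfun - ?A) w = g (L x w)" for w
      by (simp add: Cp_def bounded_linear_Blinfun_apply[OF bl] blinfun.diff_left linear_diff[OF g(1)] g)
    have "(M o\<^sub>L Cp) o\<^sub>L L x = id_blinfun"
    proof (rule blinfun_eqI)
      fix w have "M ((id_blinfun - ?A) w) = w" using M(1) by (metis blinfun_apply_blinfun_compose id_blinfun.rep_eq)
      then show "((M o\<^sub>L Cp) o\<^sub>L L x) w = id_blinfun w"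
        by (simp add: e) (simp add: Cp_def bounded_linear_Blinfun_apply[OF bl])
    qed
    moreover have "L x o\<^sub>L (M o\<^sub>L Cp) = id_blinfun"
    proof (rule blinfun_eqI)
      fix w have "(id_blinfun - ?A) (M (g w)) = g w" using M(2) by (metis blinfun_apply_blinfun_compose id_blinfun.rep_eq)
      then have "g (L x (M (g w))) = g w" by (simp only: e)
      then have "L x (M (g w)) = w" by (metis g(3))
      then show "(L x o\<^sub>L (M o\<^sub>L Cp)) w = id_blinfun w"
        by (simp add: Cp_def bounded_linear_Blinfun_apply[OF bl])
    qed
    ultimately show ?thesis by blast
  qed
  then obtain C where C: "\<And>x. x \<in> ball p r \<Longrightarrow> C x o\<^sub>L L x = id_blinfun \<and> L x o\<^sub>L C x = id_blinfun" by metis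
  show thesis by (rule that[of r C]) (use d d' C in \<open>auto simp: r_def\<close>)
qed

text \<open>For \<open>v\<close> in \<open>range (Q p)\<close>, the field \<open>\<lambda>x. Y x v\<close> is the unique section of the distribution \<open>range (Q x)\<close> whose
  projection to \<open>range (Q p)\<close> is \<open>v\<close>; uniqueness makes these fields commute.\<close>

lemma commuting_frame:
  fixes Q :: "'e::euclidean_space \<Rightarrow> 'e \<Rightarrow>\<^sub>L 'e"
  assumes S: "open S" "p \<in> S" and Q: "Cinf_on S Q"
    and skew: "\<And>x a b. x \<in> S \<Longrightarrow> Q x a \<bullet> b = - (a \<bullet> Q x b)"
    and rank: "\<And>x. x \<in> S \<Longrightarrow> dim (range (Q x)) = dim (range (Q p))"
    and invol: "\<And>x a b. x \<in> S \<Longrightarrow>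
      frechet_derivative Q (at x) (Q x a) b - frechet_derivative Q (at x) (Q x b) a \<in> range (Q x)"
  obtains pr :: "'e \<Rightarrow>\<^sub>L 'e" and Y :: "'e \<Rightarrow> 'e \<Rightarrow>\<^sub>L 'e" and r where "r > 0" "ball p r \<subseteq> S" "Cinf_on (ball p r) Y"
    "\<And>h. (\<And>a. h \<bullet> Q p a = 0) \<Longrightarrow> pr h = 0"
    "\<And>x w. x \<in> ball p r \<Longrightarrow> pr (Y x w) = pr w"
    "\<And>x w. x \<in> ball p r \<Longrightarrow> Y x (pr w) = Y x w"
    "\<And>x a. x \<in> ball p r \<Longrightarrow> Q x a = Y x (Q x a)"
    "\<And>x v w. x \<in> ball p r \<Longrightarrow> frechet_derivative Y (at x) (Y x v) w = frechet_derivative Y (at x) (Y x w) v"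
proof -
  define K where "K = range (Q p)"
  have lin: "linear (blinfun_apply A)" for A :: "'e \<Rightarrow>\<^sub>L 'e"
    by (rule bounded_linear.linear[OF blinfun.bounded_linear_right])
  have subK: "subspace K" unfolding K_def by (rule linear_subspace_image[OF lin subspace_UNIV])
  obtain pr :: "'e \<Rightarrow>\<^sub>L 'e" where pr: "\<And>x. pr x \<in> K" "\<And>x y. y \<in> K \<Longrightarrow> (x - pr x) \<bullet> y = 0"
    using orthogonal_projection_exists[OF subK] by blast
  have perp0: "x = 0" if "x \<in> K" "\<And>y. y \<in> K \<Longrightarrow> x \<bullet> y = 0" for x
    using that(2)[OF that(1)] by simp
  have prK: "pr x = x" if "x \<in> K" for x
    using perp0[of "x - pr x"] pr that subspace_diff[OF subK] by (metis eq_iff_diff_eq_0)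
  have prpr: "pr (pr x) = pr x" for x by (rule prK[OF pr(1)])
  have pr0: "pr h = 0" if "\<And>y. y \<in> K \<Longrightarrow> h \<bullet> y = 0" for h
    by (rule perp0[OF pr(1)]) (use pr(2)[of _ h] that in \<open>simp add: inner_diff_left\<close>)
  have split: "u = 0 \<and> w = 0" if "u + w = 0" "u \<in> K" "\<And>y. y \<in> K \<Longrightarrow> w \<bullet> y = 0" for u w
  proof -
    have "u \<bullet> y = 0" if "y \<in> K" for y
      using \<open>u + w = 0\<close> \<open>\<And>y. y \<in> K \<Longrightarrow> w \<bullet> y = 0\<close>[OF that] by (metis add.right_neutral inner_add_left inner_zero_left)
    then have "u = 0" using perp0 \<open>u \<in> K\<close> by blast
    then show ?thesis using \<open>u + w = 0\<close> by simp
  qed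
  \<comment> \<open>Compressing \<open>Q x\<close> to \<open>K\<close> and adding the identity on
    the orthogonal complement gives an endomorphism of the whole space. It is injective at
    \<open>p\<close> because a skew map is injective on its own range, so it has a smooth inverse
    near \<open>p\<close>.\<close>
  define L where "L x = (pr o\<^sub>L (Q x o\<^sub>L pr)) + (id_blinfun - pr)" for x
  have L: "L x w = pr (Q x (pr w)) + (w - pr w)" for x w
    by (simp add: L_def blinfun.add_left blinfun.diff_left)
  have LC: "Cinf_on S L" unfolding L_def
    by (intro Cinf_on_add Cinf_on_blinfun_compose Cinf_on_const Q S)
  have "w = 0" if "L p w = 0" for w
  proof -
    have "pr (Q p (pr w)) = 0 \<and> w - pr w = 0"
      by (rule split) (use that L pr in auto)
    then have w: "pr w = w" and "pr (Q p w) = 0" by auto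
    then have Q0: "Q p w = 0" using prK[of "Q p w"] by (auto simp: K_def)
    obtain a where "w = Q p a" using pr(1)[of w] w by (auto simp: K_def)
    then have "w \<bullet> w = - (a \<bullet> Q p w)" using skew[OF S(2)] by metis
    then show "w = 0" using Q0 by simp
  qed
  then obtain r C where r: "r > 0" "ball p r \<subseteq> S"
    and C: "\<And>x. x \<in> ball p r \<Longrightarrow> C x o\<^sub>L L x = id_blinfun" "\<And>x. x \<in> ball p r \<Longrightarrow> L x o\<^sub>L C x = id_blinfun"
    using blinfun_inverse_near[OF S Cinf_on_continuous_on[OF LC]] by metis
  have CC: "Cinf_on (ball p r) C"
    unfolding Cinf_on_def
  proof
    fix k
    have "Ck_on k (ball p r) L" using LC r(2) Ck_on_subset unfolding Cinf_on_def by blast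
    then show "Ck_on k (ball p r) C"
      by (rule Ck_on_blinfun_inverse[rotated -1]) (use C in auto)
  qed
  define N where "N x = pr o\<^sub>L (C x o\<^sub>L pr)" for x
  define Y where "Y x = Q x o\<^sub>L N x" for x
  have NC: "Cinf_on (ball p r) N" unfolding N_def
    by (intro Cinf_on_blinfun_compose Cinf_on_const CC open_ball)
  have YC: "Cinf_on (ball p r) Y" unfolding Y_def
    by (intro Cinf_on_blinfun_compose NC open_ball Cinf_on_subset[OF Q r(2)])
  have Y1: "Y x v = Q x (N x v)" for x v by (simp add: Y_def)
  have prY: "pr (Y x v) = pr v" if x: "x \<in> ball p r" for x v
  proof -
    define u where "u = C x (pr v)"
    have "L x u = pr v" using C(2)[OF x] unfolding u_def by (metis blinfun_apply_blinfun_compose id_blinfun.rep_eq)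
    then have e: "pr (Q x (pr u)) + (u - pr u) = pr v" by (simp only: L)
    have "(pr (Q x (pr u)) - pr v) + (u - pr u) = 0" using e by (metis add_diff_eq diff_self diff_add_eq)
    then have "pr (Q x (pr u)) - pr v = 0 \<and> u - pr u = 0"
      by (rule split) (rule subspace_diff[OF subK pr(1) pr(1)], rule pr(2))
    then have "pr (Q x (pr u)) - pr v = 0" by blast
    then have "pr (Q x (pr u)) = pr v" by simp
    then show ?thesis by (simp add: Y1 N_def u_def)
  qed
  have Ypr: "Y x (pr v) = Y x v" for x v by (simp add: Y1 N_def prpr)
  have QY: "Q x a = Y x (Q x a)" if x: "x \<in> ball p r" for x a
  proof -
    \<comment> \<open>\<open>Y x\<close> embeds \<open>K\<close> into \<open>range (Q x)\<close>;
      constant rank makes this onto, so a vector of \<open>range (Q x)\<close> is determined by its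
      projection.\<close>
    have inj: "inj_on (Y x) K"
      by (rule inj_onI) (metis prY[OF x] prK)
    have "dim (Y x ` K) = dim K"
      by (rule dim_image_eq[OF lin]) (simp add: span_eq_iff[THEN iffD2, OF subK] inj)
    also have "\<dots> = dim (range (Q x))" using rank[of x] x r by (auto simp: K_def)
    finally have "Y x ` K = range (Q x)"
      by (intro subspace_dim_equal linear_subspace_image lin subK subspace_UNIV) (auto simp: Y1)
    then obtain w where w: "w \<in> K" "Q x a = Y x w" by (metis imageE rangeI)
    then have "w = pr (Q x a)" using prY[OF x, of w] prK by simp
    then show ?thesis by (metis w(2) Ypr)
  qed
  have comm: "frechet_derivative Y (at x) (Y x v) w = frechet_derivative Y (at x) (Y x w) v"
    if x: "x \<in> ball p r" for x v w
  proof -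
    define Q' where "Q' = frechet_derivative Q (at x)"
    define N' where "N' = frechet_derivative N (at x)"
    have xS: "x \<in> S" using x r by auto
    have "(Y has_derivative (\<lambda>h. (Q x o\<^sub>L N' h) + (Q' h o\<^sub>L N x))) (at x)"
      unfolding Y_def Q'_def N'_def
      by (intro bounded_bilinear.FDERIV[OF bounded_bilinear_blinfun_compose] Cinf_on_has_derivative[OF Q xS] Cinf_on_has_derivative[OF NC x])
    then have Y': "frechet_derivative Y (at x) = (\<lambda>h. (Q x o\<^sub>L N' h) + (Q' h o\<^sub>L N x))"
      by (rule frechet_derivative_at[symmetric])
    define d where "d = frechet_derivative Y (at x) (Y x v) w - frechet_derivative Y (at x) (Y x w) v"
    \<comment> \<open>The terms with \<open>N'\<close> lie in \<open>range (Q x)\<close> already;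
      the remaining ones are covered by involutivity.\<close>
    have "d = Q x (N' (Y x v) w - N' (Y x w) v) + (Q' (Q x (N x v)) (N x w) - Q' (Q x (N x w)) (N x v))"
      by (simp add: d_def Y' blinfun.add_left blinfun.diff_right Y1)
    moreover have "subspace (range (Q x))" by (rule linear_subspace_image[OF lin subspace_UNIV])
    ultimately have "d \<in> range (Q x)"
      using invol[OF xS, of "N x v" "N x w"] subspace_add unfolding Q'_def by blast
    then have d: "d = Y x (pr d)" using QY[OF x] Ypr by auto
    \<comment> \<open>\<open>pr (Y z u)\<close> does not vary with \<open>z\<close>, so
      \<open>d\<close> has zero projection; being in \<open>range (Q x)\<close>, it
      vanishes.\<close>
    have z: "pr (frechet_derivative Y (at x) h u) = 0" for h u
    proof -
      have "((\<lambda>z. pr (Y z u)) has_derivative (\<lambda>h. pr (frechet_derivative Y (at x) h u))) (at x)"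
        by (intro bounded_linear.has_derivative[OF blinfun.bounded_linear_right]
            bounded_linear.has_derivative[OF blinfun.bounded_linear_left] Cinf_on_has_derivative[OF YC x])
      moreover have "((\<lambda>z. pr (Y z u)) has_derivative (\<lambda>h. 0)) (at x)"
        by (rule has_derivative_transform_within_open[OF has_derivative_const[of "pr u"] open_ball x]) (simp add: prY)
      ultimately show ?thesis by (metis has_derivative_unique)
    qed
    have "pr d = 0" by (simp add: d_def blinfun.diff_right z)
    then have "d = 0" using d by simp
    then show ?thesis by (simp add: d_def)
  qed
  show thesis
    by (rule that[OF r YC, of pr]) (use prY Ypr QY comm in \<open>auto intro!: pr0 simp: K_def\<close>)
qed

text \<open>\<open>H x\<close> is the point where the flow of \<open>Y v\<close> with \<open>v = pr (p - x)\<close> carries \<open>x\<close> at time one; it lies in the slice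
  \<open>pr (y - p) = 0\<close>. The parameter \<open>v\<close> is part of the state, and scaling it by \<open>\<epsilon>\<close> makes the field a contraction.\<close>

theorem frobenius_first_integrals:
  fixes Q :: "'e::euclidean_space \<Rightarrow> 'e \<Rightarrow>\<^sub>L 'e"
  assumes S: "open S" "p \<in> S" and Q: "Cinf_on S Q"
    and skew: "\<And>x a b. x \<in> S \<Longrightarrow> Q x a \<bullet> b = - (a \<bullet> Q x b)"
    and rank: "\<And>x. x \<in> S \<Longrightarrow> dim (range (Q x)) = dim (range (Q p))"
    and invol: "\<And>x a b. x \<in> S \<Longrightarrow>
      frechet_derivative Q (at x) (Q x a) b - frechet_derivative Q (at x) (Q x b) a \<in> range (Q x)"
  obtains T and H :: "'e \<Rightarrow> 'e" where "open T" "p \<in> T" "T \<subseteq> S" "Cinf_on UNIV H"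
    "\<And>x a. x \<in> T \<Longrightarrow> frechet_derivative H (at x) (Q x a) = 0"
    "\<And>h. (\<And>a. h \<bullet> Q p a = 0) \<Longrightarrow> frechet_derivative H (at p) h = h"
proof (rule commuting_frame[OF S Q skew rank invol])
  fix pr :: "'e \<Rightarrow>\<^sub>L 'e" and Y :: "'e \<Rightarrow> 'e \<Rightarrow>\<^sub>L 'e" and r
  assume r: "r > 0" "ball p r \<subseteq> S" and YC: "Cinf_on (ball p r) Y"
    and pr0: "\<And>h. (\<And>a. h \<bullet> Q p a = 0) \<Longrightarrow> pr h = 0"
    and prY: "\<And>x w. x \<in> ball p r \<Longrightarrow> pr (Y x w) = pr w"
    and Ypr: "\<And>x w. x \<in> ball p r \<Longrightarrow> Y x (pr w) = Y x w"
    and QY: "\<And>x a. x \<in> ball p r \<Longrightarrow> Q x a = Y x (Q x a)"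
    and comm: "\<And>x v w. x \<in> ball p r \<Longrightarrow> frechet_derivative Y (at x) (Y x v) w = frechet_derivative Y (at x) (Y x w) v"
  define z0 :: "'e \<times> 'e" where "z0 = (p, 0)"
  \<comment> \<open>The cut-off is \<open>1\<close> up to \<open>r1\<close> and \<open>0\<close>
    from \<open>r2\<close> on; both radii are below \<open>r\<close>, within which \<open>Y\<close>
    is smooth.\<close>
  define r1 where "r1 = r / 3"
  define r2 where "r2 = r / 2"
  have r12: "0 < r1" "r1 < r2" "r2 < r" using r by (auto simp: r1_def r2_def)
  obtain \<eta> :: "'e \<times> 'e \<Rightarrow> real" where eta: "Cinf_on UNIV \<eta>" "\<And>z. dist z0 z \<le> r1 \<Longrightarrow> \<eta> z = 1" "\<And>z. dist z0 z \<ge> r2 \<Longrightarrow> \<eta> z = 0"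
    using smooth_bump_exists[OF r12(1,2)] by metis
  have inb: "fst z \<in> ball p r" if "dist z0 z < r" for z
    using dist_fst_le[of z0 z] that by (simp add: z0_def)
  define Z0 where "Z0 z = \<eta> z *\<^sub>R (Y (fst z) (snd z), 0::'e)" for z
  have locC: "Cinf_on (ball z0 r) (\<lambda>z. (Y (fst z) (snd z), 0::'e))"
  proof -
    have "Cinf_on (ball z0 r) (\<lambda>z. Y (fst z) (snd z))"
      by (intro Cinf_on_blinfun_apply open_ball Cinf_on_compose[OF _ _ _ YC] Cinf_on_linear bounded_linear_fst bounded_linear_snd)
        (auto intro: inb[unfolded mem_ball])
    then show ?thesis
      by (rule Cinf_on_linear_comp[rotated 2, of _ _ "\<lambda>y. (y, 0)"]) (auto intro: bounded_linear_Pair bounded_linear_ident bounded_linear_zero)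
  qed
  have "Cinf_on UNIV Z0"
  proof (rule Cinf_on_local)
    fix z
    show "\<exists>T. open T \<and> z \<in> T \<and> Cinf_on T Z0"
    proof (cases "dist z0 z < r")
      case True
      have "Cinf_on (ball z0 r) Z0" unfolding Z0_def
        by (intro Cinf_on_scaleR open_ball locC Cinf_on_subset[OF eta(1)]) auto
      then show ?thesis using True by (intro exI[of _ "ball z0 r"]) auto
    next
      case False
      have op: "open {z. r2 < dist z0 z}" by (rule open_Collect_less) (auto intro: continuous_intros)
      have "Cinf_on {z. r2 < dist z0 z} Z0"
        by (rule Cinf_on_cong[OF op _ Cinf_on_const[of _ 0]]) (simp add: Z0_def eta(3) zero_prod_def)
      then show ?thesis using False r12 op by (intro exI[of _ "{z. r2 < dist z0 z}"]) auto
    qed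
  qed
  moreover have "Z0 z = 0" if "norm z0 + r2 < norm z" for z
  proof -
    have "r2 \<le> dist z0 z" using that norm_triangle_ineq2[of z z0] by (simp add: dist_norm norm_minus_commute)
    then show ?thesis by (simp add: Z0_def eta(3) zero_prod_def)
  qed
  ultimately have Z0: "test_fun Z0" unfolding test_fun_def by blast
  obtain M where M: "M > 0" "\<And>z v. norm (frechet_derivative Z0 (at z) v) \<le> M * norm v"
    using test_fun_lipschitz[OF Z0] by metis
  define \<epsilon> where "\<epsilon> = 1 / (2 * M)"
  have e: "\<epsilon> > 0" using M by (simp add: \<epsilon>_def)
  define Z where "Z z = \<epsilon> *\<^sub>R Z0 z" for z
  have Z: "test_fun Z" using Z0 unfolding test_fun_def Z_def
    by (auto intro: Cinf_on_scaleR Cinf_on_const)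
  have Zder: "frechet_derivative Z (at z) = (\<lambda>h. \<epsilon> *\<^sub>R frechet_derivative Z0 (at z) h)" for z
    unfolding Z_def
    by (rule frechet_derivative_at[symmetric], rule bounded_linear.has_derivative[OF bounded_linear_scaleR_right test_fun_has_derivative[OF Z0]])
  have Zh: "norm (frechet_derivative Z (at z) h) \<le> 1 / 2 * norm h" for z h
    using M(2)[of z h] M(1) e by (simp add: Zder \<epsilon>_def field_simps)
  note flow = flow_path_dist[OF Z Zh] flow_path_fixed[OF Z Zh] flow_path_has_vector_derivative[OF Z Zh]
     Cinf_flow_map[OF Z Zh] flow_map_derivative[OF Z Zh] flow_path_0[OF Z Zh]
  let ?\<Phi> = "\<lambda>z. flow_path Z z 1"
  have Zloc: "Z z = \<epsilon> *\<^sub>R (Y (fst z) (snd z), 0)" if "dist z0 z < r1" for z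
    using eta(2)[of z] that by (simp add: Z_def Z0_def)
  have Zderloc: "frechet_derivative Z (at z) h =
      \<epsilon> *\<^sub>R (Y (fst z) (snd h) + frechet_derivative Y (at (fst z)) (fst h) (snd z), 0)" if z: "dist z0 z < r1" for z h
  proof -
    have fz: "fst z \<in> ball p r" using inb[of z] z r12 by simp
    have 1: "((\<lambda>z. Y (fst z) (snd z)) has_derivative (\<lambda>h. Y (fst z) (snd h) + frechet_derivative Y (at (fst z)) (fst h) (snd z))) (at z)"
      by (rule bounded_bilinear.FDERIV[OF bounded_bilinear_blinfun_apply
            has_derivative_compose[OF bounded_linear_imp_has_derivative[OF bounded_linear_fst] Cinf_on_has_derivative[OF YC fz]]
            bounded_linear_imp_has_derivative[OF bounded_linear_snd]])
    have "((\<lambda>z. \<epsilon> *\<^sub>R (Y (fst z) (snd z), 0::'e)) has_derivative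
      (\<lambda>h. \<epsilon> *\<^sub>R (Y (fst z) (snd h) + frechet_derivative Y (at (fst z)) (fst h) (snd z), 0))) (at z)"
      by (intro bounded_linear.has_derivative[OF bounded_linear_scaleR_right] has_derivative_Pair 1 has_derivative_const)
    then have "(Z has_derivative
      (\<lambda>h. \<epsilon> *\<^sub>R (Y (fst z) (snd h) + frechet_derivative Y (at (fst z)) (fst h) (snd z), 0))) (at z)"
      by (rule has_derivative_transform_within_open[of _ _ _ _ "ball z0 r1"]) (use z Zloc in auto)
    from frechet_derivative_at[OF this] show ?thesis by (simp add: fun_eq_iff)
  qed
  have Zzero: "Z (x, 0) = 0" for x by (simp add: Z_def Z0_def zero_prod_def)
  \<comment> \<open>\<open>z0\<close> is an equilibrium and the flow is \<open>2\<close>-Lipschitz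
    in the starting point, so starts within \<open>r1 / 2\<close> remain where the cut-off is
    \<open>1\<close>.\<close>
  have stay: "dist z0 (flow_path Z z s) < r1" if "dist z0 z < r1 / 2" for z s
    using flow(1)[of z0 s z] flow(2)[of z0 s] Zzero[of p] that by (simp add: z0_def dist_norm)
  \<comment> \<open>To first order, moving the start by \<open>Y w\<close> and lowering the
    parameter by \<open>w\<close> divided by \<open>\<epsilon>\<close> does not move the end
    point.\<close>
  have key: "frechet_derivative ?\<Phi> (at z) (Y (fst z) w, - (w /\<^sub>R \<epsilon>)) = (0, - (w /\<^sub>R \<epsilon>))"
    if z: "dist z0 z < r1 / 2" for z w
  proof -
    let ?x = "\<lambda>s. fst (flow_path Z z s)"
    \<comment> \<open>\<open>c\<close> solves the linearized flow equation because the fields \<open>Y w\<close> commute.\<close>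
    define c where "c s = ((1 - s) *\<^sub>R Y (?x s) w, - (w /\<^sub>R \<epsilon>))" for s
    have c': "(c has_vector_derivative frechet_derivative Z (at (flow_path Z z s)) (c s)) (at s within {0..1})"
      if s: "s \<in> {0..1}" for s
    proof -
      let ?y = "flow_path Z z s"
      have y: "dist z0 ?y < r1" by (rule stay[OF z])
      have fy: "fst ?y \<in> ball p r" using inb[of ?y] y r12 by simp
      have "(?x has_vector_derivative fst (Z ?y)) (at s within {0..1})"
        by (rule bounded_linear.has_vector_derivative[OF bounded_linear_fst flow(3)[OF s]])
      then have "(?x has_vector_derivative \<epsilon> *\<^sub>R Y (?x s) (snd ?y)) (at s within {0..1})"
        by (simp add: Zloc[OF y])
      then have x': "(?x has_derivative (\<lambda>t. t *\<^sub>R (\<epsilon> *\<^sub>R Y (?x s) (snd ?y)))) (at s within {0..1})"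
        unfolding has_vector_derivative_def .
      have lY: "linear (frechet_derivative Y (at (?x s)))"
        by (rule has_derivative_linear[OF Cinf_on_has_derivative[OF YC fy]])
      have "((\<lambda>s. Y (?x s) w) has_derivative (\<lambda>t. frechet_derivative Y (at (?x s)) (t *\<^sub>R (\<epsilon> *\<^sub>R Y (?x s) (snd ?y))) w)) (at s within {0..1})"
        by (rule bounded_linear.has_derivative[OF blinfun.bounded_linear_left
              has_derivative_compose[OF x' Cinf_on_has_derivative[OF YC fy]]])
      then have Yx: "((\<lambda>s. Y (?x s) w) has_vector_derivative \<epsilon> *\<^sub>R frechet_derivative Y (at (?x s)) (Y (?x s) (snd ?y)) w) (at s within {0..1})"
        unfolding has_vector_derivative_def by (simp add: linear_scale[OF lY] blinfun.scaleR_left)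
      have "((\<lambda>s. (1 - s) *\<^sub>R Y (?x s) w) has_vector_derivative
         (1 - s) *\<^sub>R (\<epsilon> *\<^sub>R frechet_derivative Y (at (?x s)) (Y (?x s) (snd ?y)) w) + (0 - 1) *\<^sub>R Y (?x s) w) (at s within {0..1})"
        by (intro has_vector_derivative_scaleR Yx) (auto intro!: derivative_eq_intros)
      then have "(c has_vector_derivative
        ((1 - s) *\<^sub>R (\<epsilon> *\<^sub>R frechet_derivative Y (at (?x s)) (Y (?x s) (snd ?y)) w) + (0 - 1) *\<^sub>R Y (?x s) w, 0)) (at s within {0..1})"
        unfolding c_def[abs_def] by (intro has_vector_derivative_Pair has_vector_derivative_const)
      moreover have "frechet_derivative Z (at ?y) (c s) =
        ((1 - s) *\<^sub>R (\<epsilon> *\<^sub>R frechet_derivative Y (at (?x s)) (Y (?x s) (snd ?y)) w) + (0 - 1) *\<^sub>R Y (?x s) w, 0)"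
        using e by (simp add: Zderloc[OF y] c_def linear_scale[OF lY] blinfun.bilinear_simps comm[OF fy, of w "snd ?y"] scaleR_add_right scaleR_diff_right mult.commute)
      ultimately show ?thesis by simp
    qed
    have "frechet_derivative ?\<Phi> (at z) = (\<lambda>v. flow_lin_inverse Z (flow_path Z z) (const_bcontfun v) 1)"
      using flow(5)[OF c'] by (rule frechet_derivative_at[symmetric])
    then have "frechet_derivative ?\<Phi> (at z) (c 0) = c 1" using flow(6)[OF c'] by simp
    then show ?thesis by (simp add: c_def flow(7))
  qed
  \<comment> \<open>Division by \<open>\<epsilon>\<close> undoes the scaling of the field: near
    \<open>z0\<close> the time-one flow with this parameter covers exactly the projected
    displacement \<open>pr (p - x)\<close>.\<close>
  define A where "A x = (x, pr (p - x) /\<^sub>R \<epsilon>)" for x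
  define H where "H x = fst (?\<Phi> (A x))" for x
  have A': "(A has_derivative (\<lambda>h. (h, - (pr h /\<^sub>R \<epsilon>)))) (at x)" for x
  proof -
    have "((\<lambda>x. pr (p - x) /\<^sub>R \<epsilon>) has_derivative (\<lambda>h. pr (0 - h) /\<^sub>R \<epsilon>)) (at x)"
      by (intro bounded_linear.has_derivative[OF bounded_linear_scaleR_right]
          bounded_linear.has_derivative[OF blinfun.bounded_linear_right] has_derivative_diff has_derivative_const has_derivative_ident)
    from has_derivative_Pair[OF has_derivative_ident this] show ?thesis
      unfolding A_def[abs_def] by (simp add: blinfun.minus_right)
  qed
  have AC: "Cinf_on UNIV A"
  proof -
    have "A = (\<lambda>x. (x, - (pr x /\<^sub>R \<epsilon>)) + (0, pr p /\<^sub>R \<epsilon>))"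
      by (auto simp: A_def blinfun.diff_right scaleR_diff_right)
    moreover have "Cinf_on UNIV (\<lambda>x. (x, - (pr x /\<^sub>R \<epsilon>)) + (0, pr p /\<^sub>R \<epsilon>))"
      by (intro Cinf_on_add Cinf_on_const Cinf_on_linear open_UNIV bounded_linear_Pair bounded_linear_ident bounded_linear_minus
          bounded_linear_compose[OF bounded_linear_scaleR_right] blinfun.bounded_linear_right)
    ultimately show ?thesis by simp
  qed
  have HC: "Cinf_on UNIV H" unfolding H_def
    by (intro Cinf_on_linear_comp[OF bounded_linear_fst] Cinf_on_compose[OF _ _ _ flow(4) AC] open_UNIV) auto
  have H': "frechet_derivative H (at x) h = fst (frechet_derivative ?\<Phi> (at (A x)) (h, - (pr h /\<^sub>R \<epsilon>)))" for x h
  proof -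
    have "(H has_derivative (\<lambda>h. fst (frechet_derivative ?\<Phi> (at (A x)) (h, - (pr h /\<^sub>R \<epsilon>))))) (at x)"
      unfolding H_def
      by (rule bounded_linear.has_derivative[OF bounded_linear_fst has_derivative_compose[OF A' Cinf_on_has_derivative[OF flow(4)]]]) simp
    from frechet_derivative_at[OF this] show ?thesis by (simp add: fun_eq_iff)
  qed
  define T where "T = ball p r \<inter> A -` ball z0 (r1 / 2)"
  have "open (A -` ball z0 (r1 / 2))"
    using continuous_on_open_vimage[OF open_UNIV, of A] Cinf_on_continuous_on[OF AC] by simp
  then have T: "open T" "T \<subseteq> S" "p \<in> T"
    using r r12 by (auto simp: T_def A_def z0_def)
  show ?thesis
  proof (rule that[OF T(1,3,2) HC])
    fix x a assume x: "x \<in> T"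
    then have xr: "x \<in> ball p r" and Ax: "dist z0 (A x) < r1 / 2" by (auto simp: T_def)
    \<comment> \<open>In the direction \<open>Q x a = Y x w\<close> the derivative of
      \<open>A\<close> is exactly the vector treated in \<open>key\<close>, so the derivative of
      \<open>H\<close> vanishes along the distribution.\<close>
    define w where "w = pr (Q x a)"
    have "Y x w = Q x a" using QY[OF xr, of a] Ypr[OF xr] by (simp add: w_def)
    moreover have "pr (Q x a) = w" by (simp add: w_def)
    ultimately show "frechet_derivative H (at x) (Q x a) = 0"
      using key[OF Ax, of w] by (simp add: H' A_def)
  next
    fix h assume h: "\<And>a. h \<bullet> Q p a = 0"
    \<comment> \<open>A displacement orthogonal to \<open>range (Q p)\<close> has zero projection,
      hence parameter zero; the flow rests there and \<open>H\<close> is the identity on the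
      slice.\<close>
    have Heq: "H (p + t *\<^sub>R h) = p + t *\<^sub>R h" for t
      using flow(2)[OF Zzero] by (simp add: H_def A_def blinfun.minus_right blinfun.scaleR_right pr0[OF h])
    have lin: "((\<lambda>t. p + t *\<^sub>R h) has_derivative (\<lambda>t. t *\<^sub>R h)) (at 0)" by (auto intro!: derivative_eq_intros)
    have "(H has_derivative frechet_derivative H (at p)) (at (p + 0 *\<^sub>R h))"
      using Cinf_on_has_derivative[OF HC, of p] by simp
    from has_derivative_compose[OF lin this]
    have "((\<lambda>t. p + t *\<^sub>R h) has_derivative (\<lambda>t. frechet_derivative H (at p) (t *\<^sub>R h))) (at 0)"
      by (simp only: Heq)
    from has_derivative_unique[OF lin this] show "frechet_derivative H (at p) h = h" by (metis scaleR_one)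
  qed
qed

section \<open>Kronecker normal form\<close>

lemma rank_nullity_subspace:
  fixes Q :: "'e::euclidean_space \<Rightarrow> 'f::euclidean_space"
  assumes Q: "linear Q" and W: "subspace W"
  shows "dim (Q ` W) + dim {x \<in> W. Q x = 0} = dim W"
proof -
  define N where "N = {x \<in> W. Q x = 0}"
  define W0 where "W0 = {y \<in> W. \<forall>x\<in>N. orthogonal x y}"
  have N: "subspace N" unfolding N_def
    using W Q by (auto simp: subspace_def linear_0 linear_add linear_scale)
  have W0: "subspace W0" unfolding W0_def
    using W by (auto simp: subspace_def orthogonal_def inner_add_right)
  have "inj_on Q W0"
  proof (rule inj_onI)
    fix x y assume xy: "x \<in> W0" "y \<in> W0" "Q x = Q y"
    have d: "x - y \<in> W0" using subspace_diff[OF W0 xy(1,2)] .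
    have "Q (x - y) = 0" using xy(3) by (simp add: linear_diff[OF Q])
    then have "x - y \<in> N" using d by (auto simp: N_def W0_def)
    then have "orthogonal (x - y) (x - y)" using d by (auto simp: W0_def)
    then show "x = y" by (simp add: orthogonal_def)
  qed
  then have "dim (Q ` W0) = dim W0"
    by (intro dim_image_eq[OF Q]) (simp add: span_eq_iff[THEN iffD2, OF W0])
  moreover have "Q ` W0 = Q ` W"
  proof
    show "Q ` W0 \<subseteq> Q ` W" by (auto simp: W0_def)
    show "Q ` W \<subseteq> Q ` W0"
    proof
      fix z assume "z \<in> Q ` W"
      then obtain w where w: "w \<in> W" "z = Q w" by auto
      obtain y u where yu: "y \<in> span N" "\<And>t. t \<in> span N \<Longrightarrow> orthogonal u t" "w = y + u"
        using orthogonal_subspace_decomp_exists[of N w] by metis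
      have y: "y \<in> N" using yu(1) N by (simp add: span_eq_iff[THEN iffD2])
      have "u = w - y" using yu(3) by simp
      then have "u \<in> W" using w(1) y subspace_diff[OF W] by (auto simp: N_def)
      then have "u \<in> W0" using yu(2) by (auto simp: W0_def orthogonal_commute span_base)
      moreover have "z = Q u" using w(2) yu(3) y by (simp add: linear_add[OF Q] N_def)
      ultimately show "z \<in> Q ` W0" by blast
    qed
  qed
  moreover have "dim W0 + dim N = dim W"
    unfolding W0_def by (rule dim_subspace_orthogonal_to_vectors[OF N W]) (auto simp: N_def)
  ultimately show ?thesis by (simp add: N_def)
qed

lemma dim_orthogonal_complement:
  fixes W :: "'e::euclidean_space set"
  assumes "subspace W"
  shows "dim {y. \<forall>x\<in>W. x \<bullet> y = 0} + dim W = DIM('e)"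
  using dim_subspace_orthogonal_to_vectors[OF assms subspace_UNIV] by (simp add: orthogonal_def)

text \<open>Independence of the family, not of its image: vectors are labelled by pencil parameters,
  coefficients are compared label by label, and a repeated vector counts as a dependence.\<close>

definition indep_family :: "'i set \<Rightarrow> ('i \<Rightarrow> 'e::real_vector) \<Rightarrow> bool" where
  "indep_family L u \<longleftrightarrow> (\<forall>c. (\<Sum>l\<in>L. c l *\<^sub>R u l) = 0 \<longrightarrow> (\<forall>l\<in>L. c l = 0))"

lemma indep_familyI_independent:
  assumes "finite L" "inj_on v L" "independent (v ` L)"
  shows "indep_family L v"
  unfolding indep_family_def
proof (intro allI impI ballI)
  fix c l assume s: "(\<Sum>l\<in>L. c l *\<^sub>R v l) = 0" and l: "l \<in> L"
  have "(\<Sum>x\<in>v ` L. c (the_inv_into L v x) *\<^sub>R x) = (\<Sum>l\<in>L. c l *\<^sub>R v l)"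
    by (subst sum.reindex[OF assms(2)]) (auto simp: the_inv_into_f_f[OF assms(2)] intro!: sum.cong)
  then have "c (the_inv_into L v (v l)) = 0"
    using independentD[OF assms(3) finite_imageI[OF assms(1)] subset_refl, of "\<lambda>x. c (the_inv_into L v x)" "v l"] s l by auto
  then show "c l = 0" by (simp add: the_inv_into_f_f[OF assms(2) l])
qed

lemma indep_family_inj_on:
  assumes "finite L" "indep_family L v"
  shows "inj_on v L"
proof (rule inj_onI, rule ccontr)
  fix x y assume xy: "x \<in> L" "y \<in> L" "v x = v y" "x \<noteq> y"
  define c where "c l = (if l = x then 1 else if l = y then - 1 else (0::real))" for l
  have "(\<Sum>l\<in>L. c l *\<^sub>R v l) = (\<Sum>l\<in>{x,y}. c l *\<^sub>R v l)"
    by (rule sum.mono_neutral_right) (use assms xy in \<open>auto simp: c_def\<close>)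
  also have "\<dots> = 0" using xy by (simp add: c_def)
  finally show False using assms(2) xy unfolding indep_family_def by (metis c_def zero_neq_one)
qed

lemma indep_family_independent:
  assumes "finite L" "indep_family L v"
  shows "independent (v ` L)"
proof
  assume "dependent (v ` L)"
  then obtain u where u: "(\<Sum>x\<in>v ` L. u x *\<^sub>R x) = 0" "\<exists>x\<in>v ` L. u x \<noteq> 0"
    using dependent_finite[OF finite_imageI[OF assms(1)]] by blast
  have "(\<Sum>l\<in>L. u (v l) *\<^sub>R v l) = 0"
    using u(1) by (subst (asm) sum.reindex[OF indep_family_inj_on[OF assms]]) simp
  then show False using assms(2)[unfolded indep_family_def, rule_format, of "\<lambda>l. u (v l)"] u(2) by auto
qed

lemma indep_family_if_spanning:
  fixes u :: "'i \<Rightarrow> 'e::euclidean_space"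
  assumes "finite L" "S \<subseteq> span (u ` L)" "card L \<le> dim S"
  shows "indep_family L u"
proof -
  have 1: "dim S \<le> dim (u ` L)" using dim_subset[OF assms(2)] by (simp add: dim_span)
  have 2: "dim (u ` L) \<le> card (u ` L)" by (rule dim_le_card') (simp add: assms)
  have 3: "card (u ` L) \<le> card L" by (rule card_image_le[OF assms(1)])
  have "inj_on u L" by (rule eq_card_imp_inj_on[OF assms(1)]) (use 1 2 3 assms(3) in linarith)
  moreover have "independent (u ` L)"
    by (rule card_le_dim_spanning[of _ "u ` L"]) (use 1 2 3 assms in \<open>auto intro: span_base\<close>)
  ultimately show ?thesis by (intro indep_familyI_independent assms(1))
qed

text \<open>Coordinate functionals on the family extend linearly to the whole space and are
  represented by inner products.\<close>

lemma dual_family_exists: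
  fixes u :: "'i \<Rightarrow> 'e::euclidean_space"
  assumes "finite L" "indep_family L u"
  obtains z where "\<And>l m. l \<in> L \<Longrightarrow> m \<in> L \<Longrightarrow> u l \<bullet> z m = (if l = m then 1 else 0)"
proof -
  have "\<exists>z. \<forall>l\<in>L. u l \<bullet> z = (if l = m then 1 else 0)" if m: "m \<in> L" for m
  proof -
    obtain g :: "'e \<Rightarrow> real" where g: "linear g" "\<And>x. x \<in> u ` L \<Longrightarrow> g x = (if x = u m then 1 else 0)"
      using linear_independent_extend[OF indep_family_independent[OF assms], of "\<lambda>x. if x = u m then 1 else 0"] by blast
    define z where "z = (\<Sum>b\<in>Basis. g b *\<^sub>R b)"
    have gz: "g x = x \<bullet> z" for x
    proof -
      have "g x = g (\<Sum>b\<in>Basis. (x \<bullet> b) *\<^sub>R b)" by (simp add: euclidean_representation)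
      also have "\<dots> = (\<Sum>b\<in>Basis. (x \<bullet> b) * g b)" by (simp add: linear_sum[OF g(1)] linear_scale[OF g(1)])
      finally show ?thesis by (simp add: z_def inner_sum_right mult.commute)
    qed
    have "u l \<bullet> z = (if l = m then 1 else 0)" if l: "l \<in> L" for l
      using g(2)[of "u l"] l m inj_onD[OF indep_family_inj_on[OF assms], of l m] by (auto simp: gz)
    then show ?thesis by blast
  qed
  then obtain z where "\<And>m l. m \<in> L \<Longrightarrow> l \<in> L \<Longrightarrow> u l \<bullet> z m = (if l = m then 1 else 0)" by metis
  then show thesis by (intro that)
qed

text \<open>A nonempty open set of reals is infinite, so removing finitely many parameters leaves
  \<open>U\<close> dense in itself. A closed condition known off the nodes thus passes to the
  nodes.\<close>

lemma continuous_closed_cofinite: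
  fixes v :: "real \<Rightarrow> 'e::topological_space"
  assumes "open U" "continuous_on U v" "finite L" "closed C" "\<And>\<mu>. \<mu> \<in> U - L \<Longrightarrow> v \<mu> \<in> C" "l \<in> U"
  shows "v l \<in> C"
proof (rule ccontr)
  assume "v l \<notin> C"
  have "open (U \<inter> v -` (- C))"
    by (rule continuous_open_preimage[OF assms(2,1)]) (use assms(4) in auto)
  moreover have "l \<in> U \<inter> v -` (- C)" using \<open>v l \<notin> C\<close> assms(6) by auto
  ultimately have "infinite (U \<inter> v -` (- C))"
    using finite_imp_not_open by blast
  then have "\<not> U \<inter> v -` (- C) \<subseteq> L" using finite_subset[OF _ assms(3)] by blast
  then obtain \<mu> where "\<mu> \<in> U \<inter> v -` (- C)" "\<mu> \<notin> L" by blast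
  then show False using assms(5)[of \<mu>] by auto
qed

section \<open>A Kronecker basis from a common isotropic subspace\<close>

text \<open>In the basis \<open>v\<close> of a subspace isotropic for both pairings, with \<open>P2 (v l) = - l P1 (v l)\<close>, the remaining
  relation between the \<open>P1 (v l)\<close> is normalized to \<open>(\<Sum>l\<in>L. P1 (v l)) = 0\<close>.\<close>

locale kronecker_frame =
  fixes P1 P2 :: "'e::euclidean_space \<Rightarrow> 'e" and L :: "real set" and v :: "real \<Rightarrow> 'e" and l0 :: real
  assumes lin1: "linear P1" and lin2: "linear P2"
    and skew1: "P1 x \<bullet> y = - (x \<bullet> P1 y)" and skew2: "P2 x \<bullet> y = - (x \<bullet> P2 y)"
    and finL: "finite L" and l0: "l0 \<in> L"
    and v_indep: "indep_family L v"
    and iso1: "l \<in> L \<Longrightarrow> m \<in> L \<Longrightarrow> P1 (v l) \<bullet> v m = 0"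
    and pencil: "l \<in> L \<Longrightarrow> P2 (v l) = - (l *\<^sub>R P1 (v l))"
    and rel: "(\<Sum>l\<in>L. P1 (v l)) = 0"
    and u_indep: "indep_family (L - {l0}) (\<lambda>l. P1 (v l))"
begin

abbreviation "u l \<equiv> P1 (v l)"

text \<open>Subtracting \<open>c l0\<close> times the normalized relation removes the term at
  \<open>l0\<close>, and the other \<open>u l\<close> are independent. Hence the relations form a
  line.\<close>

lemma relation_const:
  assumes "(\<Sum>l\<in>L. c l *\<^sub>R u l) = 0" "l \<in> L"
  shows "c l = c l0"
proof (cases "l = l0")
  case False
  have "(\<Sum>l\<in>L. (c l - c l0) *\<^sub>R u l) = 0"
    using assms(1) rel by (simp add: scaleR_diff_left sum_subtractf scaleR_sum_right[symmetric])
  then have "(\<Sum>l\<in>L - {l0}. (c l - c l0) *\<^sub>R u l) = 0"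
    by (simp add: sum.remove[OF finL l0])
  then show ?thesis
    using u_indep[unfolded indep_family_def, rule_format, of "\<lambda>l. c l - c l0" l] False assms(2) by auto
qed simp

text \<open>Adding combinations of the \<open>v j\<close> to a dual family keeps it dual, since the
  \<open>v j\<close> are isotropic. For each pair \<open>l\<close>, \<open>m\<close> the
  coefficients \<open>C l m\<close> and \<open>C m l\<close> then have to solve two linear
  equations, with determinant \<open>m - l\<close>, nonzero for distinct nodes.\<close>

lemma isotropic_dual:
  "\<exists>z. \<forall>l\<in>L - {l0}. \<forall>m\<in>L - {l0}. u l \<bullet> z m = (if l = m then 1 else 0) \<and>
     P1 (z l) \<bullet> z m = 0 \<and> P2 (z l) \<bullet> z m = 0"
proof -
  define L' where "L' = L - {l0}"
  have fin: "finite L'" "L' \<subseteq> L" using finL by (auto simp: L'_def)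
  obtain y where y: "\<And>l m. l \<in> L' \<Longrightarrow> m \<in> L' \<Longrightarrow> u l \<bullet> y m = (if l = m then 1 else 0)"
    using dual_family_exists[OF fin(1)] u_indep unfolding L'_def by blast
  define a where "a l m = P1 (y l) \<bullet> y m" for l m
  define b where "b l m = P2 (y l) \<bullet> y m" for l m
  have ab: "a m l = - a l m" "b m l = - b l m" for l m
    unfolding a_def b_def by (metis inner_commute skew1, metis inner_commute skew2)
  \<comment> \<open>The solution of \<open>C l m - C m l = - a l m\<close> and \<open>m C l m - l C m l = b l m\<close>; division by zero gives \<open>C l l = 0\<close>.\<close>
  define C where "C l m = (b l m + l * a l m) / (m - l)" for l m
  define z where "z m = y m + (\<Sum>j\<in>L'. C m j *\<^sub>R v j)" for m
  have uv: "u l \<bullet> (\<Sum>j\<in>L'. C m j *\<^sub>R v j) = 0" if "l \<in> L'" for l m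
  proof -
    have "u l \<bullet> v j = 0" if "j \<in> L'" for j using iso1 \<open>l \<in> L'\<close> that fin(2) by blast
    then show ?thesis by (simp add: inner_sum_right)
  qed
  have uz: "u l \<bullet> z m = (if l = m then 1 else 0)" if "l \<in> L'" "m \<in> L'" for l m
    using that by (simp add: z_def inner_add_right y uv)
  have P1s: "P1 (\<Sum>j\<in>L'. C l j *\<^sub>R v j) = (\<Sum>j\<in>L'. C l j *\<^sub>R u j)" for l
    by (simp add: linear_sum[OF lin1] linear_scale[OF lin1])
  have P2s: "P2 (\<Sum>j\<in>L'. C l j *\<^sub>R v j) = - (\<Sum>j\<in>L'. (C l j * j) *\<^sub>R u j)" for l
    using fin(2) by (simp add: linear_sum[OF lin2] linear_scale[OF lin2] pencil subset_iff sum_negf)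
  have 1: "P1 (z l) \<bullet> z m = 0" if lm: "l \<in> L'" "m \<in> L'" for l m
  proof -
    have s: "(\<Sum>j\<in>L'. C l j *\<^sub>R u j) \<bullet> z m = C l m"
      using lm fin by (simp add: inner_sum_left uz if_distrib cong: if_cong)
    have t: "P1 (y l) \<bullet> (\<Sum>j\<in>L'. C m j *\<^sub>R v j) = - C m l"
      using lm fin by (simp add: inner_sum_right skew1[of "y l"] inner_commute[of "y l"] y if_distrib sum_negf cong: if_cong)
    have "P1 (z l) \<bullet> z m = P1 (y l) \<bullet> z m + (\<Sum>j\<in>L'. C l j *\<^sub>R u j) \<bullet> z m"
      by (simp only: z_def[of l] linear_add[OF lin1] P1s inner_add_left)
    also have "\<dots> = a l m - C m l + C l m"
      by (simp only: s) (simp add: z_def inner_add_right t a_def)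
    also have "\<dots> = 0"
    proof (cases "l = m")
      case True then show ?thesis using ab(1)[of l l] by simp
    next
      case False then show ?thesis
        by (simp add: C_def ab[of l m] divide_simps) (simp add: algebra_simps)
    qed
    finally show ?thesis .
  qed
  have 2: "P2 (z l) \<bullet> z m = 0" if lm: "l \<in> L'" "m \<in> L'" for l m
  proof -
    have s: "(\<Sum>j\<in>L'. (C l j * j) *\<^sub>R u j) \<bullet> z m = C l m * m"
      using lm fin by (simp add: inner_sum_left uz if_distrib cong: if_cong)
    have "P2 (y l) \<bullet> (\<Sum>j\<in>L'. C m j *\<^sub>R v j) = (\<Sum>j\<in>L'. C m j * (- (y l \<bullet> P2 (v j))))"
      by (simp add: inner_sum_right skew2[of "y l"])
    also have "\<dots> = (\<Sum>j\<in>L'. C m j * (j * (u j \<bullet> y l)))"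
      using fin(2) by (intro sum.cong) (auto simp: pencil inner_commute)
    also have "\<dots> = C m l * l"
      using lm fin by (simp add: y if_distrib cong: if_cong)
    finally have t: "P2 (y l) \<bullet> (\<Sum>j\<in>L'. C m j *\<^sub>R v j) = C m l * l" .
    have "P2 (z l) \<bullet> z m = P2 (y l) \<bullet> z m - (\<Sum>j\<in>L'. (C l j * j) *\<^sub>R u j) \<bullet> z m"
      by (simp only: z_def[of l] linear_add[OF lin2] P2s inner_add_left inner_minus_left inner_diff_left add_uminus_conv_diff)
    also have "\<dots> = b l m + C m l * l - C l m * m"
      by (simp only: s) (simp add: z_def inner_add_right t b_def)
    also have "\<dots> = 0"
    proof (cases "l = m")
      case True then show ?thesis using ab(2)[of l l] by simp
    next
      case False then show ?thesis
        by (simp add: C_def ab[of l m] divide_simps) (simp add: algebra_simps)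
    qed
    finally show ?thesis .
  qed
  show ?thesis unfolding L'_def[symmetric] using uz 1 2 by blast
qed

text \<open>The even Kronecker vectors are \<open>\<Sum>i. f\<^sub>l(i) v i\<close> with the Horner polynomials \<open>f\<^sub>l\<close> of
  \<open>\<Prod>j\<in>L. (x - j)\<close>, which satisfy \<open>x f\<^sub>l\<^sub>+\<^sub>1 = f\<^sub>l - const\<close>.\<close>

definition node_poly :: "real poly" where "node_poly = (\<Prod>j\<in>L. [:- j, 1:])"

definition horner :: "nat \<Rightarrow> real poly" where "horner l = poly_shift (Suc l) node_poly"

definition even_vec :: "nat \<Rightarrow> 'e" where "even_vec l = (\<Sum>i\<in>L. poly (horner l) i *\<^sub>R v i)"

lemma node_poly: "degree node_poly = card L" "lead_coeff node_poly = 1" "i \<in> L \<Longrightarrow> poly node_poly i = 0"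
proof -
  show "lead_coeff node_poly = 1" unfolding node_poly_def lead_coeff_prod by simp
qed (use finL in \<open>auto simp: node_poly_def poly_prod degree_prod_eq_sum_degree prod_zero_iff\<close>)

lemma horner_pCons: "horner l = pCons (coeff node_poly (Suc l)) (horner (Suc l))"
  by (rule poly_eqI) (auto simp: horner_def coeff_poly_shift coeff_pCons split: nat.split)

lemma node_poly_pCons: "node_poly = pCons (coeff node_poly 0) (horner 0)"
  by (rule poly_eqI) (auto simp: horner_def coeff_poly_shift coeff_pCons split: nat.split)

lemma horner_last: "horner (card L - 1) = 1"
proof (rule poly_eqI)
  have c: "card L > 0" using finL l0 card_gt_0_iff by blast
  show "coeff (horner (card L - 1)) n = coeff 1 n" for n
    using c node_poly(1,2) coeff_eq_0[of node_poly "n + card L"]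
    by (cases "n = 0") (auto simp: horner_def coeff_poly_shift)
qed

lemma P1_even: "P1 (even_vec l) = (\<Sum>i\<in>L. poly (horner l) i *\<^sub>R u i)"
  by (simp add: even_vec_def linear_sum[OF lin1] linear_scale[OF lin1])

lemma P2_even: "P2 (even_vec l) = - (\<Sum>i\<in>L. (i * poly (horner l) i) *\<^sub>R u i)"
  by (simp add: even_vec_def linear_sum[OF lin2] linear_scale[OF lin2] pencil sum_negf mult.commute)

lemma P1_even_last: "P1 (even_vec (card L - 1)) = 0"
  by (simp add: P1_even horner_last[unfolded One_nat_def] rel)

text \<open>On \<open>v i\<close>, \<open>P2\<close> is \<open>- i\<close> times \<open>P1\<close>.
  Multiplication by \<open>i\<close> lowers the index of the Horner polynomial up to a constant, and
  constant coefficients contribute nothing by \<open>rel\<close>. This is the chain of a Kronecker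
  block.\<close>

lemma P2_even_Suc: "P2 (even_vec (Suc l)) = - P1 (even_vec l)"
proof -
  have "i * poly (horner (Suc l)) i = poly (horner l) i - coeff node_poly (Suc l)" for i
    by (subst horner_pCons[of l]) simp
  then show ?thesis
    by (simp add: P2_even P1_even scaleR_diff_left sum_subtractf scaleR_sum_right[symmetric] rel)
qed

text \<open>At the start of the chain the index shift reaches \<open>node_poly\<close>, which is
  zero at the nodes, so only a constant coefficient is left.\<close>

lemma P2_even_0: "P2 (even_vec 0) = 0"
proof -
  have "i * poly (horner 0) i = - coeff node_poly 0" if "i \<in> L" for i
    using node_poly(3)[OF that] by (subst (asm) node_poly_pCons) simp
  then have "P2 (even_vec 0) = coeff node_poly 0 *\<^sub>R (\<Sum>i\<in>L. u i)"
    by (simp add: P2_even scaleR_sum_right sum_negf)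
  then show ?thesis by (simp add: rel)
qed

lemma even_iso: "P1 (even_vec l) \<bullet> even_vec m = 0" "P2 (even_vec l) \<bullet> even_vec m = 0"
proof -
  show 1: "P1 (even_vec l) \<bullet> even_vec m = 0" for l
    unfolding P1_even by (simp add: even_vec_def inner_sum_left inner_sum_right iso1)
  show "P2 (even_vec l) \<bullet> even_vec m = 0"
    by (cases l) (simp_all add: P2_even_0 P2_even_Suc 1)
qed

lemma even_last_nonzero: "even_vec (card L - 1) \<noteq> 0"
proof
  assume "even_vec (card L - 1) = 0"
  then have "(\<Sum>i\<in>L. 1 *\<^sub>R v i) = 0" by (simp add: even_vec_def horner_last[unfolded One_nat_def])
  then show False
    using v_indep[unfolded indep_family_def, rule_format, of "\<lambda>_. 1" l0] l0 by simp
qed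

text \<open>A vanishing combination gives a polynomial \<open>G\<close> that is constant on the
  nodes. Subtracting this constant leaves degree below \<open>card L\<close> with
  \<open>card L\<close> roots, hence zero; the Horner polynomials have distinct degrees, which
  forces every \<open>x l\<close> to vanish.\<close>

lemma P1_even_indep: "indep_family {..<card L - 1} (\<lambda>l. P1 (even_vec l))"
  unfolding indep_family_def
proof (intro allI impI)
  fix x assume x: "(\<Sum>l<card L - 1. x l *\<^sub>R P1 (even_vec l)) = 0"
  have cL: "card L > 0" using finL l0 card_gt_0_iff by blast
  define G where "G = (\<Sum>l<card L - 1. smult (x l) (horner l))"
  have Gi: "poly G i = (\<Sum>l<card L - 1. x l * poly (horner l) i)" for i
    by (simp add: G_def poly_sum)
  have "(\<Sum>i\<in>L. poly G i *\<^sub>R u i) = (\<Sum>i\<in>L. \<Sum>l<card L - 1. (x l * poly (horner l) i) *\<^sub>R u i)"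
    by (simp add: Gi scaleR_sum_left)
  also have "\<dots> = (\<Sum>l<card L - 1. x l *\<^sub>R P1 (even_vec l))"
    by (subst sum.swap) (simp add: P1_even scaleR_sum_right)
  finally have "(\<Sum>i\<in>L. poly G i *\<^sub>R u i) = 0" using x by simp
  then have const: "poly G i = poly G l0" if "i \<in> L" for i using relation_const that by blast
  define R where "R = G - [:poly G l0:]"
  \<comment> \<open>The restriction \<open>d > 0\<close> hides the constant that was
    subtracted.\<close>
  have cR: "coeff R d = (\<Sum>l<card L - 1. x l * coeff node_poly (d + Suc l))" if "d > 0" for d
    using that by (simp add: R_def G_def coeff_sum horner_def coeff_poly_shift coeff_pCons split: nat.split)
  have "degree R \<le> card L - 1"
  proof (rule degree_le, intro allI impI)
    fix d assume "card L - 1 < d"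
    then show "coeff R d = 0"
      by (subst cR) (auto intro!: sum.neutral coeff_eq_0 simp: node_poly(1))
  qed
  moreover have "card L \<le> card {i. poly R i = 0}" if "R \<noteq> 0"
    by (rule card_mono[OF poly_roots_finite[OF that]]) (use const in \<open>auto simp: R_def\<close>)
  ultimately have R0: "R = 0"
    using card_poly_roots_bound[of R] cL by fastforce
  have "x l = 0" if "l < card L - 1" for l
    using that
  proof (induction l rule: less_induct)
    case (less l)
    \<comment> \<open>At this degree the \<open>l\<close>-th Horner polynomial has its leading
      coefficient \<open>1\<close>; later ones have smaller degree, and earlier ones are removed by
      the induction hypothesis.\<close>
    let ?d = "card L - 1 - l"
    have "0 = (\<Sum>l'<card L - 1. x l' * coeff node_poly (?d + Suc l'))"
      using cR[of ?d] R0 less.prems by simp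
    also have "\<dots> = (\<Sum>l'<card L - 1. if l' = l then x l else 0)"
    proof (rule sum.cong[OF refl])
      fix l' assume l': "l' \<in> {..<card L - 1}"
      show "x l' * coeff node_poly (?d + Suc l') = (if l' = l then x l else 0)"
      proof (cases "l' < l")
        case True then show ?thesis using less.IH[OF True] l' by simp
      next
        case False
        show ?thesis
        proof (cases "l' = l")
          case True
          have "?d + Suc l = card L" using less.prems by simp
          then show ?thesis using True node_poly(1,2) by simp
        next
          case n: False
          then have "degree node_poly < ?d + Suc l'" using False less.prems by (simp add: node_poly(1))
          then show ?thesis using n coeff_eq_0[of node_poly "?d + Suc l'"] by simp
        qed
      qed
    qed
    also have "\<dots> = x l" using less.prems by simp
    finally show ?case by simp
  qed
  then show "\<forall>l\<in>{..<card L - 1}. x l = 0" by auto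
qed

text \<open>Even positions carry the Horner vectors and odd positions vectors dual to them under
  \<open>P1\<close>; the chain relation then produces the shifted pattern for
  \<open>P2\<close>.\<close>

lemma kronecker_basis:
  obtains w :: "nat \<Rightarrow> 'e" where "indep_family {..<2 * card L - 1} w"
    "\<And>i j. i < 2 * card L - 1 \<Longrightarrow> j < 2 * card L - 1 \<Longrightarrow>
      P1 (w i) \<bullet> w j = (if even i \<and> j = Suc i then 1 else if even j \<and> i = Suc j then - 1 else 0)"
    "\<And>i j. i < 2 * card L - 1 \<Longrightarrow> j < 2 * card L - 1 \<Longrightarrow>
      P2 (w i) \<bullet> w j = (if odd i \<and> j = Suc i then 1 else if odd j \<and> i = Suc j then - 1 else 0)"
proof -
  have cL: "card L > 0" using finL l0 card_gt_0_iff by blast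
  define k where "k = card L - 1"
  have kL: "card L = Suc k" using cL by (simp add: k_def)
  define L' where "L' = L - {l0}"
  obtain z where "\<forall>l\<in>L'. \<forall>m\<in>L'. u l \<bullet> z m = (if l = m then 1 else 0) \<and>
     P1 (z l) \<bullet> z m = 0 \<and> P2 (z l) \<bullet> z m = 0"
    using isotropic_dual unfolding L'_def by blast
  then have z: "\<And>l m. l \<in> L' \<Longrightarrow> m \<in> L' \<Longrightarrow> u l \<bullet> z m = (if l = m then 1 else 0)"
    "\<And>l m. l \<in> L' \<Longrightarrow> m \<in> L' \<Longrightarrow> P1 (z l) \<bullet> z m = 0"
    "\<And>l m. l \<in> L' \<Longrightarrow> m \<in> L' \<Longrightarrow> P2 (z l) \<bullet> z m = 0" by blast+
  obtain y0 where y0: "\<And>l m. l \<in> {..<k} \<Longrightarrow> m \<in> {..<k} \<Longrightarrow> P1 (even_vec l) \<bullet> y0 m = (if l = m then 1 else 0)"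
    using dual_family_exists[OF _ P1_even_indep] unfolding k_def by blast
  \<comment> \<open>Replacing \<open>y0 m\<close> by a combination of the \<open>z j\<close> with
    the same pairings against all \<open>u i\<close> makes the odd vectors isotropic for both
    pairings without losing duality.\<close>
  define y where "y m = (\<Sum>j\<in>L'. (u j \<bullet> y0 m) *\<^sub>R z j)" for m
  have fin: "finite L'" using finL by (simp add: L'_def)
  have uy': "u i \<bullet> y m = u i \<bullet> y0 m" if "i \<in> L'" for i m
    using that fin by (simp add: y_def inner_sum_right z(1) if_distrib cong: if_cong)
  have u0: "u l0 = - (\<Sum>i\<in>L'. u i)"
    using rel by (simp add: sum.remove[OF finL l0] L'_def add_eq_0_iff)
  have uy: "u i \<bullet> y m = u i \<bullet> y0 m" if "i \<in> L" for i m
  proof (cases "i = l0")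
    case True
    show ?thesis unfolding True u0 by (simp add: inner_sum_left uy')
  next
    case False then show ?thesis using that uy' by (simp add: L'_def)
  qed
  have e1: "P1 (even_vec l) \<bullet> y m = (if l = m then 1 else 0)" if "m < k" "l \<le> k" for l m
  proof (cases "l = k")
    case True then show ?thesis using P1_even_last that by (simp add: k_def)
  next
    case False
    have "P1 (even_vec l) \<bullet> y m = P1 (even_vec l) \<bullet> y0 m"
      unfolding P1_even by (simp add: inner_sum_left uy)
    then show ?thesis using y0 that False by simp
  qed
  have e2: "P2 (even_vec l) \<bullet> y m = (if l = Suc m then - 1 else 0)" if "m < k" "l \<le> k" for l m
    using that by (cases l) (simp_all add: P2_even_0 P2_even_Suc e1)
  have o1: "P1 (y m) \<bullet> y m' = 0" and o2: "P2 (y m) \<bullet> y m' = 0" for m m'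
    unfolding y_def
    by (simp_all add: linear_sum[OF lin1] linear_scale[OF lin1] linear_sum[OF lin2] linear_scale[OF lin2]
        inner_sum_left inner_sum_right z)
  define w where "w i = (if even i then even_vec (i div 2) else y (i div 2))" for i
  have n: "2 * card L - 1 = Suc (2 * k)" by (simp add: kL)
  have r1: "P1 (w i) \<bullet> w j = (if even i \<and> j = Suc i then 1 else if even j \<and> i = Suc j then - 1 else 0)"
    if "i < Suc (2 * k)" "j < Suc (2 * k)" for i j
  proof (cases "even i"; cases "even j")
    assume "even i" "even j"
    then show ?thesis by (auto simp: w_def even_iso)
  next
    assume ij: "even i" "odd j"
    then obtain l m where "i = 2 * l" "j = Suc (2 * m)" by (metis evenE oddE Suc_eq_plus1)
    then show ?thesis using that by (auto simp: w_def e1)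
  next
    assume ij: "odd i" "even j"
    then obtain l m where lm: "j = 2 * l" "i = Suc (2 * m)" by (metis evenE oddE Suc_eq_plus1)
    have "P1 (w i) \<bullet> w j = - (P1 (w j) \<bullet> w i)" using skew1[of "w i" "w j"] by (simp add: inner_commute)
    then show ?thesis using that lm by (auto simp: w_def e1)
  next
    assume "odd i" "odd j" then show ?thesis by (auto simp: w_def o1)
  qed
  have r2: "P2 (w i) \<bullet> w j = (if odd i \<and> j = Suc i then 1 else if odd j \<and> i = Suc j then - 1 else 0)"
    if "i < Suc (2 * k)" "j < Suc (2 * k)" for i j
  proof (cases "even i"; cases "even j")
    assume "even i" "even j"
    then show ?thesis by (auto simp: w_def even_iso)
  next
    assume ij: "even i" "odd j"
    then obtain l m where "i = 2 * l" "j = Suc (2 * m)" by (metis evenE oddE Suc_eq_plus1)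
    then show ?thesis using that by (auto simp: w_def e2)
  next
    assume ij: "odd i" "even j"
    then obtain l m where lm: "j = 2 * l" "i = Suc (2 * m)" by (metis evenE oddE Suc_eq_plus1)
    have "P2 (w i) \<bullet> w j = - (P2 (w j) \<bullet> w i)" using skew2[of "w i" "w j"] by (simp add: inner_commute)
    then show ?thesis using that lm by (auto simp: w_def e2)
  next
    assume "odd i" "odd j" then show ?thesis by (auto simp: w_def o2)
  qed
  have "indep_family {..<Suc (2 * k)} w"
    unfolding indep_family_def
  proof (intro allI impI)
    fix x assume x: "(\<Sum>i<Suc (2 * k). x i *\<^sub>R w i) = 0"
    have p1: "(\<Sum>i<Suc (2 * k). x i * (P1 (w i) \<bullet> w j)) = 0" for j
    proof -
      have "P1 (\<Sum>i<Suc (2 * k). x i *\<^sub>R w i) \<bullet> w j = 0" by (simp only: x linear_0[OF lin1] inner_zero_left)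
      then show ?thesis by (simp only: linear_sum[OF lin1] linear_scale[OF lin1] inner_sum_left inner_scaleR_left)
    qed
    \<comment> \<open>Pairing with neighbours under \<open>P1\<close> isolates every coefficient
      except that of \<open>w (2 * k)\<close>, which lies in the kernel of \<open>P1\<close> and is
      treated last, as a nonzero vector.\<close>
    have ev: "x (2 * m) = 0" if "m < k" for m
    proof -
      have "(\<Sum>i<Suc (2 * k). x i * (P1 (w i) \<bullet> w (Suc (2 * m)))) = (\<Sum>i<Suc (2 * k). if i = 2 * m then x i else 0)"
        using that by (intro sum.cong) (auto simp: r1, presburger?)
      then show ?thesis using p1[of "Suc (2 * m)"] that by simp
    qed
    have od: "x (Suc (2 * m)) = 0" if "m < k" for m
    proof -
      have "(\<Sum>i<Suc (2 * k). x i * (P1 (w i) \<bullet> w (2 * m))) = (\<Sum>i<Suc (2 * k). if i = Suc (2 * m) then - x i else 0)"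
        using that by (intro sum.cong) (auto simp: r1, presburger?)
      then show ?thesis using p1[of "2 * m"] that by simp
    qed
    have z: "x i = 0" if "i < 2 * k" for i
    proof (cases "even i")
      case True then show ?thesis using ev[of "i div 2"] that by auto
    next
      case False then show ?thesis using od[of "i div 2"] that by (auto elim!: oddE)
    qed
    then have "x (2 * k) *\<^sub>R w (2 * k) = 0" using x by simp
    moreover have "w (2 * k) \<noteq> 0" using even_last_nonzero by (simp add: w_def k_def)
    ultimately have "x (2 * k) = 0" by simp
    then show "\<forall>i\<in>{..<Suc (2 * k)}. x i = 0" using z by (auto simp: less_Suc_eq)
  qed
  then show thesis using r1 r2 by (intro that[of w]) (simp_all only: n)
qed

end

section \<open>Dimension count and reduction to a frame\<close>

lemma isotropic_span:
  assumes "linear P" "\<And>x y. x \<in> S \<Longrightarrow> y \<in> S \<Longrightarrow> P x \<bullet> y = 0" "x \<in> span S" "y \<in> span S"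
  shows "P x \<bullet> y = 0"
  using assms(3)
proof (induction rule: span_induct_alt)
  case base then show ?case by (simp add: linear_0[OF assms(1)])
next
  case (step c a z)
  have "P a \<bullet> y = 0" using assms(4)
    by (induction rule: span_induct_alt) (auto simp: inner_add_right assms(2) step)
  then show ?case using step by (simp add: linear_add[OF assms(1)] linear_scale[OF assms(1)] inner_add_left)
qed

lemma span_image_sum:
  assumes "finite L" "inj_on v L" "x \<in> span (v ` L)"
  shows "\<exists>c. x = (\<Sum>l\<in>L. c l *\<^sub>R v l)"
proof -
  obtain q where "x = (\<Sum>y\<in>v ` L. q y *\<^sub>R y)"
    using assms(3) span_finite[OF finite_imageI[OF assms(1)]] by blast
  then have "x = (\<Sum>l\<in>L. q (v l) *\<^sub>R v l)" by (simp add: sum.reindex[OF assms(2)])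
  then show ?thesis by (rule exI[of _ "\<lambda>l. q (v l)"])
qed

text \<open>In even dimension, a vector outside \<open>W\<close> in the \<open>Q\<close>-orthogonal complement of \<open>W\<close> would enlarge \<open>W\<close> to an
  isotropic subspace of impossible dimension.\<close>

lemma dim_isotropic_near_half:
  fixes Q :: "'e::euclidean_space \<Rightarrow> 'e"
  assumes Q: "linear Q" "\<And>x y. Q x \<bullet> y = - (x \<bullet> Q y)" and W: "subspace W"
    and iso: "\<And>x y. x \<in> W \<Longrightarrow> y \<in> W \<Longrightarrow> Q x \<bullet> y = 0"
    and ker: "dim {x. Q x = 0} \<le> 1" and e: "e \<in> W" "e \<noteq> 0" "Q e = 0"
    and half: "DIM('e) \<le> 2 * dim W"
  shows "DIM('e) + 1 = 2 * dim W" "dim (Q ` W) + 1 = dim W"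
proof -
  define N where "N = {x. Q x = 0}"
  have N: "subspace N" unfolding N_def
    by (auto simp: subspace_def linear_0[OF Q(1)] linear_add[OF Q(1)] linear_scale[OF Q(1)])
  have "span {e} \<subseteq> N" using e by (intro span_minimal N) (auto simp: N_def)
  moreover have de: "dim (span {e}) = 1" using e(2) by (simp add: dim_insert)
  \<comment> \<open>The kernel is exactly the line through \<open>e\<close> and lies in
    \<open>W\<close>, so every subspace containing \<open>W\<close> loses one dimension under
    \<open>Q\<close>.\<close>
  ultimately have Ne: "N = span {e}"
    using ker by (intro subspace_dim_equal[symmetric] subspace_span N) (auto simp: N_def)
  have NW: "N \<subseteq> W" unfolding Ne using e(1) by (intro span_minimal W) auto
  have nul: "dim {x \<in> V. Q x = 0} = 1" if "N \<subseteq> V" for V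
  proof -
    have "{x \<in> V. Q x = 0} = N" using that by (auto simp: N_def)
    then show ?thesis using Ne de by simp
  qed
  show rW: "dim (Q ` W) + 1 = dim W"
    using rank_nullity_subspace[OF Q(1) W] nul[OF NW] by simp
  define R where "R = {y. \<forall>x\<in>Q ` W. x \<bullet> y = 0}"
  have dR: "dim R + dim (Q ` W) = DIM('e)" unfolding R_def
    by (rule dim_orthogonal_complement[OF linear_subspace_image[OF Q(1) W]])
  have WR: "W \<subseteq> R" using iso by (auto simp: R_def)
  have "dim W \<le> dim R" by (rule dim_subset[OF WR])
  then have le: "2 * dim W \<le> DIM('e) + 1" using dR rW by linarith
  have "DIM('e) \<noteq> 2 * dim W"
  proof
    assume eq: "DIM('e) = 2 * dim W"
    then have "\<not> R \<subseteq> W" using dR rW dim_subset[of R W] by linarith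
    then obtain x where x: "x \<in> R" "x \<notin> W" by blast
    define W' where "W' = span (insert x W)"
    have W': "subspace W'" "W \<subseteq> W'" by (auto simp: W'_def span_base)
    have dW': "dim W' = dim W + 1"
      using x(2) by (simp add: W'_def dim_insert span_eq_iff[THEN iffD2, OF W])
    have iso': "Q a \<bullet> b = 0" if "a \<in> W'" "b \<in> W'" for a b
    proof (rule isotropic_span[OF Q(1) _ that[unfolded W'_def]])
      fix a b assume ab: "a \<in> insert x W" "b \<in> insert x W"
      have xx: "Q x \<bullet> x = 0" using Q(2)[of x x] by (simp add: inner_commute)
      have wx: "Q w \<bullet> x = 0" if "w \<in> W" for w using x(1) that by (auto simp: R_def)
      have xw: "Q x \<bullet> w = 0" if "w \<in> W" for w using wx[OF that] Q(2)[of x w] by (simp add: inner_commute)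
      show "Q a \<bullet> b = 0" using ab xx wx xw iso by auto
    qed
    \<comment> \<open>Isotropy gives \<open>dim W' - 1 \<le> DIM('e) - dim W'\<close>, that is
      \<open>dim W \<le> dim W - 1\<close>.\<close>
    have "dim (Q ` W') + 1 = dim W'"
      using rank_nullity_subspace[OF Q(1) W'(1)] nul[of W'] NW W'(2) by simp
    moreover have "dim (Q ` W') \<le> dim {y. \<forall>x\<in>W'. x \<bullet> y = 0}"
      by (rule dim_subset) (use iso' in \<open>auto simp: inner_commute\<close>)
    moreover have "dim {y. \<forall>x\<in>W'. x \<bullet> y = 0} + dim W' = DIM('e)"
      by (rule dim_orthogonal_complement[OF W'(1)])
    ultimately show False using dW' eq by linarith
  qed
  then show "DIM('e) + 1 = 2 * dim W" using half le by linarith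
qed

theorem kronecker_normal_form:
  fixes P1 P2 :: "'e::euclidean_space \<Rightarrow> 'e" and v :: "real \<Rightarrow> 'e"
  assumes lin1: "linear P1" and lin2: "linear P2"
    and skew1: "\<And>x y. P1 x \<bullet> y = - (x \<bullet> P1 y)" and skew2: "\<And>x y. P2 x \<bullet> y = - (x \<bullet> P2 y)"
    and U: "open U" and cont: "continuous_on U v"
    and ker: "\<And>l. l \<in> U \<Longrightarrow> l *\<^sub>R P1 (v l) + P2 (v l) = 0"
    and half: "DIM('e) \<le> 2 * dim (v ` U)"
    and cork: "dim {x. a1 *\<^sub>R P1 x + a2 *\<^sub>R P2 x = 0} \<le> 1"
  obtains k and w :: "nat \<Rightarrow> 'e" where "k \<ge> 1" "DIM('e) = 2 * k - 1" "indep_family {..<2 * k - 1} w"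
    "\<And>i j. i < 2 * k - 1 \<Longrightarrow> j < 2 * k - 1 \<Longrightarrow>
      P1 (w i) \<bullet> w j = (if even i \<and> j = Suc i then 1 else if even j \<and> i = Suc j then - 1 else 0)"
    "\<And>i j. i < 2 * k - 1 \<Longrightarrow> j < 2 * k - 1 \<Longrightarrow>
      P2 (w i) \<bullet> w j = (if odd i \<and> j = Suc i then 1 else if odd j \<and> i = Suc j then - 1 else 0)"
proof -
  have P2v: "P2 (v l) = - (l *\<^sub>R P1 (v l))" if "l \<in> U" for l
    using ker[OF that] by (metis add_eq_0_iff add.commute minus_minus)
  have iso: "P1 (v l) \<bullet> v m = 0" if lm: "l \<in> U" "m \<in> U" for l m
  proof (cases "l = m")
    case True then show ?thesis using skew1[of "v m" "v m"] by (simp add: inner_commute)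
  next
    case False
    have "P2 (v l) \<bullet> v m = - (v l \<bullet> P2 (v m))" by (rule skew2)
    then have "l * (P1 (v l) \<bullet> v m) = - (m * (v l \<bullet> P1 (v m)))" using lm by (simp add: P2v)
    then have "l * (P1 (v l) \<bullet> v m) = m * (P1 (v l) \<bullet> v m)" using skew1[of "v l" "v m"] by simp
    then show ?thesis using False by simp
  qed
  obtain B where B: "B \<subseteq> v ` U" "independent B" "v ` U \<subseteq> span B" "card B = dim (v ` U)"
    using basis_exists by blast
  define L where "L = inv_into U v ` B"
  have finB: "finite B" using B(2) by (rule independent_imp_finite)
  have vL: "v ` L = B" unfolding L_def using B(1) by (force simp: image_image f_inv_into_f subset_iff image_iff)
  have LU: "L \<subseteq> U" unfolding L_def using B(1) by (auto intro: inv_into_into)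
  have finL: "finite L" using finB by (simp add: L_def)
  have injL: "inj_on v L" unfolding L_def
    using B(1) by (auto intro!: inj_onI simp: f_inv_into_f subset_iff)
  have cL: "card L = dim (v ` U)" using card_image[OF injL] vL B(4) by simp
  have Lne: "L \<noteq> {}"
  proof
    assume "L = {}"
    then have "dim (v ` U) = 0" using cL by simp
    then show False using half DIM_positive[where 'a='e] by linarith
  qed
  have v_indep: "indep_family L v" by (rule indep_familyI_independent[OF finL injL]) (simp add: vL B(2))
  define W where "W = span (v ` L)"
  have sW: "subspace W" by (simp add: W_def)
  have vW: "v l \<in> W" if "l \<in> U" for l using that B(3) by (auto simp: W_def vL)
  have dW: "dim W = card L" using B(2,4) cL by (simp add: W_def vL dim_eq_card_independent)
  let ?u = "\<lambda>l. P1 (v l)"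
  define Q where "Q x = a1 *\<^sub>R P1 x + a2 *\<^sub>R P2 x" for x
  have linQ: "linear Q" unfolding Q_def
    by (intro linear_compose_add linear_compose_scale_right lin1 lin2)
  have skewQ: "Q x \<bullet> y = - (x \<bullet> Q y)" for x y
    by (simp add: Q_def inner_add_left inner_add_right skew1[of x y] skew2[of x y])
  have Qv: "Q (v l) = (a1 - a2 * l) *\<^sub>R ?u l" if "l \<in> U" for l
    using P2v[OF that] by (simp add: Q_def scaleR_diff_left)
  have isoQ: "Q x \<bullet> y = 0" if "x \<in> W" "y \<in> W" for x y
    by (rule isotropic_span[OF linQ _ that[unfolded W_def]]) (use LU iso in \<open>auto simp: Qv subset_iff\<close>)
  have Qsum: "Q (\<Sum>l\<in>L. c l *\<^sub>R v l) = (\<Sum>l\<in>L. (c l * (a1 - a2 * l)) *\<^sub>R ?u l)" for c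
    unfolding linear_sum[OF linQ] linear_scale[OF linQ] using LU by (intro sum.cong) (auto simp: Qv subset_iff)
  \<comment> \<open>Applying \<open>\<mu> P1 + P2\<close> to the expansion of \<open>v \<mu>\<close>
    multiplies its coefficients by \<open>\<mu> - l\<close>, so each further parameter yields a
    linear relation between the \<open>P1 (v l)\<close>.\<close>
  have expand: "(\<Sum>l\<in>L. (x l * (\<mu> - l)) *\<^sub>R ?u l) = 0" if mu: "\<mu> \<in> U" "v \<mu> = (\<Sum>l\<in>L. x l *\<^sub>R v l)" for \<mu> x
  proof -
    have "0 = \<mu> *\<^sub>R P1 (v \<mu>) + P2 (v \<mu>)" using ker[OF mu(1)] by simp
    also have "\<dots> = (\<Sum>l\<in>L. \<mu> *\<^sub>R x l *\<^sub>R ?u l) + (\<Sum>l\<in>L. x l *\<^sub>R P2 (v l))"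
      unfolding mu(2) by (simp add: linear_sum[OF lin1] linear_scale[OF lin1] linear_sum[OF lin2] linear_scale[OF lin2] scaleR_sum_right)
    also have "\<dots> = (\<Sum>l\<in>L. (x l * (\<mu> - l)) *\<^sub>R ?u l)"
      unfolding sum.distrib[symmetric] using LU by (intro sum.cong) (auto simp: P2v subset_iff algebra_simps)
    finally show ?thesis by simp
  qed
  have vne: "v l \<noteq> 0" if "l \<in> L" for l
    using B(2) that vL dependent_zero by (metis imageI)
  \<comment> \<open>If the \<open>P1 (v l)\<close> were independent, every \<open>v \<mu>\<close>
    off the nodes would be \<open>0\<close>, and by continuity so would the basis vectors.\<close>
  have "\<not> indep_family L ?u"
  proof
    assume u: "indep_family L ?u"
    have z: "v \<mu> = 0" if mu: "\<mu> \<in> U - L" for \<mu>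
    proof -
      obtain x where x: "v \<mu> = (\<Sum>l\<in>L. x l *\<^sub>R v l)"
        using span_image_sum[OF finL injL vW[unfolded W_def, of \<mu>]] mu by blast
      have "\<forall>l\<in>L. x l * (\<mu> - l) = 0"
        using u[unfolded indep_family_def, rule_format, of "\<lambda>l. x l * (\<mu> - l)"] expand[OF _ x] mu by auto
      then have "\<forall>l\<in>L. x l = 0" using mu by auto
      then show ?thesis using x by simp
    qed
    obtain l where l: "l \<in> L" using Lne by blast
    have "v l \<in> {0}" by (rule continuous_closed_cofinite[OF U cont finL]) (use z l LU in auto)
    then show False using vne[OF l] by simp
  qed
  then obtain c l1 where c: "(\<Sum>l\<in>L. c l *\<^sub>R ?u l) = 0" and l1: "l1 \<in> L" "c l1 \<noteq> 0"
    unfolding indep_family_def by blast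
  \<comment> \<open>\<open>Q\<close> acts on \<open>v l\<close> as \<open>a1 - a2 * l\<close> times
    \<open>P1\<close>. If this factor vanishes at a node, the vector of that node is in the kernel;
    otherwise dividing the relation by the factors produces a kernel vector.\<close>
  obtain e where e: "e \<in> W" "e \<noteq> 0" "Q e = 0"
  proof (cases "\<exists>l\<in>L. a1 = a2 * l")
    case True
    then obtain l where l: "l \<in> L" "a1 = a2 * l" by blast
    then have "Q (v l) = 0" using Qv[of l] LU by auto
    then show thesis using that[of "v l"] vne l(1) vW LU by blast
  next
    case False
    define e where "e = (\<Sum>l\<in>L. (c l / (a1 - a2 * l)) *\<^sub>R v l)"
    have "Q e = (\<Sum>l\<in>L. c l *\<^sub>R ?u l)" unfolding e_def Qsum using False by (intro sum.cong) auto
    moreover have "e \<in> W" unfolding e_def using vW LU by (intro subspace_sum[OF sW] subspace_scale[OF sW]) auto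
    moreover have "e \<noteq> 0"
    proof
      assume "e = 0"
      then have "c l1 / (a1 - a2 * l1) = 0"
        using v_indep[unfolded indep_family_def, rule_format, of "\<lambda>l. c l / (a1 - a2 * l)" l1] l1 by (simp add: e_def)
      then show False using l1 False by auto
    qed
    ultimately show thesis using that c by simp
  qed
  have kerQ: "dim {x. Q x = 0} \<le> 1" using cork by (simp add: Q_def)
  have halfW: "DIM('e) \<le> 2 * dim W" using half by (simp add: dW cL)
  note dims = dim_isotropic_near_half[OF linQ skewQ sW isoQ kerQ e halfW]
  define Wp where "Wp = {y. \<forall>x\<in>W. x \<bullet> y = 0}"
  have dWp: "dim Wp + dim W = DIM('e)" unfolding Wp_def by (rule dim_orthogonal_complement[OF sW])
  have sWp: "subspace Wp" by (auto simp: Wp_def subspace_def inner_add_right)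
  \<comment> \<open>Isotropy gives one inclusion and the dimension count equality. So the
    \<open>P1 (v l)\<close> span at least \<open>card L - 1\<close> dimensions, and only one
    relation holds between them.\<close>
  have "Q ` W = Wp"
    by (rule subspace_dim_equal[OF linear_subspace_image[OF linQ sW] sWp])
      (use isoQ dims dWp in \<open>auto simp: Wp_def inner_commute\<close>)
  moreover have "Q ` W \<subseteq> span (?u ` L)"
  proof
    fix y assume "y \<in> Q ` W"
    then obtain x where x: "x \<in> W" "y = Q x" by blast
    then obtain q where "x = (\<Sum>l\<in>L. q l *\<^sub>R v l)" using span_image_sum[OF finL injL, of x] unfolding W_def by blast
    then show "y \<in> span (?u ` L)" unfolding x(2) by (simp only: Qsum) (intro span_sum span_scale span_base, auto)
  qed
  moreover have "span (?u ` L) \<subseteq> span (?u ` (L - {l1}))"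
  proof (rule span_minimal[OF _ subspace_span], rule image_subsetI)
    fix l assume l: "l \<in> L"
    show "?u l \<in> span (?u ` (L - {l1}))"
    proof (cases "l = l1")
      case True
      have "c l1 *\<^sub>R ?u l1 = - (\<Sum>l\<in>L - {l1}. c l *\<^sub>R ?u l)"
        using c by (simp add: sum.remove[OF finL l1(1)] add_eq_0_iff2)
      also have "\<dots> \<in> span (?u ` (L - {l1}))" by (intro span_neg span_sum span_scale span_base) auto
      finally have "inverse (c l1) *\<^sub>R c l1 *\<^sub>R ?u l1 \<in> span (?u ` (L - {l1}))" by (rule span_scale)
      then show ?thesis using l1(2) True by simp
    qed (use l in \<open>auto intro: span_base\<close>)
  qed
  ultimately have u_indep: "indep_family (L - {l1}) ?u"
    by (intro indep_family_if_spanning[of _ Wp]) (use dims dWp dW finL l1 in auto)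
  \<comment> \<open>If the coefficient at \<open>l2\<close> vanished, the single relation would
    force \<open>x l2 = 0\<close> in the expansion of every \<open>v \<mu>\<close> off the nodes,
    and continuity would put \<open>v l2\<close> into the span of the other basis vectors.\<close>
  have cne: "c l2 \<noteq> 0" if l2: "l2 \<in> L" for l2
  proof
    assume c2: "c l2 = 0"
    have mem: "v \<mu> \<in> span (v ` (L - {l2}))" if mu: "\<mu> \<in> U - L" for \<mu>
    proof -
      obtain x where x: "v \<mu> = (\<Sum>l\<in>L. x l *\<^sub>R v l)"
        using span_image_sum[OF finL injL vW[unfolded W_def, of \<mu>]] mu by blast
      \<comment> \<open>This multiple of the relation cancels the coefficient at \<open>l1\<close>,
        after which independence of the remaining vectors applies.\<close>
      define t where "t = x l1 * (\<mu> - l1) / c l1"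
      have "(\<Sum>l\<in>L. (x l * (\<mu> - l) - t * c l) *\<^sub>R ?u l) = (\<Sum>l\<in>L. (x l * (\<mu> - l)) *\<^sub>R ?u l) - t *\<^sub>R (\<Sum>l\<in>L. c l *\<^sub>R ?u l)"
        by (simp add: scaleR_diff_left sum_subtractf scaleR_sum_right)
      also have "\<dots> = 0" using expand[OF _ x] mu c by simp
      finally have "(\<Sum>l\<in>L - {l1}. (x l * (\<mu> - l) - t * c l) *\<^sub>R ?u l) = 0"
        using l1(2) by (simp add: sum.remove[OF finL l1(1)] t_def)
      moreover have "l2 \<in> L - {l1}" using l2 c2 l1(2) by auto
      ultimately have "x l2 * (\<mu> - l2) - t * c l2 = 0"
        using u_indep[unfolded indep_family_def, rule_format, of "\<lambda>l. x l * (\<mu> - l) - t * c l" l2] by blast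
      then have "x l2 = 0" using c2 mu l2 by auto
      then have "v \<mu> = (\<Sum>l\<in>L - {l2}. x l *\<^sub>R v l)" using x by (simp add: sum.remove[OF finL l2])
      then show ?thesis by (simp only:) (intro span_sum span_scale span_base, auto)
    qed
    have "v l2 \<in> span (v ` (L - {l2}))"
      by (rule continuous_closed_cofinite[OF U cont finL closed_span mem]) (use l2 LU in auto)
    moreover have "v ` (L - {l2}) = B - {v l2}"
      using injL l2 vL by (auto simp: inj_on_def)
    ultimately have sp: "v l2 \<in> span (B - {v l2})" by simp
    have "v l2 \<in> B" using l2 vL by blast
    from bexI[of "\<lambda>a. a \<in> span (B - {a})", OF sp this] have "dependent B" by (simp only: dependent_def)
    then show False using B(2) by simp
  qed
  \<comment> \<open>Absorbing the nonzero coefficients brings the relation into the normalized form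
    with coefficients \<open>1\<close>.\<close>
  define v' where "v' l = c l *\<^sub>R v l" for l
  have Pv': "P1 (v' l) = c l *\<^sub>R ?u l" "P2 (v' l) = c l *\<^sub>R P2 (v l)" for l
    by (simp_all add: v'_def linear_scale[OF lin1] linear_scale[OF lin2])
  interpret kronecker_frame P1 P2 L v' l1
  proof
    show "indep_family L v'" unfolding indep_family_def
    proof (intro allI impI ballI)
      fix x l assume "(\<Sum>l\<in>L. x l *\<^sub>R v' l) = 0" "l \<in> L"
      then have "x l * c l = 0"
        using v_indep[unfolded indep_family_def, rule_format, of "\<lambda>l. x l * c l" l] by (simp add: v'_def)
      then show "x l = 0" using cne \<open>l \<in> L\<close> by simp
    qed
    show "indep_family (L - {l1}) (\<lambda>l. P1 (v' l))" unfolding indep_family_def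
    proof (intro allI impI ballI)
      fix x l assume "(\<Sum>l\<in>L - {l1}. x l *\<^sub>R P1 (v' l)) = 0" and l: "l \<in> L - {l1}"
      then have "x l * c l = 0"
        using u_indep[unfolded indep_family_def, rule_format, of "\<lambda>l. x l * c l" l] by (simp add: Pv')
      then show "x l = 0" using cne l by simp
    qed
    show "(\<Sum>l\<in>L. P1 (v' l)) = 0" using c by (simp add: Pv')
    show "P1 (v' l) \<bullet> v' m = 0" if "l \<in> L" "m \<in> L" for l m
      using iso[of l m] that LU by (auto simp: Pv' v'_def[of m])
    show "P2 (v' l) = - (l *\<^sub>R P1 (v' l))" if "l \<in> L" for l
      using P2v[of l] that LU by (auto simp: Pv')
  qed (use skew1 skew2 finL l1 in \<open>auto simp: linear_add[OF lin1] linear_scale[OF lin1] linear_add[OF lin2] linear_scale[OF lin2]\<close>)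
  have n: "DIM('e) = 2 * card L - 1" and k: "card L \<ge> 1"
    using dims dW by auto
  show thesis
  proof (rule kronecker_basis)
    fix w :: "nat \<Rightarrow> 'e" assume w: "indep_family {..<2 * card L - 1} w"
      "\<And>i j. i < 2 * card L - 1 \<Longrightarrow> j < 2 * card L - 1 \<Longrightarrow>
        P1 (w i) \<bullet> w j = (if even i \<and> j = Suc i then 1 else if even j \<and> i = Suc j then - 1 else 0)"
      "\<And>i j. i < 2 * card L - 1 \<Longrightarrow> j < 2 * card L - 1 \<Longrightarrow>
        P2 (w i) \<bullet> w j = (if odd i \<and> j = Suc i then 1 else if odd j \<and> i = Suc j then - 1 else 0)"
    show thesis by (rule that[OF k n w])
  qed
qed

section \<open>Brackets in a chart\<close>

lemma
  assumes "smooth_manifold X A" "(V, \<phi>) \<in> A"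
  shows chart_openin: "openin X V" and chart_open_image: "open (\<phi> ` V)"
    and chart_homeo: "homeomorphic_map (subtopology X V) (top_of_set (\<phi> ` V)) \<phi>"
  using assms unfolding smooth_manifold_def by fast+

lemma chart_transition:
  assumes "smooth_manifold X A" "(V, \<phi>) \<in> A" "(W, \<psi>) \<in> A"
  shows "Cinf_on (\<phi> ` (V \<inter> W)) (\<psi> \<circ> inv_into V \<phi>)"
  using assms unfolding smooth_manifold_def by fast

lemma chart_topspace:
  assumes "smooth_manifold X A" "(V, \<phi>) \<in> A"
  shows "V \<subseteq> topspace X" "topspace (subtopology X V) = V"
  using openin_subset[OF chart_openin[OF assms]] by auto

lemma chart_inj_on:
  assumes "smooth_manifold X A" "(V, \<phi>) \<in> A"
  shows "inj_on \<phi> V"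
  using homeomorphic_imp_injective_map[OF chart_homeo[OF assms]] chart_topspace(2)[OF assms] by simp

lemma chart_inv:
  assumes "smooth_manifold X A" "(V, \<phi>) \<in> A"
  shows "x \<in> V \<Longrightarrow> inv_into V \<phi> (\<phi> x) = x"
  using chart_inj_on[OF assms] by simp

lemma open_chart_image:
  assumes "smooth_manifold X A" "(V, \<phi>) \<in> A" "openin X U"
  shows "open (\<phi> ` (U \<inter> V))"
proof -
  have "openin (subtopology X V) (U \<inter> V)" using assms(3) by (auto simp: openin_subtopology)
  then have "openin (top_of_set (\<phi> ` V)) (\<phi> ` (U \<inter> V))"
    using homeomorphic_imp_open_map[OF chart_homeo[OF assms(1,2)]] unfolding open_map_def by blast
  then show ?thesis using chart_open_image[OF assms(1,2)] openin_open_trans by blast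
qed

lemma openin_chart_preimage:
  assumes "smooth_manifold X A" "(V, \<phi>) \<in> A" "open T"
  shows "openin X (V \<inter> \<phi> -` T)"
proof -
  have "continuous_map (subtopology X V) (top_of_set (\<phi> ` V)) \<phi>"
    by (rule homeomorphic_imp_continuous_map[OF chart_homeo[OF assms(1,2)]])
  moreover have "openin (top_of_set (\<phi> ` V)) (\<phi> ` V \<inter> T)" using assms(3) by (simp add: openin_open_Int)
  ultimately have "openin (subtopology X V) {x \<in> topspace (subtopology X V). \<phi> x \<in> \<phi> ` V \<inter> T}"
    by (rule openin_continuous_map_preimage)
  moreover have "{x \<in> topspace (subtopology X V). \<phi> x \<in> \<phi> ` V \<inter> T} = V \<inter> \<phi> -` T"
    unfolding chart_topspace(2)[OF assms(1,2)] by auto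
  ultimately show ?thesis using openin_trans_full[OF _ chart_openin[OF assms(1,2)]] by simp
qed

lemma smooth_funsD: "f \<in> smooth_funs A U \<Longrightarrow> (V, \<phi>) \<in> A \<Longrightarrow> Cinf_on (\<phi> ` (U \<inter> V)) (f \<circ> inv_into V \<phi>)"
  unfolding smooth_funs_def by fast

lemma smooth_funsI: "(\<And>V \<phi>. (V, \<phi>) \<in> A \<Longrightarrow> Cinf_on (\<phi> ` (U \<inter> V)) (f \<circ> inv_into V \<phi>)) \<Longrightarrow> f \<in> smooth_funs A U"
  unfolding smooth_funs_def by fast

lemma smooth_funs_chart_change:
  assumes M: "smooth_manifold X A" and V: "(V, \<phi>) \<in> A" and U: "openin X U" "U \<subseteq> V"
    and f: "Cinf_on (\<phi> ` U) (f \<circ> inv_into V \<phi>)"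
  shows "f \<in> smooth_funs A U"
proof (rule smooth_funsI)
  fix W \<psi> assume W: "(W, \<psi>) \<in> A"
  have UV: "U \<inter> V = U" using U by auto
  have op: "open (\<psi> ` (U \<inter> W))" "open (\<phi> ` U)"
    using open_chart_image[OF M W U(1)] open_chart_image[OF M V U(1)] by (simp_all add: UV)
  have "Cinf_on (\<psi> ` (U \<inter> W)) (\<lambda>y. (f \<circ> inv_into V \<phi>) ((\<phi> \<circ> inv_into W \<psi>) y))"
  proof (rule Cinf_on_compose[OF op _ f])
    show "(\<phi> \<circ> inv_into W \<psi>) y \<in> \<phi> ` U" if "y \<in> \<psi> ` (U \<inter> W)" for y
      using that chart_inv[OF M W] by auto
    show "Cinf_on (\<psi> ` (U \<inter> W)) (\<phi> \<circ> inv_into W \<psi>)"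
      by (rule Cinf_on_subset[OF chart_transition[OF M W V]]) (use U in auto)
  qed
  then show "Cinf_on (\<psi> ` (U \<inter> W)) (f \<circ> inv_into W \<psi>)"
    by (rule Cinf_on_cong[OF op(1), rotated]) (use U chart_inv[OF M W] chart_inv[OF M V] in auto)
qed

lemma smooth_funs_local:
  assumes M: "smooth_manifold X A"
    and "\<And>x. x \<in> U \<Longrightarrow> \<exists>U'. openin X U' \<and> x \<in> U' \<and> f \<in> smooth_funs A U'"
  shows "f \<in> smooth_funs A U"
proof (rule smooth_funsI, rule Cinf_on_local)
  fix V \<phi> y assume V: "(V, \<phi>) \<in> A" and "y \<in> \<phi> ` (U \<inter> V)"
  then obtain x where x: "x \<in> U" "x \<in> V" "y = \<phi> x" by auto
  then obtain U' where U': "openin X U'" "x \<in> U'" "f \<in> smooth_funs A U'" using assms(2) by blast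
  show "\<exists>T. open T \<and> y \<in> T \<and> Cinf_on T (f \<circ> inv_into V \<phi>)"
    using open_chart_image[OF M V U'(1)] smooth_funsD[OF U'(3) V] U'(2) x by (intro exI[of _ "\<phi> ` (U' \<inter> V)"]) auto
qed

lemma smooth_funs_const: "(\<lambda>x. c) \<in> smooth_funs A U"
  by (rule smooth_funsI) (simp add: comp_def Cinf_on_const)

lemma smooth_funs_mult:
  assumes "smooth_manifold X A" "openin X U" "f \<in> smooth_funs A U" "g \<in> smooth_funs A U"
  shows "(\<lambda>x. f x * g x) \<in> smooth_funs A U"
proof (rule smooth_funsI)
  fix V \<phi> assume V: "(V, \<phi>) \<in> A"
  show "Cinf_on (\<phi> ` (U \<inter> V)) ((\<lambda>x. f x * g x) \<circ> inv_into V \<phi>)"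
    using Cinf_on_mult[OF open_chart_image[OF assms(1) V assms(2)] smooth_funsD[OF assms(3) V] smooth_funsD[OF assms(4) V]]
    by (simp add: comp_def)
qed

lemma smooth_funs_lincomb:
  assumes "smooth_manifold X A" "openin X U" "f \<in> smooth_funs A U" "g \<in> smooth_funs A U"
  shows "(\<lambda>x. a * f x + b * g x) \<in> smooth_funs A U"
proof (rule smooth_funsI)
  fix V \<phi> assume V: "(V, \<phi>) \<in> A"
  note op = open_chart_image[OF assms(1) V assms(2)]
  show "Cinf_on (\<phi> ` (U \<inter> V)) ((\<lambda>x. a * f x + b * g x) \<circ> inv_into V \<phi>)"
    using Cinf_on_add[OF op Cinf_on_mult[OF op Cinf_on_const smooth_funsD[OF assms(3) V]]
        Cinf_on_mult[OF op Cinf_on_const smooth_funsD[OF assms(4) V]]]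
    by (simp add: comp_def)
qed

lemma smooth_funs_sum:
  assumes "smooth_manifold X A" "openin X U" "\<And>i. i \<in> I \<Longrightarrow> f i \<in> smooth_funs A U"
  shows "(\<lambda>x. \<Sum>i\<in>I. f i x) \<in> smooth_funs A U"
  using assms(3)
proof (induction I rule: infinite_finite_induct)
  case (insert i I)
  then show ?case using smooth_funs_lincomb[OF assms(1,2), of "f i" "\<lambda>x. \<Sum>i\<in>I. f i x" 1 1] by simp
qed (auto intro: smooth_funs_const)

section \<open>Gradients and covectors in a fixed chart\<close>

locale manifold_chart =
  fixes X :: "'a topology" and A :: "('a, 'e::euclidean_space) chart set"
    and V :: "'a set" and \<phi> :: "'a \<Rightarrow> 'e"
  assumes M: "smooth_manifold X A" and V: "(V, \<phi>) \<in> A"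
begin

abbreviation "M \<equiv> topspace X"
abbreviation "C \<equiv> smooth_funs A M"
abbreviation "inv_chart \<equiv> inv_into V \<phi>"

lemma VM: "x \<in> V \<Longrightarrow> x \<in> M" using chart_topspace(1)[OF M V] by blast

lemmas inv_chart = chart_inv[OF M V]
lemmas open_V = chart_open_image[OF M V]

definition gradient :: "('a \<Rightarrow> real) \<Rightarrow> 'a \<Rightarrow> 'e" where
  "gradient f m = (\<Sum>b\<in>Basis. frechet_derivative (f \<circ> inv_chart) (at (\<phi> m)) b *\<^sub>R b)"

text \<open>The components in the chart \<open>\<phi>\<close> of the tangent vector that is represented in another chart.\<close>

definition rep_vec :: "'a \<Rightarrow> ('a, 'e) tangent_rep \<Rightarrow> 'e" where
  "rep_vec m = (\<lambda>((W, \<psi>), v). if (W, \<psi>) \<in> A \<and> m \<in> W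
     then frechet_derivative (\<phi> \<circ> inv_into W \<psi>) (at (\<psi> m)) v else 0)"

text \<open>Going through \<open>rep_vec\<close> gives values on representatives in all charts, so
  that \<open>differential\<close> can be matched as a function.\<close>

definition covec :: "'a \<Rightarrow> 'e \<Rightarrow> ('a, 'e) tangent_rep \<Rightarrow> real" where
  "covec m a = (\<lambda>r. a \<bullet> rep_vec m r)"

lemma rep_vec_chart:
  assumes "m \<in> V"
  shows "rep_vec m ((V, \<phi>), v) = v"
proof -
  have "((\<phi> \<circ> inv_chart) has_derivative (\<lambda>v. v)) (at (\<phi> m))"
    by (rule has_derivative_transform_within_open[OF has_derivative_ident open_V])
      (use assms in \<open>auto simp: inv_chart\<close>)
  then show ?thesis using assms V by (simp add: rep_vec_def frechet_derivative_at[symmetric])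
qed

lemma covec_inj: "m \<in> V \<Longrightarrow> covec m a = covec m b \<Longrightarrow> a = b"
  by (rule euclidean_eqI) (metis covec_def rep_vec_chart)

lemma smooth_has_derivative:
  assumes "openin X U" "f \<in> smooth_funs A U" "m \<in> U" "m \<in> V"
  shows "((f \<circ> inv_chart) has_derivative (\<lambda>v. gradient f m \<bullet> v)) (at (\<phi> m))"
proof -
  have d: "((f \<circ> inv_chart) has_derivative frechet_derivative (f \<circ> inv_chart) (at (\<phi> m))) (at (\<phi> m))"
    by (rule Cinf_on_has_derivative[OF smooth_funsD[OF assms(2) V]]) (use assms in auto)
  have "frechet_derivative (f \<circ> inv_chart) (at (\<phi> m)) v = gradient f m \<bullet> v" for v
    by (subst linear_eq_sum_Basis[OF has_derivative_linear[OF d]])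
      (simp add: gradient_def inner_sum_left inner_commute[of v] mult.commute)
  then show ?thesis using d by (metis (no_types, lifting) ext)
qed

lemma gradientI:
  assumes "((f \<circ> inv_chart) has_derivative (\<lambda>v. a \<bullet> v)) (at (\<phi> m))"
  shows "gradient f m = a"
  unfolding gradient_def frechet_derivative_at[OF assms, symmetric] by (rule euclidean_representation)

lemma differential_eq_covec:
  assumes U: "openin X U" "f \<in> smooth_funs A U" "m \<in> U" "m \<in> V"
  shows "differential A f m = covec m (gradient f m)"
proof
  fix t :: "('a, 'e) tangent_rep"
  obtain W \<psi> v where t: "t = ((W, \<psi>), v)" by (metis prod.exhaust)
  show "differential A f m t = covec m (gradient f m) t"
  proof (cases "(W, \<psi>) \<in> A \<and> m \<in> W")
    case True
    then have W: "(W, \<psi>) \<in> A" "m \<in> W" by auto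
    have pm: "\<psi> m \<in> \<psi> ` (W \<inter> V)" using W U by auto
    have 1: "((\<phi> \<circ> inv_into W \<psi>) has_derivative frechet_derivative (\<phi> \<circ> inv_into W \<psi>) (at (\<psi> m))) (at (\<psi> m))"
      by (rule Cinf_on_has_derivative[OF chart_transition[OF M W(1) V] pm])
    have e: "(\<phi> \<circ> inv_into W \<psi>) (\<psi> m) = \<phi> m" using chart_inv[OF M W] by simp
    have "((\<lambda>y. (f \<circ> inv_chart) ((\<phi> \<circ> inv_into W \<psi>) y)) has_derivative
        (\<lambda>v. gradient f m \<bullet> frechet_derivative (\<phi> \<circ> inv_into W \<psi>) (at (\<psi> m)) v)) (at (\<psi> m))"
      by (rule has_derivative_compose[OF 1]) (simp only: e smooth_has_derivative[OF U])
    then have "((f \<circ> inv_into W \<psi>) has_derivative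
        (\<lambda>v. gradient f m \<bullet> frechet_derivative (\<phi> \<circ> inv_into W \<psi>) (at (\<psi> m)) v)) (at (\<psi> m))"
    proof (rule has_derivative_transform_within_open)
      show "open (\<psi> ` (V \<inter> W))" by (rule open_chart_image[OF M W(1) chart_openin[OF M V]])
    qed (use pm in \<open>auto simp: chart_inv[OF M W(1)] inv_chart\<close>)
    then show ?thesis
      using W by (simp add: t differential_def covec_def rep_vec_def frechet_derivative_at[symmetric])
  next
    case False then show ?thesis by (simp only: t differential_def covec_def rep_vec_def prod.case if_False inner_zero_right)
  qed
qed

definition chart_ext :: "('e \<Rightarrow> real) \<Rightarrow> 'a \<Rightarrow> real" where
  "chart_ext g x = (if x \<in> V then g (\<phi> x) else 0)"

lemma chart_ext_inv: "y \<in> \<phi> ` V \<Longrightarrow> (chart_ext g \<circ> inv_chart) y = g y"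
  by (auto simp: chart_ext_def inv_chart)

text \<open>The ball has a compact preimage, closed because the manifold is Hausdorff. The extension
  is zero on the open complement, so nothing can go wrong at the boundary of
  \<open>V\<close>.\<close>

lemma chart_ext_smooth:
  assumes g: "Cinf_on UNIV g" and supp: "\<And>y. y \<notin> cball c r \<Longrightarrow> g y = 0" and r: "cball c r \<subseteq> \<phi> ` V"
  shows "chart_ext g \<in> C"
proof (rule smooth_funs_local[OF M])
  define K where "K = V \<inter> \<phi> -` cball c r"
  have "\<phi> ` K = cball c r" using r by (auto simp: K_def)
  then have "compactin (top_of_set (\<phi> ` V)) (\<phi> ` K)" using r by (simp add: compactin_subtopology)
  then have "compactin (subtopology X V) K"
    using homeomorphic_map_compactness[OF chart_homeo[OF M V], of K] chart_topspace(2)[OF M V] by (auto simp: K_def)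
  then have "closedin X K"
    using M compactin_imp_closedin[of X K] by (auto simp: compactin_subtopology smooth_manifold_def)
  then have oK: "openin X (M - K)" by blast
  fix x assume x: "x \<in> M"
  show "\<exists>U'. openin X U' \<and> x \<in> U' \<and> chart_ext g \<in> smooth_funs A U'"
  proof (cases "x \<in> V")
    case True
    have "chart_ext g \<in> smooth_funs A V"
      by (rule smooth_funs_chart_change[OF M V chart_openin[OF M V] subset_refl])
        (rule Cinf_on_cong[OF open_V _ Cinf_on_subset[OF g subset_UNIV]], simp add: chart_ext_inv del: comp_apply)
    then show ?thesis using True chart_openin[OF M V] by blast
  next
    case False
    have "chart_ext g \<in> smooth_funs A (M - K)"
    proof (rule smooth_funsI)
      fix W \<psi> assume W: "(W, \<psi>) \<in> A"
      show "Cinf_on (\<psi> ` ((M - K) \<inter> W)) (chart_ext g \<circ> inv_into W \<psi>)"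
      proof (rule Cinf_on_cong[OF open_chart_image[OF M W oK] _ Cinf_on_const])
        fix y assume "y \<in> \<psi> ` ((M - K) \<inter> W)"
        then obtain z where z: "z \<in> M - K" "z \<in> W" "y = \<psi> z" by auto
        then show "0 = (chart_ext g \<circ> inv_into W \<psi>) y"
          using supp[of "\<phi> z"] by (auto simp: chart_inv[OF M W] chart_ext_def K_def)
      qed
    qed
    then show ?thesis using False x oK by (intro exI[of _ "M - K"]) (auto simp: K_def)
  qed
qed

lemma chart_ext_has_derivative:
  assumes "m \<in> V" "(g has_derivative g') (at (\<phi> m))"
  shows "((chart_ext g \<circ> inv_chart) has_derivative g') (at (\<phi> m))"
  by (rule has_derivative_transform_within_open[OF assms(2) open_V])
    (use assms(1) chart_ext_inv in \<open>auto simp del: comp_apply\<close>)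

end

text \<open>Abstracts a bracket with one argument and the point fixed. The first clause is there
  because functions live on the whole type while only their values on the manifold count.\<close>

definition point_derivation :: "'a topology \<Rightarrow> ('a, 'e::euclidean_space) chart set \<Rightarrow> 'a \<Rightarrow> (('a \<Rightarrow> real) \<Rightarrow> real) \<Rightarrow> bool" where
  "point_derivation X A m D \<longleftrightarrow> (let M = topspace X; C = smooth_funs A M in
     (\<forall>f\<in>C. \<forall>f'\<in>C. (\<forall>x\<in>M. f x = f' x) \<longrightarrow> D f = D f') \<and>
     (\<forall>f\<in>C. \<forall>g\<in>C. \<forall>a b. D (\<lambda>y. a * f y + b * g y) = a * D f + b * D g) \<and>
     (\<forall>f\<in>C. \<forall>g\<in>C. D (\<lambda>y. f y * g y) = D f * g m + f m * D g))"

text \<open>Nested cut-offs: \<open>\<eta>\<close> is \<open>1\<close> where the bivector is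
  computed and vanishes outside the region where \<open>\<theta>\<close> is \<open>1\<close>;
  \<open>\<theta>\<close> serves to extend functions from the chart to the Euclidean space. The
  margin up to \<open>r\<close> keeps both supports inside the chart.\<close>

locale bump_chart = manifold_chart X A V \<phi>
  for X :: "'a topology" and A :: "('a, 'e::euclidean_space) chart set"
    and V :: "'a set" and \<phi> :: "'a \<Rightarrow> 'e" +
  fixes c :: 'e and r :: real and \<eta> \<theta> :: "'e \<Rightarrow> real"
  assumes r: "r > 0" "cball c r \<subseteq> \<phi> ` V"
    and eta: "Cinf_on UNIV \<eta>" "\<And>y. dist c y \<le> r / 4 \<Longrightarrow> \<eta> y = 1" "\<And>y. dist c y \<ge> r / 3 \<Longrightarrow> \<eta> y = 0"
    and theta: "Cinf_on UNIV \<theta>" "\<And>y. dist c y \<le> r / 2 \<Longrightarrow> \<theta> y = 1" "\<And>y. dist c y \<ge> 3 * r / 4 \<Longrightarrow> \<theta> y = 0"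
begin

definition O_dom :: "'a set" where "O_dom = V \<inter> \<phi> -` ball c (r / 4)"

lemma openin_O: "openin X O_dom"
  unfolding O_dom_def by (rule openin_chart_preimage[OF M V open_ball])

lemma O_V: "m \<in> O_dom \<Longrightarrow> m \<in> V" by (simp add: O_dom_def)

lemma O_M: "m \<in> O_dom \<Longrightarrow> m \<in> M" using O_V VM by blast

lemma O_image: "\<phi> ` O_dom = ball c (r / 4)"
proof -
  have "ball c (r / 4) \<subseteq> cball c r" using r by auto
  then have "ball c (r / 4) \<subseteq> \<phi> ` V" using r(2) by blast
  then show ?thesis by (auto simp: O_dom_def)
qed

lemma cut_smooth:
  assumes "Cinf_on UNIV g"
  shows "chart_ext (\<lambda>y. \<eta> y * g y) \<in> C"
proof (rule chart_ext_smooth[OF _ _ r(2)])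
  show "Cinf_on UNIV (\<lambda>y. \<eta> y * g y)" by (intro Cinf_on_mult eta assms open_UNIV)
  show "\<eta> y * g y = 0" if "y \<notin> cball c r" for y using that r eta(3)[of y] by auto
qed

lemma cut_derivative:
  assumes "m \<in> O_dom" "(g has_derivative g') (at (\<phi> m))"
  shows "((chart_ext (\<lambda>y. \<eta> y * g y) \<circ> inv_chart) has_derivative g') (at (\<phi> m))"
  by (rule chart_ext_has_derivative[OF O_V[OF assms(1)]],
      rule has_derivative_transform_within_open[OF assms(2) open_ball[of c "r / 4"]])
    (use assms(1) eta(2) in \<open>auto simp: O_dom_def\<close>)

definition coord :: "'e \<Rightarrow> 'a \<Rightarrow> real" where "coord a = chart_ext (\<lambda>y. \<eta> y * (y \<bullet> a))"

lemma Cinf_inner: "Cinf_on UNIV (\<lambda>y::'e. y \<bullet> a)"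
  by (intro Cinf_on_linear bounded_linear_inner_left open_UNIV)

lemma coord_smooth: "coord a \<in> C"
  unfolding coord_def by (rule cut_smooth[OF Cinf_inner])

lemma gradient_coord:
  assumes "m \<in> O_dom"
  shows "gradient (coord a) m = a"
  unfolding coord_def
  by (rule gradientI, rule cut_derivative[OF assms]) (auto intro!: derivative_eq_intros simp: inner_commute)

text \<open>Multiplying Hadamard's expansion of \<open>f - f m\<close> by \<open>\<eta>\<^sup>2\<close> makes it an identity between globally defined functions.\<close>

lemma point_derivation_eq:
  assumes D: "point_derivation X A m D" and m: "m \<in> O_dom" and f: "f \<in> C"
  shows "D f = (\<Sum>b\<in>Basis. (gradient f m \<bullet> b) * D (coord b))"
proof -
  have Dcong: "D f = D f'" if "f \<in> C" "f' \<in> C" "\<And>x. x \<in> M \<Longrightarrow> f x = f' x" for f f'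
    using D that unfolding point_derivation_def Let_def by blast
  have Dlin: "D (\<lambda>y. a * f y + b * g y) = a * D f + b * D g" if "f \<in> C" "g \<in> C" for f g a b
    using D that unfolding point_derivation_def Let_def by blast
  have Dmult: "D (\<lambda>y. f y * g y) = D f * g m + f m * D g" if "f \<in> C" "g \<in> C" for f g
    using D that unfolding point_derivation_def Let_def by blast
  note Cl = smooth_funs_lincomb[OF M openin_topspace] and Cm = smooth_funs_mult[OF M openin_topspace]
    and Cs = smooth_funs_sum[OF M openin_topspace]
  have D1: "D (\<lambda>_. k) = 0" for k
  proof -
    have "D (\<lambda>_. 1 * 1) = D (\<lambda>_. 1) * 1 + 1 * D (\<lambda>_. 1)" by (rule Dmult) (rule smooth_funs_const)+
    then have 1: "D (\<lambda>_. 1) = 0" by simp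
    have "D (\<lambda>_. k * 1 + 0 * 1) = k * D (\<lambda>_. 1) + 0 * D (\<lambda>_. 1)" by (rule Dlin) (rule smooth_funs_const)+
    then show ?thesis using 1 by simp
  qed
  have Dsum: "D (\<lambda>y. \<Sum>i\<in>I. h i y) = (\<Sum>i\<in>I. D (h i))" if "\<And>i. i \<in> I \<Longrightarrow> h i \<in> C" for I :: "'e set" and h
    using that
  proof (induction I rule: infinite_finite_induct)
    case (insert i I)
    have "D (\<lambda>y. 1 * h i y + 1 * (\<Sum>i\<in>I. h i y)) = 1 * D (h i) + 1 * D (\<lambda>y. \<Sum>i\<in>I. h i y)"
      by (rule Dlin) (use insert in \<open>auto intro: Cs\<close>)
    then show ?case using insert by simp
  qed (simp_all add: D1)
  let ?q = "\<phi> m"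
  have q: "dist c ?q < r / 4" "m \<in> V" using m by (auto simp: O_dom_def)
  have etaq: "\<eta> ?q = 1" using eta(2) q by simp
  let ?eta = "chart_ext \<eta>"
  define \<alpha> where "\<alpha> b = chart_ext (\<lambda>y. \<eta> y * ((y - ?q) \<bullet> b))" for b
  have eC: "?eta \<in> C" using cut_smooth[OF Cinf_on_const[of UNIV 1]] by simp
  have aC: "\<alpha> b \<in> C" for b unfolding \<alpha>_def
    by (rule cut_smooth) (simp add: inner_diff_left, intro Cinf_on_diff Cinf_inner Cinf_on_const open_UNIV)
  have main: "D f = (\<Sum>b\<in>Basis. (gradient f m \<bullet> b) * D (\<alpha> b))" if f: "f \<in> C" for f
  proof -
    \<comment> \<open>Hadamard's lemma needs a function on the whole Euclidean space; multiplying by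
      \<open>\<theta>\<close> provides one without changing \<open>f\<close> on the support of
      \<open>\<eta>\<close>.\<close>
    define h where "h y = \<theta> y * (f \<circ> inv_chart) y" for y
    have sm: "Cinf_on (\<phi> ` V) (f \<circ> inv_chart)"
      using smooth_funsD[OF f V] chart_topspace(1)[OF M V] by (simp add: Int_absorb1)
    have "Cinf_on UNIV h"
    proof (rule Cinf_on_local)
      fix y
      show "\<exists>T. open T \<and> y \<in> T \<and> Cinf_on T h"
      proof (cases "y \<in> \<phi> ` V")
        case True
        have "Cinf_on (\<phi> ` V) h" unfolding h_def
          by (intro Cinf_on_mult open_V Cinf_on_subset[OF theta(1)] sm) auto
        then show ?thesis using True open_V by blast
      next
        case False
        have op: "open {y. 3 * r / 4 < dist c y}" by (rule open_Collect_less) (auto intro: continuous_intros)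
        have "y \<notin> cball c r" using False r by blast
        then have "3 * r / 4 < dist c y" using r by simp
        moreover have "Cinf_on {y. 3 * r / 4 < dist c y} h"
          by (rule Cinf_on_cong[OF op _ Cinf_on_const[of _ 0]]) (simp add: h_def theta(3))
        ultimately show ?thesis using op by blast
      qed
    qed
    moreover have "h y = 0" if "norm c + r < norm y" for y
    proof -
      have "r \<le> dist c y" using that norm_triangle_ineq2[of y c] by (simp add: dist_norm norm_minus_commute)
      then show ?thesis using r by (simp add: h_def theta(3))
    qed
    ultimately have h: "test_fun h" unfolding test_fun_def by blast
    obtain g where g: "\<And>b. Cinf_on UNIV (g b)" "\<And>x. h x = h ?q + (\<Sum>b\<in>Basis. ((x - ?q) \<bullet> b) * g b x)"
      "\<And>b. g b ?q = frechet_derivative h (at ?q) b" using hadamard_factors[OF h] by metis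
    have "(h has_derivative (\<lambda>v. gradient f m \<bullet> v)) (at ?q)"
    proof (rule has_derivative_transform_within_open[OF smooth_has_derivative[OF openin_topspace f O_M[OF m] q(2)] open_ball[of c "r / 4"]])
      show "(f \<circ> inv_chart) y = h y" if "y \<in> ball c (r / 4)" for y using that r theta(2)[of y] by (simp add: h_def)
    qed (use q in simp)
    then have gq: "g b ?q = gradient f m \<bullet> b" for b by (simp add: g(3) frechet_derivative_at[symmetric])
    define \<beta> where "\<beta> b = chart_ext (\<lambda>y. \<eta> y * g b y)" for b
    have bC: "\<beta> b \<in> C" for b unfolding \<beta>_def by (rule cut_smooth[OF g(1)])
    define F where "F x = 1 * f x + (- f m) * 1" for x
    have FC: "F \<in> C" unfolding F_def[abs_def] by (rule Cl[OF f smooth_funs_const])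
    have eq: "F x * (?eta x * ?eta x) = (\<Sum>b\<in>Basis. \<alpha> b x * \<beta> b x)" if "x \<in> M" for x
    proof (cases "x \<in> V")
      case True
      have fm: "f m = h ?q" using q r theta(2)[of ?q] by (simp add: h_def inv_chart)
      have "F x * (\<eta> (\<phi> x) * \<eta> (\<phi> x)) = (h (\<phi> x) - h ?q) * (\<eta> (\<phi> x) * \<eta> (\<phi> x))"
      proof (cases "dist c (\<phi> x) \<ge> r / 3")
        case True then show ?thesis by (simp add: eta(3))
      next
        case False
        then show ?thesis using True r theta(2)[of "\<phi> x"] by (simp add: F_def fm h_def[of "\<phi> x"] inv_chart)
      qed
      also have "\<dots> = (\<Sum>b\<in>Basis. \<eta> (\<phi> x) * ((\<phi> x - ?q) \<bullet> b) * (\<eta> (\<phi> x) * g b (\<phi> x)))"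
        by (subst g(2)[of "\<phi> x"]) (simp add: sum_distrib_right sum_distrib_left algebra_simps)
      finally show ?thesis using True by (simp add: \<alpha>_def \<beta>_def chart_ext_def)
    qed (simp add: \<alpha>_def \<beta>_def chart_ext_def)
    have "D (\<lambda>x. F x * (?eta x * ?eta x)) = D (\<lambda>x. \<Sum>b\<in>Basis. \<alpha> b x * \<beta> b x)"
      by (rule Dcong) (auto intro!: Cm Cs FC eC aC bC eq)
    also have "\<dots> = (\<Sum>b\<in>Basis. D (\<alpha> b) * \<beta> b m + \<alpha> b m * D (\<beta> b))"
      by (subst Dsum) (auto intro!: Cm aC bC sum.cong Dmult)
    also have "\<dots> = (\<Sum>b\<in>Basis. (gradient f m \<bullet> b) * D (\<alpha> b))"
      using q by (intro sum.cong) (auto simp: \<alpha>_def \<beta>_def chart_ext_def etaq gq)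
    also have "D (\<lambda>x. F x * (?eta x * ?eta x)) = D F * (?eta m * ?eta m) + F m * D (\<lambda>x. ?eta x * ?eta x)"
      by (rule Dmult[OF FC Cm[OF eC eC]])
    also have "\<dots> = D F" using q by (simp add: F_def chart_ext_def etaq)
    also have "D F = 1 * D f + (- f m) * D (\<lambda>_. 1)" unfolding F_def[abs_def] by (rule Dlin[OF f smooth_funs_const])
    finally show ?thesis by (simp add: D1)
  qed
  \<comment> \<open>\<open>\<eta>\<close> is constant near the point, so \<open>D\<close> vanishes
    on it. Centred and uncentred coordinates differ by a multiple of it and get the same
    value.\<close>
  have "gradient ?eta m = 0"
    using cut_derivative[OF m has_derivative_const[of 1]] by (intro gradientI) simp
  then have De: "D ?eta = 0" using main[OF eC] by simp
  have "D (\<alpha> b) = D (coord b)" for b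
  proof -
    have "D (\<alpha> b) = D (\<lambda>x. 1 * coord b x + (- (?q \<bullet> b)) * ?eta x)"
      by (rule Dcong[OF aC Cl[OF coord_smooth eC]]) (simp add: \<alpha>_def coord_def chart_ext_def inner_diff_left algebra_simps)
    then show ?thesis using Dlin[OF coord_smooth eC, of 1 b "- (?q \<bullet> b)"] De by simp
  qed
  then show ?thesis using main[OF f] by simp
qed

text \<open>The Hamiltonian (sharp) map of the bivector, with covectors and vectors both identified
  with coordinate vectors through the inner product.\<close>

definition bivec :: "'a bracket \<Rightarrow> 'a \<Rightarrow> 'e \<Rightarrow> 'e" where
  "bivec B m a = (\<Sum>b\<in>Basis. \<Sum>c\<in>Basis. ((a \<bullet> b) * B (coord b) (coord c) m) *\<^sub>R c)"

lemma linear_bivec: "linear (bivec B m)"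
  unfolding bivec_def
  by (rule linearI) (simp_all add: inner_add_left algebra_simps sum.distrib scaleR_sum_right)

lemma bivec_inner: "bivec B m a \<bullet> d = (\<Sum>b\<in>Basis. \<Sum>c\<in>Basis. (a \<bullet> b) * B (coord b) (coord c) m * (c \<bullet> d))"
  by (simp add: bivec_def inner_sum_left)

end

section \<open>The bivector of a Poisson bracket\<close>

locale poisson_chart = bump_chart X A V \<phi> c r \<eta> \<theta>
  for X :: "'a topology" and A :: "('a, 'e::euclidean_space) chart set"
    and V :: "'a set" and \<phi> :: "'a \<Rightarrow> 'e" and c r \<eta> \<theta> +
  fixes B :: "'a bracket"
  assumes B: "poisson_bracket X A B"
begin

lemma
  shows bracket_smooth: "f \<in> C \<Longrightarrow> g \<in> C \<Longrightarrow> B f g \<in> C"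
    and bracket_cong: "\<lbrakk>f \<in> C; f' \<in> C; g \<in> C; g' \<in> C; \<And>x. x \<in> M \<Longrightarrow> f x = f' x; \<And>x. x \<in> M \<Longrightarrow> g x = g' x; x \<in> M\<rbrakk>
      \<Longrightarrow> B f g x = B f' g' x"
    and bracket_skew: "f \<in> C \<Longrightarrow> g \<in> C \<Longrightarrow> x \<in> M \<Longrightarrow> B f g x = - B g f x"
    and bracket_linear: "f \<in> C \<Longrightarrow> g \<in> C \<Longrightarrow> h \<in> C \<Longrightarrow> x \<in> M \<Longrightarrow>
      B (\<lambda>y. a * f y + b * g y) h x = a * B f h x + b * B g h x"
    and bracket_leibniz: "f \<in> C \<Longrightarrow> g \<in> C \<Longrightarrow> h \<in> C \<Longrightarrow> x \<in> M \<Longrightarrow>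
      B f (\<lambda>y. g y * h y) x = B f g x * h x + g x * B f h x"
    and bracket_jacobi: "f \<in> C \<Longrightarrow> g \<in> C \<Longrightarrow> h \<in> C \<Longrightarrow> x \<in> M \<Longrightarrow>
      B f (B g h) x + B g (B h f) x + B h (B f g) x = 0"
proof -
  note b = B[unfolded poisson_bracket_def Let_def]
  show "f \<in> C \<Longrightarrow> g \<in> C \<Longrightarrow> B f g \<in> C"
    using conjunct1[OF b] by simp
  note b = conjunct2[OF b]
  show "\<lbrakk>f \<in> C; f' \<in> C; g \<in> C; g' \<in> C; \<And>x. x \<in> M \<Longrightarrow> f x = f' x; \<And>x. x \<in> M \<Longrightarrow> g x = g' x; x \<in> M\<rbrakk>
      \<Longrightarrow> B f g x = B f' g' x"
    using conjunct1[OF b] by (elim ballE allE impE) auto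
  note b = conjunct2[OF b]
  show "f \<in> C \<Longrightarrow> g \<in> C \<Longrightarrow> x \<in> M \<Longrightarrow> B f g x = - B g f x"
    by (rule conjunct1[OF b, rule_format])
  note b = conjunct2[OF b]
  show "f \<in> C \<Longrightarrow> g \<in> C \<Longrightarrow> h \<in> C \<Longrightarrow> x \<in> M \<Longrightarrow>
      B (\<lambda>y. a * f y + b * g y) h x = a * B f h x + b * B g h x"
    by (rule conjunct1[OF b, rule_format])
  note b = conjunct2[OF b]
  show "f \<in> C \<Longrightarrow> g \<in> C \<Longrightarrow> h \<in> C \<Longrightarrow> x \<in> M \<Longrightarrow>
      B f (\<lambda>y. g y * h y) x = B f g x * h x + g x * B f h x"
    by (rule conjunct1[OF b, rule_format])
  note b = conjunct2[OF b]
  show "f \<in> C \<Longrightarrow> g \<in> C \<Longrightarrow> h \<in> C \<Longrightarrow> x \<in> M \<Longrightarrow>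
      B f (B g h) x + B g (B h f) x + B h (B f g) x = 0"
    by (rule b[rule_format])
qed

lemma bracket_point_derivation:
  assumes h: "h \<in> C" and m: "m \<in> M"
  shows "point_derivation X A m (\<lambda>f. B f h m)"
proof -
  have 1: "B f h m = B f' h m" if "f \<in> C" "f' \<in> C" "\<forall>x\<in>M. f x = f' x" for f f'
    by (rule bracket_cong[OF that(1,2) h h]) (use that(3) m in auto)
  have 2: "B (\<lambda>y. a * f y + b * g y) h m = a * B f h m + b * B g h m" if "f \<in> C" "g \<in> C" for f g a b
    by (rule bracket_linear[OF that h m])
  have 3: "B (\<lambda>y. f y * g y) h m = B f h m * g m + f m * B g h m" if fg: "f \<in> C" "g \<in> C" for f g
  proof -
    have "B (\<lambda>y. f y * g y) h m = - B h (\<lambda>y. f y * g y) m"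
      by (rule bracket_skew[OF smooth_funs_mult[OF M openin_topspace fg] h m])
    also have "B h (\<lambda>y. f y * g y) m = B h f m * g m + f m * B h g m"
      by (rule bracket_leibniz[OF h fg m])
    finally show ?thesis using bracket_skew[OF fg(1) h m] bracket_skew[OF fg(2) h m] by simp
  qed
  show ?thesis unfolding point_derivation_def Let_def using 1 2 3 by blast
qed

lemma bracket_eq_coord:
  assumes "f \<in> C" "h \<in> C" "m \<in> O_dom"
  shows "B f h m = (\<Sum>b\<in>Basis. (gradient f m \<bullet> b) * B (coord b) h m)"
  by (rule point_derivation_eq[OF bracket_point_derivation[OF assms(2) O_M[OF assms(3)]] assms(3,1)])

lemma bracket_eq_coord_right:
  assumes "f \<in> C" "h \<in> C" "m \<in> O_dom"
  shows "B f h m = (\<Sum>b\<in>Basis. (gradient h m \<bullet> b) * B f (coord b) m)"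
  using bracket_eq_coord[OF assms(2,1,3)] bracket_skew[OF assms(1,2) O_M[OF assms(3)]]
    bracket_skew[OF assms(1) coord_smooth O_M[OF assms(3)]]
  by (simp add: sum_negf)

lemma bracket_eq_bivec:
  assumes "f \<in> C" "h \<in> C" "m \<in> O_dom"
  shows "B f h m = bivec B m (gradient f m) \<bullet> gradient h m"
  unfolding bivec_inner
  by (subst bracket_eq_coord[OF assms], subst bracket_eq_coord_right[OF coord_smooth assms(2,3)])
    (simp add: sum_distrib_left mult_ac inner_commute)

lemma bivec_skew:
  assumes "m \<in> O_dom"
  shows "bivec B m a \<bullet> d = - (a \<bullet> bivec B m d)"
  using bracket_eq_bivec[OF coord_smooth coord_smooth assms, of a d] bracket_eq_bivec[OF coord_smooth coord_smooth assms, of d a]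
    bracket_skew[OF coord_smooth coord_smooth O_M[OF assms], of a d]
  by (simp add: gradient_coord[OF assms] inner_commute)

text \<open>The bracket depends on its arguments only through their gradients, so \<open>THE\<close>
  describes a unique value; cut-off linear coordinates realize every covector.\<close>

lemma covector_pairing_covec:
  assumes m: "m \<in> O_dom"
  shows "covector_pairing X A B m (covec m a) (covec m d) = bivec B m a \<bullet> d"
  unfolding covector_pairing_def
proof (rule the_equality)
  have dc: "differential A (coord a) m = covec m a" for a
    using differential_eq_covec[OF openin_topspace coord_smooth O_M[OF m] O_V[OF m]] by (simp add: gradient_coord[OF m])
  show "\<exists>f\<in>C. \<exists>g\<in>C. differential A f m = covec m a \<and> differential A g m = covec m d \<and> B f g m = bivec B m a \<bullet> d"
    using dc coord_smooth bracket_eq_bivec[OF coord_smooth coord_smooth m] gradient_coord[OF m] by metis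
next
  fix t assume "\<exists>f\<in>C. \<exists>g\<in>C. differential A f m = covec m a \<and> differential A g m = covec m d \<and> B f g m = t"
  then obtain f g where fg: "f \<in> C" "g \<in> C" "differential A f m = covec m a" "differential A g m = covec m d" "B f g m = t" by blast
  have "gradient f m = a" "gradient g m = d"
    using fg differential_eq_covec[OF openin_topspace _ O_M[OF m] O_V[OF m]] covec_inj[OF O_V[OF m]] by metis+
  then show "t = bivec B m a \<bullet> d" using bracket_eq_bivec[OF fg(1,2) m] fg(5) by simp
qed

lemma local_bracket_eq:
  assumes "openin X U" "f \<in> smooth_funs A U" "g \<in> smooth_funs A U" "m \<in> U" "m \<in> O_dom"
  shows "local_bracket X A B f g m = bivec B m (gradient f m) \<bullet> gradient g m"
  unfolding local_bracket_def differential_eq_covec[OF assms(1,2,4) O_V[OF assms(5)]]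
    differential_eq_covec[OF assms(1,3,4) O_V[OF assms(5)]]
  by (rule covector_pairing_covec[OF assms(5)])

end

lemma (in bump_chart) cotangent_space_eq:
  assumes m: "m \<in> O_dom"
  shows "cotangent_space X A m = range (covec m)"
proof -
  have "covec m a \<in> cotangent_space X A m" for a
    using differential_eq_covec[OF openin_topspace coord_smooth O_M[OF m] O_V[OF m], of a] coord_smooth
    unfolding cotangent_space_def gradient_coord[OF m] by (metis imageI)
  moreover have "cotangent_space X A m \<subseteq> range (covec m)"
    unfolding cotangent_space_def
    using differential_eq_covec[OF openin_topspace _ O_M[OF m] O_V[OF m]] by auto
  ultimately show ?thesis by auto
qed

section \<open>Casimir functions and corank\<close>

text \<open>Paired with a dual family at \<open>p\<close>, the vectors at nearby points give a
  matrix close to the identity. A relation is tested against the index of its largest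
  coefficient.\<close>

lemma eventually_indep_family:
  fixes u :: "'i \<Rightarrow> 'x::t2_space \<Rightarrow> 'e::euclidean_space"
  assumes I: "finite I" and cont: "\<And>i. i \<in> I \<Longrightarrow> isCont (u i) p"
    and ind: "indep_family I (\<lambda>i. u i p)"
  shows "\<forall>\<^sub>F y in nhds p. indep_family I (\<lambda>i. u i y)"
proof -
  obtain z where z: "\<And>l m. l \<in> I \<Longrightarrow> m \<in> I \<Longrightarrow> u l p \<bullet> z m = (if l = m then 1 else 0)"
    using dual_family_exists[OF I ind] by blast
  \<comment> \<open>\<open>card I\<close> terms of size at most \<open>K * \<epsilon>\<close> add up
    to at most half of the largest coefficient \<open>K\<close>; the added \<open>1\<close> avoids
    division by zero for empty \<open>I\<close>.\<close>
  define \<epsilon> where "\<epsilon> = 1 / (2 * (real (card I) + 1))"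
  have e: "\<epsilon> > 0" "real (card I) * \<epsilon> \<le> 1 / 2" by (auto simp: \<epsilon>_def field_simps)
  have "\<forall>\<^sub>F y in nhds p. \<bar>u l y \<bullet> z m - (if l = m then 1 else 0)\<bar> < \<epsilon>" if "l \<in> I" "m \<in> I" for l m
  proof -
    have "((\<lambda>y. \<bar>u l y \<bullet> z m - (if l = m then 1 else 0)\<bar>) \<longlongrightarrow> \<bar>u l p \<bullet> z m - (if l = m then 1 else 0)\<bar>) (nhds p)"
      using cont[OF that(1)] by (intro tendsto_intros) (simp add: isCont_def tendsto_at_iff_tendsto_nhds)
    then show ?thesis using z[OF that] e(1) by (intro order_tendstoD) auto
  qed
  then have "\<forall>\<^sub>F y in nhds p. \<forall>l\<in>I. \<forall>m\<in>I. \<bar>u l y \<bullet> z m - (if l = m then 1 else 0)\<bar> < \<epsilon>"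
    using I by (simp add: eventually_ball_finite_distrib)
  then show ?thesis
  proof eventually_elim
    case (elim y)
    show ?case unfolding indep_family_def
    proof (intro allI impI)
      fix c assume c: "(\<Sum>l\<in>I. c l *\<^sub>R u l y) = 0"
      show "\<forall>l\<in>I. c l = 0"
      proof (cases "I = {}")
        case False
        define K where "K = Max ((\<lambda>l. \<bar>c l\<bar>) ` I)"
        have K: "\<bar>c l\<bar> \<le> K" if "l \<in> I" for l using I that by (simp add: K_def)
        have "K \<in> (\<lambda>l. \<bar>c l\<bar>) ` I" unfolding K_def by (rule Max_in) (use I False in auto)
        then obtain m where m: "m \<in> I" "K = \<bar>c m\<bar>" by blast
        have "0 = (\<Sum>l\<in>I. c l *\<^sub>R u l y) \<bullet> z m" using c by simp
        also have "\<dots> = (\<Sum>l\<in>I. c l * (u l y \<bullet> z m - (if l = m then 1 else 0)) + (if l = m then c l else 0))"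
          unfolding inner_sum_left by (intro sum.cong) (auto simp: algebra_simps)
        also have "\<dots> = (\<Sum>l\<in>I. c l * (u l y \<bullet> z m - (if l = m then 1 else 0))) + c m"
          using I m by (simp add: sum.distrib)
        finally have "\<bar>c m\<bar> = \<bar>\<Sum>l\<in>I. c l * (u l y \<bullet> z m - (if l = m then 1 else 0))\<bar>" by simp
        also have "\<dots> \<le> (\<Sum>l\<in>I. K * \<epsilon>)"
        proof (rule order_trans[OF sum_abs sum_mono])
          fix l assume l: "l \<in> I"
          have "\<bar>u l y \<bullet> z m - (if l = m then 1 else 0)\<bar> \<le> \<epsilon>" using elim l m(1) by (intro less_imp_le) blast
          then show "\<bar>c l * (u l y \<bullet> z m - (if l = m then 1 else 0))\<bar> \<le> K * \<epsilon>"
            unfolding abs_mult using K[OF l] by (intro mult_mono) auto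
        qed
        also have "\<dots> = (real (card I) * \<epsilon>) * K" by simp
        also have "\<dots> \<le> 1 / 2 * K" using e(2) m(2) by (intro mult_right_mono) auto
        finally have "K \<le> 0" using m(2) by simp
        then show ?thesis using K by fastforce
      qed simp
    qed
  qed
qed

lemma indep_family_card_le_dim:
  fixes u :: "'i \<Rightarrow> 'e::euclidean_space"
  assumes "finite I" "indep_family I u" "u ` I \<subseteq> S"
  shows "card I \<le> dim S"
proof -
  have "card I = card (u ` I)" using card_image[OF indep_family_inj_on[OF assms(1,2)]] by simp
  also have "\<dots> = dim (u ` I)" by (rule dim_eq_card_independent[OF indep_family_independent[OF assms(1,2)], symmetric])
  also have "\<dots> \<le> dim S" by (rule dim_subset[OF assms(3)])
  finally show ?thesis .
qed

text \<open>Lower semicontinuity of the rank: fixed preimages of a basis of the range keep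
  independent images nearby.\<close>

lemma eventually_rank_ge:
  fixes Q :: "'x::t2_space \<Rightarrow> 'e::euclidean_space \<Rightarrow>\<^sub>L 'e"
  assumes "isCont Q p"
  shows "\<forall>\<^sub>F y in nhds p. dim (range (Q p)) \<le> dim (range (Q y))"
proof -
  obtain B where B: "B \<subseteq> range (Q p)" "independent B" "card B = dim (range (Q p))"
    by (rule basis_exists[of "range (blinfun_apply (Q p))"])
  have fin: "finite B" using B(2) by (rule independent_imp_finite)
  define a where "a b = (SOME a. b = Q p a)" for b
  have a: "Q p (a b) = b" if "b \<in> B" for b
    unfolding a_def by (rule someI2_ex) (use B(1) that in auto)
  have "indep_family B (\<lambda>b. b)"
    by (rule indep_familyI_independent[OF fin]) (simp_all add: B(2))
  then have "indep_family B (\<lambda>b. Q p (a b))"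
    unfolding indep_family_def by (simp add: a cong: sum.cong)
  then have "\<forall>\<^sub>F y in nhds p. indep_family B (\<lambda>b. Q y (a b))"
    by (rule eventually_indep_family[OF fin, rotated])
      (intro continuous_intros assms)
  then show ?thesis
  proof eventually_elim
    case (elim y)
    show ?case using indep_family_card_le_dim[OF fin elim, of "range (Q y)"] B(3) by auto
  qed
qed

lemma two_indep_in_subspace:
  fixes N :: "'e::euclidean_space set"
  assumes "2 \<le> dim N"
  shows "\<exists>e :: nat \<Rightarrow> 'e. (\<forall>i. e i \<in> N) \<and> indep_family {..<2} e"
proof -
  obtain B where B: "B \<subseteq> N" "independent B" "card B = dim N" by (rule basis_exists[of N])
  then have "2 \<le> card B" using assms by simp
  then obtain T where T: "T \<subseteq> B" "card T = 2" by (rule obtain_subset_with_card_n)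
  then obtain x y where xy: "T = {x, y}" "x \<noteq> y" using card_2_iff by metis
  define e where "e i = (if i = 0 then x else y)" for i :: nat
  have im: "e ` {..<2} = T" by (auto simp: e_def xy lessThan_nat_numeral lessThan_Suc)
  show ?thesis
  proof (intro exI[of _ e] conjI allI)
    show "e i \<in> N" for i using T xy B by (auto simp: e_def)
    have "independent (e ` {..<2})" unfolding im using B(2) T(1) by (rule independent_mono)
    moreover have "inj_on e {..<2}"
      using xy(2) by (auto simp: inj_on_def e_def less_2_cases_iff)
    ultimately show "indep_family {..<2} e"
      by (intro indep_familyI_independent finite_lessThan)
  qed
qed

section \<open>Involutivity and independent Casimir functions\<close>

context bump_chart
begin

text \<open>\<open>bivec\<close> as an operator-valued function of the coordinates, the form in
  which Frobenius' theorem is stated.\<close>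

definition bivec_map :: "'a bracket \<Rightarrow> 'e \<Rightarrow> 'e \<Rightarrow>\<^sub>L 'e" where
  "bivec_map B y = (\<Sum>b\<in>Basis. \<Sum>c\<in>Basis. B (coord b) (coord c) (inv_chart y) *\<^sub>R Blinfun (\<lambda>a. (a \<bullet> b) *\<^sub>R c))"

lemma bivec_map_apply: "bivec_map B y a = bivec B (inv_chart y) a"
proof -
  have bl: "bounded_linear (\<lambda>a. (a \<bullet> b) *\<^sub>R c)" for b c :: 'e
    by (rule bounded_linear_scaleR_const[OF bounded_linear_inner_left])
  show ?thesis
    by (simp add: bivec_map_def bivec_def blinfun.sum_left blinfun.scaleR_left bounded_linear_Blinfun_apply[OF bl] mult.commute)
qed

lemma bivec_map_phi: "m \<in> O_dom \<Longrightarrow> bivec_map B (\<phi> m) a = bivec B m a"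
  by (simp add: bivec_map_apply inv_chart O_V)

end

context poisson_chart
begin

lemma Cinf_bivec_map: "Cinf_on (ball c (r / 4)) (bivec_map B)"
proof -
  have "Cinf_on (ball c (r / 4)) (\<lambda>y. B (coord b) (coord d) (inv_chart y))" for b d
  proof -
    have "Cinf_on (\<phi> ` (M \<inter> V)) (B (coord b) (coord d) \<circ> inv_chart)"
      by (rule smooth_funsD[OF bracket_smooth[OF coord_smooth coord_smooth] V])
    moreover have "ball c (r / 4) \<subseteq> \<phi> ` (M \<inter> V)" using O_image O_V O_M by blast
    ultimately show ?thesis unfolding comp_def by (rule Cinf_on_subset)
  qed
  then show ?thesis unfolding bivec_map_def[abs_def]
    by (intro Cinf_on_sum Cinf_on_scaleR Cinf_on_const open_ball)
qed

lemma bivec_coord: "m \<in> O_dom \<Longrightarrow> bivec B m a \<bullet> d = B (coord a) (coord d) m"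
  using bracket_eq_bivec[OF coord_smooth coord_smooth] gradient_coord by metis

lemma bivec_map_derivative:
  assumes m: "m \<in> O_dom"
  shows "frechet_derivative (bivec_map B) (at (\<phi> m)) h a \<bullet> d = gradient (B (coord a) (coord d)) m \<bullet> h"
proof -
  have mb: "\<phi> m \<in> ball c (r / 4)" using m O_image by blast
  have "((\<lambda>y. bivec_map B y a \<bullet> d) has_derivative (\<lambda>h. frechet_derivative (bivec_map B) (at (\<phi> m)) h a \<bullet> d)) (at (\<phi> m))"
    by (intro has_derivative_inner_left bounded_linear.has_derivative[OF blinfun.bounded_linear_left] Cinf_on_has_derivative[OF Cinf_bivec_map mb])
  moreover have "((\<lambda>y. bivec_map B y a \<bullet> d) has_derivative (\<lambda>h. gradient (B (coord a) (coord d)) m \<bullet> h)) (at (\<phi> m))"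
  proof (rule has_derivative_transform_within_open[OF smooth_has_derivative[OF openin_topspace
        bracket_smooth[OF coord_smooth coord_smooth] O_M[OF m] O_V[OF m]] open_ball mb])
    fix y assume "y \<in> ball c (r / 4)"
    then obtain x where x: "x \<in> O_dom" "y = \<phi> x" using O_image by blast
    then show "(B (coord a) (coord d) \<circ> inv_chart) y = bivec_map B y a \<bullet> d"
      by (simp add: bivec_map_phi bivec_coord inv_chart O_V)
  qed
  ultimately show ?thesis using has_derivative_unique by metis
qed

text \<open>By the Jacobi identity for linear coordinates, the commutator of two Hamiltonian fields
  is the Hamiltonian field of the bracket, here \<open>?Q G\<close>.\<close>

lemma bivec_map_involutive:
  assumes m: "m \<in> O_dom"
  shows "frechet_derivative (bivec_map B) (at (\<phi> m)) (bivec_map B (\<phi> m) a) b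
    - frechet_derivative (bivec_map B) (at (\<phi> m)) (bivec_map B (\<phi> m) b) a \<in> range (bivec_map B (\<phi> m))"
proof -
  let ?D = "frechet_derivative (bivec_map B) (at (\<phi> m))" and ?Q = "bivec_map B (\<phi> m)"
  define G where "G = gradient (B (coord a) (coord b)) m"
  note cs = coord_smooth and bs = bracket_smooth[OF coord_smooth coord_smooth]
  have skewD: "gradient (B (coord d) (coord a)) m \<bullet> h = - (gradient (B (coord a) (coord d)) m \<bullet> h)" for d h
  proof -
    have "((B (coord d) (coord a) \<circ> inv_chart) has_derivative (\<lambda>v. gradient (B (coord d) (coord a)) m \<bullet> v)) (at (\<phi> m))"
      by (rule smooth_has_derivative[OF openin_topspace bs O_M[OF m] O_V[OF m]])
    moreover have "((B (coord d) (coord a) \<circ> inv_chart) has_derivative (\<lambda>v. - (gradient (B (coord a) (coord d)) m \<bullet> v))) (at (\<phi> m))"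
    proof (rule has_derivative_transform_within_open[OF has_derivative_minus[OF
          smooth_has_derivative[OF openin_topspace bs[of a d] O_M[OF m] O_V[OF m]]] open_V])
      fix y assume "y \<in> \<phi> ` V"
      then show "- (B (coord a) (coord d) \<circ> inv_chart) y = (B (coord d) (coord a) \<circ> inv_chart) y"
        using bracket_skew[OF cs cs, of "inv_chart y" a d] inv_into_into[of y \<phi> V] VM by simp
    qed (use O_V[OF m] in simp)
    ultimately show ?thesis using has_derivative_unique by metis
  qed
  have "(?D (?Q a) b - ?D (?Q b) a) \<bullet> d = ?Q G \<bullet> d" for d
  proof -
    have "B (coord a) (B (coord b) (coord d)) m = ?D (?Q a) b \<bullet> d"
      by (simp only: bracket_eq_bivec[OF cs bs m] gradient_coord[OF m] bivec_map_derivative[OF m] bivec_map_phi[OF m]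
          inner_commute[of "bivec B m a"])
    moreover have "B (coord b) (B (coord d) (coord a)) m = - (?D (?Q b) a \<bullet> d)"
      by (simp only: bracket_eq_bivec[OF cs bs m] gradient_coord[OF m] bivec_map_derivative[OF m] bivec_map_phi[OF m]
          inner_commute[of "bivec B m b"] skewD)
    moreover have "B (coord d) (B (coord a) (coord b)) m = - (?Q G \<bullet> d)"
    proof -
      have "B (coord d) (B (coord a) (coord b)) m = bivec B m d \<bullet> G"
        by (simp only: bracket_eq_bivec[OF cs bs m] gradient_coord[OF m] G_def)
      also have "\<dots> = - (d \<bullet> bivec B m G)" by (rule bivec_skew[OF m])
      finally show ?thesis by (simp only: bivec_map_phi[OF m] inner_commute)
    qed
    ultimately show ?thesis using bracket_jacobi[OF cs cs cs O_M[OF m], of a b d] by (simp add: inner_diff_left)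
  qed
  then have "?D (?Q a) b - ?D (?Q b) a = ?Q G" by (metis vector_eq_rdot)
  then show ?thesis by simp
qed

lemma corank_le_one_dense:
  assumes cas: "\<And>U F. openin X U \<Longrightarrow> U \<subseteq> W \<Longrightarrow> (\<forall>i<1 + 1. casimir_on A U (local_bracket X A B) (F i)) \<Longrightarrow>
      functionally_dependent_on A U {..<1 + 1} F"
    and N: "openin X N" "N \<subseteq> O_dom" "N \<subseteq> W" "N \<noteq> {}"
  shows "\<exists>m\<in>N. dim {x. bivec B m x = 0} \<le> 1"
proof (rule ccontr)
  assume "\<not> ?thesis"
  then have cork: "2 \<le> dim {x. bivec B m x = 0}" if "m \<in> N" for m using that by force
  let ?rk = "\<lambda>m. dim (range (bivec_map B (\<phi> m)))"
  obtain n0 where "n0 \<in> N" using N(4) by blast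
  \<comment> \<open>Maximality bounds the rank from above and semicontinuity from below, so it is
    constant near this point, as Frobenius' theorem requires.\<close>
  then have "\<exists>m. m \<in> N \<and> (\<forall>m'. m' \<in> N \<longrightarrow> ?rk m' \<le> ?rk m)"
    by (rule ex_has_greatest_nat[where b = "Suc DIM('e)"]) (auto simp: less_Suc_eq_le intro: dim_subset_UNIV)
  then obtain m1 where m1: "m1 \<in> N" "\<And>m'. m' \<in> N \<Longrightarrow> ?rk m' \<le> ?rk m1" by blast
  have m1O: "m1 \<in> O_dom" using m1 N by blast
  define p where "p = \<phi> m1"
  let ?Q = "bivec_map B"
  have NV: "N \<inter> V = N" using N(2) O_V by blast
  have oN: "open (\<phi> ` N)" using open_chart_image[OF M V N(1)] by (simp add: NV)
  have Nball: "\<phi> ` N \<subseteq> ball c (r / 4)" using N(2) O_image by blast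
  have "isCont ?Q p"
    using Cinf_on_continuous_on[OF Cinf_bivec_map] Nball m1(1) by (auto simp: continuous_on_eq_continuous_at p_def)
  from eventually_rank_ge[OF this] obtain S0 where S0: "open S0" "p \<in> S0" "\<And>y. y \<in> S0 \<Longrightarrow> dim (range (?Q p)) \<le> dim (range (?Q y))"
    unfolding eventually_nhds by blast
  define S where "S = \<phi> ` N \<inter> S0"
  have S: "open S" "p \<in> S" using oN S0 m1 by (auto simp: S_def p_def)
  have SO: "\<exists>m\<in>O_dom. y = \<phi> m" if "y \<in> S" for y using that N(2) by (auto simp: S_def)
  have QS: "Cinf_on S ?Q" by (rule Cinf_on_subset[OF Cinf_bivec_map]) (use Nball in \<open>auto simp: S_def\<close>)
  have skew: "?Q x a \<bullet> b = - (a \<bullet> ?Q x b)" if "x \<in> S" for x a b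
    using SO[OF that] bivec_skew by (auto simp: bivec_map_phi)
  have rank: "dim (range (?Q x)) = dim (range (?Q p))" if "x \<in> S" for x
    using that S0(3)[of x] m1(2) by (auto simp: S_def p_def intro: antisym)
  have invol: "frechet_derivative ?Q (at x) (?Q x a) b - frechet_derivative ?Q (at x) (?Q x b) a \<in> range (?Q x)" if "x \<in> S" for x a b
    using SO[OF that] bivec_map_involutive by blast
  show False
  proof (rule frobenius_first_integrals[OF S QS skew rank invol])
    fix T and H :: "'e \<Rightarrow> 'e"
    assume T: "open T" "p \<in> T" "T \<subseteq> S" and H: "Cinf_on UNIV H"
      and H0: "\<And>x a. x \<in> T \<Longrightarrow> frechet_derivative H (at x) (?Q x a) = 0"
      and Hp: "\<And>h. (\<And>a. h \<bullet> ?Q p a = 0) \<Longrightarrow> frechet_derivative H (at p) h = h"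
    \<comment> \<open>For a skew map the kernel is the orthogonal complement of the range, and there
      the derivative of \<open>H\<close> at \<open>p\<close> is the identity.\<close>
    obtain e :: "nat \<Rightarrow> 'e" where e: "\<And>i. e i \<in> {x. bivec B m1 x = 0}" "indep_family {..<2} e"
      using two_indep_in_subspace[OF cork[OF m1(1)]] by blast
    define F where "F i x = H (\<phi> x) \<bullet> e i" for i x
    define U where "U = N \<inter> (V \<inter> \<phi> -` T)"
    have U: "openin X U" unfolding U_def
      by (intro openin_Int N(1) openin_chart_preimage[OF M V T(1)])
    have UV: "U \<subseteq> V" "U \<subseteq> O_dom" "m1 \<in> U" using N(2) m1 T(2) O_V by (auto simp: U_def p_def)
    have UinvV: "U \<inter> V = U" using UV by blast
    have F': "((F i \<circ> inv_chart) has_derivative (\<lambda>h. frechet_derivative H (at (\<phi> x)) h \<bullet> e i)) (at (\<phi> x))" if "x \<in> U" for i x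
    proof (rule has_derivative_transform_within_open[OF _ open_V])
      show "((\<lambda>y. H y \<bullet> e i) has_derivative (\<lambda>h. frechet_derivative H (at (\<phi> x)) h \<bullet> e i)) (at (\<phi> x))"
        by (intro has_derivative_inner_left Cinf_on_has_derivative[OF H]) simp
    qed (use UV that in \<open>auto simp: F_def inv_chart\<close>)
    have FC: "F i \<in> smooth_funs A U" for i
    proof (rule smooth_funs_chart_change[OF M V U UV(1)])
      have op: "open (\<phi> ` U)" using open_chart_image[OF M V U] by (simp add: UinvV)
      show "Cinf_on (\<phi> ` U) (F i \<circ> inv_chart)"
        by (rule Cinf_on_cong[OF op _ Cinf_on_inner[OF op Cinf_on_subset[OF H] Cinf_on_const]])
          (use UV in \<open>auto simp: F_def inv_chart subset_iff\<close>)
    qed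
    have grad: "gradient (F i) x \<bullet> h = frechet_derivative H (at (\<phi> x)) h \<bullet> e i" if "x \<in> U" for i x h
    proof -
      have "x \<in> V" using UV that by blast
      from has_derivative_unique[OF smooth_has_derivative[OF U FC that this] F'[OF that]]
      show ?thesis by (rule fun_cong)
    qed
    have "casimir_on A U (local_bracket X A B) (F i)" for i
      unfolding casimir_on_def
    proof (intro conjI FC ballI)
      fix f x assume f: "f \<in> smooth_funs A U" and x: "x \<in> U"
      have xO: "x \<in> O_dom" using x UV by blast
      \<comment> \<open>The derivative of \<open>H\<close> kills the range of the bivector, so the
        gradient of \<open>F i\<close> is orthogonal to every Hamiltonian vector.\<close>
      have "local_bracket X A B (F i) f x = - (gradient (F i) x \<bullet> bivec B x (gradient f x))"
        by (simp add: local_bracket_eq[OF U FC f x xO] bivec_skew[OF xO])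
      also have "\<dots> = 0"
        using H0[of "\<phi> x" "gradient f x"] x by (simp add: grad[OF x] bivec_map_phi[OF xO] U_def)
      finally show "local_bracket X A B (F i) f x = 0" .
    qed
    then have "functionally_dependent_on A U {..<1 + 1} F"
      using cas[OF U] N(3) by (auto simp: U_def)
    then obtain k where k: "\<exists>i\<in>{..<1 + 1}. k i \<noteq> 0" "(\<Sum>i\<in>{..<1 + 1::nat}. pscale (k i) (differential A (F i) m1)) = 0"
      using UV(3) unfolding functionally_dependent_on_def by blast
    have m1V: "m1 \<in> V" using UV by blast
    have "k 0 * (gradient (F 0) m1 \<bullet> h) + k 1 * (gradient (F 1) m1 \<bullet> h) = 0" for h
    proof -
      have "(\<Sum>i\<in>{..<1 + 1::nat}. pscale (k i) (differential A (F i) m1)) ((V, \<phi>), h) = 0"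
        unfolding k(2) by simp
      then show ?thesis
        by (simp add: differential_eq_covec[OF U FC UV(3) m1V] pscale_def covec_def rep_vec_chart[OF m1V])
    qed
    then have g: "frechet_derivative H (at p) h \<bullet> (k 0 *\<^sub>R e 0 + k 1 *\<^sub>R e 1) = 0" for h
      by (simp add: grad[OF UV(3)] p_def inner_add_right)
    \<comment> \<open>A dependence at \<open>m1\<close> makes \<open>x\<close> orthogonal to the
      image of the derivative of \<open>H\<close>. But \<open>x\<close> is its own image under it,
      so \<open>x = 0\<close>, against independence of \<open>e\<close>.\<close>
    define x where "x = k 0 *\<^sub>R e 0 + k 1 *\<^sub>R e 1"
    have "bivec B m1 x = 0"
      using e(1)[of 0] e(1)[of 1] by (simp add: x_def linear_add[OF linear_bivec] linear_scale[OF linear_bivec])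
    then have "x \<bullet> ?Q p a = 0" for a
      using bivec_skew[OF m1O, of x a] by (simp add: p_def bivec_map_phi[OF m1O])
    then have "frechet_derivative H (at p) x = x" by (rule Hp)
    then have "x \<bullet> x = 0" using g[of x] unfolding x_def[symmetric] by simp
    then have "k 0 *\<^sub>R e 0 + k 1 *\<^sub>R e 1 = 0" unfolding x_def[symmetric] by simp
    then have "(\<Sum>i<2. k i *\<^sub>R e i) = 0" by (simp add: lessThan_nat_numeral lessThan_Suc add.commute)
    then have "\<forall>i\<in>{..<2}. k i = 0" using e(2) unfolding indep_family_def by blast
    then show False using k(1) by auto
  qed
qed

end

section \<open>Cotangent spaces and Kronecker pairs\<close>

text \<open>The natural map goes from coefficient vectors to covectors, opposite to the direction in
  \<open>pair_isomorphic\<close>; its properties are transferred to the inverse here.\<close>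

lemma pair_isomorphic_if_inverse:
  assumes bij: "bij_betw S W V"
    and W: "\<And>x y. x \<in> W \<Longrightarrow> y \<in> W \<Longrightarrow> x + y \<in> W" "\<And>c x. x \<in> W \<Longrightarrow> pscale c x \<in> W"
    and lin: "\<And>x y. x \<in> W \<Longrightarrow> y \<in> W \<Longrightarrow> S (x + y) = S x + S y" "\<And>c x. x \<in> W \<Longrightarrow> S (pscale c x) = pscale c (S x)"
    and pres: "\<And>x y. x \<in> W \<Longrightarrow> y \<in> W \<Longrightarrow> p1 (S x) (S y) = q1 x y" "\<And>x y. x \<in> W \<Longrightarrow> y \<in> W \<Longrightarrow> p2 (S x) (S y) = q2 x y"
  shows "pair_isomorphic (V, p1, p2) (W, q1, q2)"
proof -
  define T where "T = the_inv_into W S"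
  have inj: "inj_on S W" and im: "S ` W = V" using bij by (auto simp: bij_betw_def)
  have T: "T v \<in> W" "S (T v) = v" if "v \<in> V" for v
    using the_inv_into_into[OF inj, of v W] f_the_inv_into_f[OF inj, of v] that im by (auto simp: T_def)
  have TS: "T (S w) = w" if "w \<in> W" for w using the_inv_into_f_f[OF inj that] by (simp add: T_def)
  have "bij_betw T V W" unfolding T_def by (rule bij_betw_the_inv_into[OF bij])
  moreover have "T (x + y) = T x + T y" if "x \<in> V" "y \<in> V" for x y
    using TS[OF W(1)[OF T(1)[OF that(1)] T(1)[OF that(2)]]] lin(1)[OF T(1)[OF that(1)] T(1)[OF that(2)]] T(2) that by simp
  moreover have "T (pscale c x) = pscale c (T x)" if "x \<in> V" for c x
    using TS[OF W(2)[OF T(1)[OF that]], of c] lin(2)[OF T(1)[OF that], of c] T(2) that by simp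
  moreover have "q1 (T x) (T y) = p1 x y" "q2 (T x) (T y) = p2 x y" if "x \<in> V" "y \<in> V" for x y
    using pres[OF T(1)[OF that(1)] T(1)[OF that(2)]] T(2) that by simp_all
  ultimately show ?thesis unfolding pair_isomorphic_def by (auto intro!: exI[of _ T])
qed

text \<open>The groupings match the index pairs of the first and of the second Kronecker form, each
  leaving one end of the chain unpaired.\<close>

lemma sum_lessThan_odd_split:
  fixes f :: "nat \<Rightarrow> 'b::comm_monoid_add"
  shows "(\<Sum>i<Suc (2 * K). f i) = (\<Sum>l<K. f (2 * l) + f (2 * l + 1)) + f (2 * K)"
    and "(\<Sum>i<Suc (2 * K). f i) = f 0 + (\<Sum>l<K. f (2 * l + 1) + f (2 * l + 2))"
proof -
  show "(\<Sum>i<Suc (2 * K). f i) = (\<Sum>l<K. f (2 * l) + f (2 * l + 1)) + f (2 * K)"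
    by (induction K) (simp_all add: add_ac)
  show "(\<Sum>i<Suc (2 * K). f i) = f 0 + (\<Sum>l<K. f (2 * l + 1) + f (2 * l + 2))"
    by (induction K) (simp_all add: add_ac)
qed

text \<open>Stated over any commutative ring, so that the real computation and the complex model
  share one formula.\<close>

definition kron_form1 :: "nat \<Rightarrow> (nat \<Rightarrow> 'k::comm_ring) \<Rightarrow> (nat \<Rightarrow> 'k) \<Rightarrow> 'k" where
  "kron_form1 K x y = (\<Sum>l<K. x (2*l) * y (2*l + 1) - x (2*l + 1) * y (2*l))"

definition kron_form2 :: "nat \<Rightarrow> (nat \<Rightarrow> 'k::comm_ring) \<Rightarrow> (nat \<Rightarrow> 'k) \<Rightarrow> 'k" where
  "kron_form2 K x y = (\<Sum>l<K. x (2*l + 1) * y (2*l + 2) - x (2*l + 2) * y (2*l + 1))"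

lemma kron_form1_eq:
  assumes "linear P" "\<And>i j. i < Suc (2 * K) \<Longrightarrow> j < Suc (2 * K) \<Longrightarrow>
    P (w i) \<bullet> w j = (if even i \<and> j = Suc i then 1 else if even j \<and> i = Suc j then - 1 else 0)"
  shows "P (\<Sum>i<Suc (2 * K). x i *\<^sub>R w i) \<bullet> (\<Sum>j<Suc (2 * K). y j *\<^sub>R w j) = kron_form1 K x y"
proof -
  let ?n = "Suc (2 * K)"
  have r: "P (w i) \<bullet> (\<Sum>j<?n. y j *\<^sub>R w j) =
      (if even i then (if i < 2 * K then y (Suc i) else 0) else - y (i - 1))" if i: "i < ?n" for i
  proof -
    have "P (w i) \<bullet> (\<Sum>j<?n. y j *\<^sub>R w j) = (\<Sum>j<?n. y j * (P (w i) \<bullet> w j))" by (simp only: inner_sum_right inner_scaleR_right)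
    also have "\<dots> = (\<Sum>j<?n. if even i then (if j = Suc i then y j else 0) else (if j = i - 1 then - y j else 0))"
      using i by (intro sum.cong) (auto simp: assms(2) elim!: oddE)
    also have "\<dots> = (if even i then (if i < 2 * K then y (Suc i) else 0) else - y (i - 1))"
      using i by auto
    finally show ?thesis .
  qed
  have "P (\<Sum>i<?n. x i *\<^sub>R w i) \<bullet> (\<Sum>j<?n. y j *\<^sub>R w j) = (\<Sum>i<?n. x i * (P (w i) \<bullet> (\<Sum>j<?n. y j *\<^sub>R w j)))"
    by (simp only: linear_sum[OF assms(1)] linear_scale[OF assms(1)] inner_sum_left inner_scaleR_left)
  also have "\<dots> = (\<Sum>i<?n. x i * (if even i then (if i < 2 * K then y (Suc i) else 0) else - y (i - 1)))"
    by (intro sum.cong) (auto simp only: r lessThan_iff)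
  also have "\<dots> = kron_form1 K x y"
    unfolding sum_lessThan_odd_split(1) kron_form1_def by simp
  finally show ?thesis .
qed

lemma kron_form2_eq:
  assumes "linear P" "\<And>i j. i < Suc (2 * K) \<Longrightarrow> j < Suc (2 * K) \<Longrightarrow>
    P (w i) \<bullet> w j = (if odd i \<and> j = Suc i then 1 else if odd j \<and> i = Suc j then - 1 else 0)"
  shows "P (\<Sum>i<Suc (2 * K). x i *\<^sub>R w i) \<bullet> (\<Sum>j<Suc (2 * K). y j *\<^sub>R w j) = kron_form2 K x y"
proof -
  let ?n = "Suc (2 * K)"
  have r: "P (w i) \<bullet> (\<Sum>j<?n. y j *\<^sub>R w j) =
      (if odd i then y (Suc i) else (if i = 0 then 0 else - y (i - 1)))" if i: "i < ?n" for i
  proof -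
    have "P (w i) \<bullet> (\<Sum>j<?n. y j *\<^sub>R w j) = (\<Sum>j<?n. y j * (P (w i) \<bullet> w j))" by (simp only: inner_sum_right inner_scaleR_right)
    also have "\<dots> = (\<Sum>j<?n. if odd i then (if j = Suc i then y j else 0) else (if i = 0 then 0 else if j = i - 1 then - y j else 0))"
      using i by (intro sum.cong) (auto simp: assms(2) elim!: oddE evenE)
    also have "\<dots> = (if odd i then y (Suc i) else (if i = 0 then 0 else - y (i - 1)))"
      using i by (auto elim!: oddE)
    finally show ?thesis .
  qed
  have "P (\<Sum>i<?n. x i *\<^sub>R w i) \<bullet> (\<Sum>j<?n. y j *\<^sub>R w j) = (\<Sum>i<?n. x i * (P (w i) \<bullet> (\<Sum>j<?n. y j *\<^sub>R w j)))"
    by (simp only: linear_sum[OF assms(1)] linear_scale[OF assms(1)] inner_sum_left inner_scaleR_left)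
  also have "\<dots> = (\<Sum>i<?n. x i * (if odd i then y (Suc i) else (if i = 0 then 0 else - y (i - 1))))"
    by (intro sum.cong) (auto simp only: r lessThan_iff)
  also have "\<dots> = kron_form2 K x y"
    unfolding sum_lessThan_odd_split(2) kron_form2_def by (simp cong: sum.cong)
  finally show ?thesis .
qed

text \<open>The forms have integer coefficients, so the complex bilinear extension of the real form
  is given by the same formula.\<close>

lemma kron_form_Complex:
  "Complex (kron_form1 K (\<lambda>i. Re (x i)) (\<lambda>i. Re (y i)) - kron_form1 K (\<lambda>i. Im (x i)) (\<lambda>i. Im (y i)))
     (kron_form1 K (\<lambda>i. Re (x i)) (\<lambda>i. Im (y i)) + kron_form1 K (\<lambda>i. Im (x i)) (\<lambda>i. Re (y i))) = kron_form1 K x y"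
  "Complex (kron_form2 K (\<lambda>i. Re (x i)) (\<lambda>i. Re (y i)) - kron_form2 K (\<lambda>i. Im (x i)) (\<lambda>i. Im (y i)))
     (kron_form2 K (\<lambda>i. Re (x i)) (\<lambda>i. Im (y i)) + kron_form2 K (\<lambda>i. Im (x i)) (\<lambda>i. Re (y i))) = kron_form2 K x y"
  unfolding kron_form1_def kron_form2_def
  by (rule complex_eqI; simp add: Re_sum Im_sum sum_subtractf[symmetric] sum.distrib[symmetric]; rule sum.cong; simp add: algebra_simps)+

lemma direct_sum_single_kronecker:
  "direct_sum_pairs [kronecker_pair (Suc K)] =
    ({x. (\<forall>j\<ge>Suc (2 * K). x (0, j) = 0) \<and> (\<forall>s\<ge>1. \<forall>i. x (s, i) = 0)},
     \<lambda>x y. kron_form1 K (\<lambda>i. x (0, i)) (\<lambda>i. y (0, i)), \<lambda>x y. kron_form2 K (\<lambda>i. x (0, i)) (\<lambda>i. y (0, i)))"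
  by (simp add: direct_sum_pairs_def kronecker_pair_def kron_form1_def kron_form2_def)

lemma indep_family_DIM_spans:
  fixes w :: "nat \<Rightarrow> 'e::euclidean_space"
  assumes "indep_family {..<DIM('e)} w"
  shows "\<exists>c. x = (\<Sum>i<DIM('e). c i *\<^sub>R w i)"
proof (rule span_image_sum)
  have inj: "inj_on w {..<DIM('e)}" and ind: "independent (w ` {..<DIM('e)})"
    using indep_family_inj_on indep_family_independent assms by blast+
  show "inj_on w {..<DIM('e)}" by (rule inj)
  have "card (w ` {..<DIM('e)}) = dim (UNIV :: 'e set)" using card_image[OF inj] by simp
  then show "x \<in> span (w ` {..<DIM('e)})"
    using card_ge_dim_independent[OF subset_UNIV ind] by auto
qed simp

text \<open>The basis \<open>w\<close> is real; complex coefficient vectors become complexified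
  covectors by expanding real and imaginary parts separately.\<close>

lemma (in bump_chart) cotangent_pair_isomorphic:
  assumes B1: "poisson_bracket X A B1" and B2: "poisson_bracket X A B2" and m: "m \<in> O_dom"
    and n: "DIM('e) = Suc (2 * K)" and w: "indep_family {..<Suc (2 * K)} w"
    and r1: "\<And>i j. i < Suc (2 * K) \<Longrightarrow> j < Suc (2 * K) \<Longrightarrow>
      bivec B1 m (w i) \<bullet> w j = (if even i \<and> j = Suc i then 1 else if even j \<and> i = Suc j then - 1 else 0)"
    and r2: "\<And>i j. i < Suc (2 * K) \<Longrightarrow> j < Suc (2 * K) \<Longrightarrow>
      bivec B2 m (w i) \<bullet> w j = (if odd i \<and> j = Suc i then 1 else if odd j \<and> i = Suc j then - 1 else 0)"
  shows "pair_isomorphic (cotangent_pair X A B1 B2 m) (direct_sum_pairs [kronecker_pair (Suc K)])"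
proof -
  interpret B1: poisson_chart X A V \<phi> c r \<eta> \<theta> B1 by unfold_locales (rule B1)
  interpret B2: poisson_chart X A V \<phi> c r \<eta> \<theta> B2 by unfold_locales (rule B2)
  let ?n = "Suc (2 * K)"
  define vec where "vec x = (\<Sum>i<?n. x i *\<^sub>R w i)" for x
  define S where "S x = (\<lambda>t. Complex (covec m (vec (\<lambda>i. Re (x (0::nat, i)))) t) (covec m (vec (\<lambda>i. Im (x (0, i)))) t))" for x
  define W where "W = {x. (\<forall>j\<ge>?n. x (0, j) = 0) \<and> (\<forall>s\<ge>1. \<forall>i. x (s::nat, i) = (0::complex))}"
  have ReS: "(\<lambda>t. Re (S x t)) = covec m (vec (\<lambda>i. Re (x (0, i))))"
    and ImS: "(\<lambda>t. Im (S x t)) = covec m (vec (\<lambda>i. Im (x (0, i))))" for x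
    by (auto simp: S_def)
  have vec_inj: "x i = y i" if "vec x = vec y" "i < ?n" for x y :: "nat \<Rightarrow> real" and i
  proof -
    have "(\<Sum>i<?n. (x i - y i) *\<^sub>R w i) = 0" using that(1) by (simp only: vec_def scaleR_diff_left sum_subtractf) simp
    then have "\<forall>i\<in>{..<?n}. x i - y i = 0" using w[unfolded indep_family_def, rule_format, of "\<lambda>i. x i - y i"] by blast
    then show ?thesis using that(2) by simp
  qed
  have "inj_on S W"
  proof (rule inj_onI)
    fix x y assume xy: "x \<in> W" "y \<in> W" "S x = S y"
    have "x (0, i) = y (0, i)" if "i < ?n" for i
      using vec_inj[OF covec_inj[OF O_V[OF m]] that] ReS[of x] ReS[of y] ImS[of x] ImS[of y] xy(3)
      by (intro complex_eqI) metis+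
    then have "x (s, i) = y (s, i)" for s i
      using xy(1,2) by (cases "s = 0"; cases "i < ?n") (auto simp: W_def)
    then show "x = y" by auto
  qed
  moreover have "S ` W = complexify_space (range (covec m))"
  proof
    show "S ` W \<subseteq> complexify_space (range (covec m))"
      by (auto simp: complexify_space_def ReS ImS)
    show "complexify_space (range (covec m)) \<subseteq> S ` W"
    proof
      fix z assume "z \<in> complexify_space (range (covec m))"
      then obtain a b where ab: "(\<lambda>t. Re (z t)) = covec m a" "(\<lambda>t. Im (z t)) = covec m b"
        by (auto simp: complexify_space_def)
      obtain \<alpha> \<beta> where c: "a = vec \<alpha>" "b = vec \<beta>"
        using indep_family_DIM_spans[of w] w unfolding n vec_def by metis
      define x where "x = (\<lambda>(s::nat, i). if s = 0 \<and> i < ?n then Complex (\<alpha> i) (\<beta> i) else 0)"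
      have "x \<in> W" by (auto simp: W_def x_def)
      moreover have "vec (\<lambda>i. Re (x (0, i))) = a" "vec (\<lambda>i. Im (x (0, i))) = b"
        unfolding c vec_def by (auto simp: x_def intro!: sum.cong simp del: sum.lessThan_Suc)
      then have "S x = z"
        using ab by (auto simp: S_def fun_eq_iff complex_eq_iff)
      ultimately show "z \<in> S ` W" by blast
    qed
  qed
  ultimately have bij: "bij_betw S W (complexify_space (cotangent_space X A m))"
    by (simp add: bij_betw_def cotangent_space_eq[OF m])
  have vadd: "vec (\<lambda>i. x i + y i) = vec x + vec y" for x y
    by (simp only: vec_def scaleR_add_left sum.distrib)
  have vscale: "vec (\<lambda>i. k * x i) = k *\<^sub>R vec x" for k x
    by (simp only: vec_def scaleR_sum_right scaleR_scaleR)
  have vdiff: "vec (\<lambda>i. x i - y i) = vec x - vec y" for x y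
    by (simp only: vec_def scaleR_diff_left sum_subtractf)
  have f1: "covector_pairing X A B1 m (covec m (vec x)) (covec m (vec y)) = kron_form1 K x y" for x y
    unfolding B1.covector_pairing_covec[OF m] vec_def by (rule kron_form1_eq[OF linear_bivec r1])
  have f2: "covector_pairing X A B2 m (covec m (vec x)) (covec m (vec y)) = kron_form2 K x y" for x y
    unfolding B2.covector_pairing_covec[OF m] vec_def by (rule kron_form2_eq[OF linear_bivec r2])
  show ?thesis
    unfolding direct_sum_single_kronecker cotangent_pair_def W_def[symmetric]
  proof (rule pair_isomorphic_if_inverse[OF bij])
    show "x + y \<in> W" if "x \<in> W" "y \<in> W" for x y using that by (auto simp: W_def)
    show "pscale c x \<in> W" if "x \<in> W" for c x using that by (auto simp: W_def pscale_def)
    show "S (x + y) = S x + S y" for x y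
      by (auto simp: S_def fun_eq_iff complex_eq_iff vadd covec_def inner_add_left)
    show "S (pscale c x) = pscale c (S x)" for c x
      by (auto simp: S_def fun_eq_iff complex_eq_iff pscale_def vadd vdiff vscale covec_def inner_add_left inner_diff_left)
    show "complexify_pairing (covector_pairing X A B1 m) (S x) (S y) = kron_form1 K (\<lambda>i. x (0, i)) (\<lambda>i. y (0, i))" for x y
      unfolding complexify_pairing_def Let_def ReS ImS f1 by (rule kron_form_Complex)
    show "complexify_pairing (covector_pairing X A B2 m) (S x) (S y) = kron_form2 K (\<lambda>i. x (0, i)) (\<lambda>i. y (0, i))" for x y
      unfolding complexify_pairing_def Let_def ReS ImS f2 by (rule kron_form_Complex)
  qed
qed

text \<open>Carries the lower bound on the dimension from spans of covectors in the function space
  over to gradients in \<open>'e\<close>.\<close>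

lemma pointwise_dim_linear_image_le:
  fixes \<tau> :: "'e::euclidean_space \<Rightarrow> ('i \<Rightarrow> real)"
  assumes add: "\<And>x y. \<tau> (x + y) = \<tau> x + \<tau> y" and scale: "\<And>c x. \<tau> (c *\<^sub>R x) = pscale c (\<tau> x)"
  shows "pointwise.dim (pointwise.span (\<tau> ` S)) \<le> dim S"
proof -
  obtain B where B: "B \<subseteq> S" "independent B" "S \<subseteq> span B" "card B = dim S" by (rule basis_exists[of S])
  have fin: "finite B" using B(2) by (rule independent_imp_finite)
  have z: "\<tau> 0 = 0" using scale[of 0 0] by (simp add: pscale_def zero_fun_def)
  have "\<tau> x \<in> pointwise.span (\<tau> ` B)" if "x \<in> span B" for x
    using that
  proof (induction rule: span_induct_alt)
    case base show ?case unfolding z by (rule pointwise.span_zero)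
  next
    case (step c x y)
    show ?case unfolding add scale
      by (intro pointwise.span_add pointwise.span_scale pointwise.span_base step imageI)
  qed
  then have "pointwise.span (\<tau> ` S) \<subseteq> pointwise.span (\<tau> ` B)"
    using B(3) by (intro pointwise.span_minimal pointwise.subspace_span) auto
  then have "pointwise.dim (pointwise.span (\<tau> ` S)) \<le> card (\<tau> ` B)"
    by (rule pointwise.dim_le_card) (simp add: fin)
  also have "\<dots> \<le> card B" by (rule card_image_le[OF fin])
  finally show ?thesis using B(4) by simp
qed

theorem theorem3p1:
  fixes X :: "'a topology"
    and A :: "('a, 'e::euclidean_space) chart set"
    and B1 B2 :: "'a bracket"
    and \<U> :: "real set"
    and F :: "real \<Rightarrow> 'a \<Rightarrow> real"
    and m0 :: 'a
    and a1 a2 :: real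
  assumes "smooth_manifold X A"
    and "DIM('e) \<noteq> 0"
    and "poisson_bracket X A B1" and "poisson_bracket X A B2"
    and "compatible_brackets X A B1 B2"
    and "open \<U>"
    and "\<And>l. l \<in> \<U> \<Longrightarrow> F l \<in> smooth_funs A (topspace X)"
    and "\<And>l. l \<in> \<U> \<Longrightarrow> casimir_on A (topspace X) (bracket_comb l 1 B1 B2) (F l)"
    and "\<And>m. m \<in> topspace X \<Longrightarrow> continuous_on \<U> (\<lambda>l. differential A (F l) m)"
    and "m0 \<in> topspace X"
    and "real (pointwise.dim (pointwise.span ((\<lambda>l. differential A (F l) m0) ` \<U>))) \<ge> real DIM('e) / 2"
    and "at_most_independent_casimirs_near X A (bracket_comb a1 a2 B1 B2) m0 1"
  shows "odd DIM('e) \<and>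
    (\<exists>U. openin X U \<and> m0 \<in> X closure_of U \<and> homogeneous_on X A B1 B2 U [DIM('e)])"
proof -
  note mani = assms(1) and FC = assms(7) and cas = assms(8)
  obtain V \<phi> where chart: "(V, \<phi>) \<in> A" "m0 \<in> V"
    using mani assms(10) unfolding smooth_manifold_def by fast
  have "\<phi> m0 \<in> \<phi> ` V" using chart by blast
  then obtain r where rad: "r > 0" "cball (\<phi> m0) r \<subseteq> \<phi> ` V"
    using chart_open_image[OF mani chart(1)] open_contains_cball by blast
  obtain \<eta> :: "'e \<Rightarrow> real" where bump1: "Cinf_on UNIV \<eta>" "\<And>y. dist (\<phi> m0) y \<le> r / 4 \<Longrightarrow> \<eta> y = 1"
      "\<And>y. dist (\<phi> m0) y \<ge> r / 3 \<Longrightarrow> \<eta> y = 0"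
    using smooth_bump_exists[of "r / 4" "r / 3" "\<phi> m0"] rad(1) by auto
  obtain \<theta> :: "'e \<Rightarrow> real" where bump2: "Cinf_on UNIV \<theta>" "\<And>y. dist (\<phi> m0) y \<le> r / 2 \<Longrightarrow> \<theta> y = 1"
      "\<And>y. dist (\<phi> m0) y \<ge> 3 * r / 4 \<Longrightarrow> \<theta> y = 0"
    using smooth_bump_exists[of "r / 2" "3 * r / 4" "\<phi> m0"] rad(1) by auto
  define Q where "Q = bracket_comb a1 a2 B1 B2"
  have PQ: "poisson_bracket X A Q" using assms(5) unfolding compatible_brackets_def Q_def by blast
  interpret bump_chart X A V \<phi> "\<phi> m0" r \<eta> \<theta>
    by unfold_locales (use mani chart rad bump1 bump2 in auto)
  interpret B1: poisson_chart X A V \<phi> "\<phi> m0" r \<eta> \<theta> B1 by unfold_locales (rule assms(3))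
  interpret B2: poisson_chart X A V \<phi> "\<phi> m0" r \<eta> \<theta> B2 by unfold_locales (rule assms(4))
  interpret Q: poisson_chart X A V \<phi> "\<phi> m0" r \<eta> \<theta> Q by unfold_locales (rule PQ)
  have m0O: "m0 \<in> O_dom" using chart rad by (simp add: O_dom_def)
  have bivecQ: "bivec Q m x = a1 *\<^sub>R bivec B1 m x + a2 *\<^sub>R bivec B2 m x" for m x
    by (simp add: bivec_def Q_def bracket_comb_def scaleR_sum_right sum.distrib[symmetric] algebra_simps)
  define v where "v l m = gradient (F l) m" for l m
  have dF: "differential A (F l) m = covec m (v l m)" if "l \<in> \<U>" "m \<in> O_dom" for l m
    unfolding v_def by (rule differential_eq_covec[OF openin_topspace FC[OF that(1)] O_M[OF that(2)] O_V[OF that(2)]])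
  have ker: "l *\<^sub>R bivec B1 m (v l m) + bivec B2 m (v l m) = 0" if l: "l \<in> \<U>" and m: "m \<in> O_dom" for l m
  proof -
    have "(l *\<^sub>R bivec B1 m (v l m) + bivec B2 m (v l m)) \<bullet> a = 0" for a
    proof -
      have "l * B1 (F l) (coord a) m + 1 * B2 (F l) (coord a) m = 0"
        using cas[OF l] coord_smooth O_M[OF m] unfolding casimir_on_def bracket_comb_def by blast
      then show ?thesis
        by (simp add: B1.bracket_eq_bivec[OF FC[OF l] coord_smooth m] B2.bracket_eq_bivec[OF FC[OF l] coord_smooth m]
            gradient_coord[OF m] v_def inner_add_left)
    qed
    then show ?thesis by (metis inner_eq_zero_iff)
  qed
  have cont: "continuous_on \<U> (\<lambda>l. v l m)" if m: "m \<in> O_dom" for m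
  proof -
    \<comment> \<open>Continuity in the function space means continuity at every representative, and
      those in the fixed chart recover the components of the gradient.\<close>
    have "continuous_on \<U> (\<lambda>l. differential A (F l) m ((V, \<phi>), b))" for b
      by (rule continuous_on_product_then_coordinatewise[OF assms(9)[OF O_M[OF m]]])
    moreover have "differential A (F l) m ((V, \<phi>), b) = v l m \<bullet> b" if "l \<in> \<U>" for l b
      by (simp add: dF[OF that m] covec_def rep_vec_chart[OF O_V[OF m]])
    ultimately have "continuous_on \<U> (\<lambda>l. v l m \<bullet> b)" for b by (simp cong: continuous_on_cong)
    then show ?thesis by (subst continuous_on_componentwise) blast
  qed
  have half0: "DIM('e) \<le> 2 * dim ((\<lambda>l. v l m0) ` \<U>)"
  proof -
    have "(\<lambda>l. differential A (F l) m0) ` \<U> = covec m0 ` (\<lambda>l. v l m0) ` \<U>"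
      unfolding image_image using dF[OF _ m0O] by (intro image_cong) auto
    moreover have "pointwise.dim (pointwise.span (covec m0 ` (\<lambda>l. v l m0) ` \<U>)) \<le> dim ((\<lambda>l. v l m0) ` \<U>)"
      by (rule pointwise_dim_linear_image_le) (auto simp: covec_def fun_eq_iff inner_add_left pscale_def)
    ultimately show ?thesis using assms(11) by simp
  qed
  \<comment> \<open>Independence of finitely many covectors with fixed parameters is an open
    condition on the point, so the dimension bound at \<open>m0\<close> persists nearby.\<close>
  obtain B where B: "B \<subseteq> (\<lambda>l. v l m0) ` \<U>" "independent B" "card B = dim ((\<lambda>l. v l m0) ` \<U>)"
    by (rule basis_exists[of "(\<lambda>l. v l m0) ` \<U>"])
  obtain L where L: "L \<subseteq> \<U>" "inj_on (\<lambda>l. v l m0) L" "(\<lambda>l. v l m0) ` L = B"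
    using subset_image_inj[THEN iffD1, OF B(1)] by metis
  have finL: "finite L" using independent_imp_finite[OF B(2)] L finite_imageD by blast
  have cL: "card L = dim ((\<lambda>l. v l m0) ` \<U>)" using card_image[OF L(2)] L(3) B(3) by simp
  have indL: "indep_family L (\<lambda>l. v l m0)" by (rule indep_familyI_independent[OF finL L(2)]) (simp add: L(3) B(2))
  have "\<forall>\<^sub>F y in nhds (\<phi> m0). indep_family L (\<lambda>l. v l (inv_chart y))"
  proof (rule eventually_indep_family[OF finL])
    show "indep_family L (\<lambda>l. v l (inv_chart (\<phi> m0)))" using indL chart by (simp add: inv_chart)
    fix l assume l: "l \<in> L"
    have sm: "Cinf_on (\<phi> ` V) (F l \<circ> inv_chart)"
      using smooth_funsD[OF FC chart(1)] l L(1) chart_topspace(1)[OF mani chart(1)] by (auto simp: Int_absorb1)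
    have "continuous_on (\<phi> ` V) (\<lambda>y. \<Sum>b\<in>Basis. frechet_derivative (F l \<circ> inv_chart) (at y) b *\<^sub>R b)"
      by (intro continuous_intros Cinf_on_continuous_on[OF Cinf_on_derivative[OF sm]])
    then have "continuous_on (\<phi> ` V) (\<lambda>y. v l (inv_chart y))"
      by (rule continuous_on_eq) (auto simp: v_def gradient_def inv_chart)
    then show "isCont (\<lambda>y. v l (inv_chart y)) (\<phi> m0)"
      using open_V chart(2) by (simp add: continuous_on_eq_continuous_at)
  qed
  then obtain T0 where T0: "open T0" "\<phi> m0 \<in> T0" "\<And>y. y \<in> T0 \<Longrightarrow> indep_family L (\<lambda>l. v l (inv_chart y))"
    unfolding eventually_nhds by blast
  define N0 where "N0 = O_dom \<inter> (V \<inter> \<phi> -` T0)"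
  have N0: "openin X N0" "m0 \<in> N0" "N0 \<subseteq> O_dom"
    unfolding N0_def using openin_O openin_chart_preimage[OF mani chart(1) T0(1)] m0O chart T0(2) by auto
  have half: "DIM('e) \<le> 2 * dim ((\<lambda>l. v l m) ` \<U>)" if m: "m \<in> N0" for m
  proof -
    have "indep_family L (\<lambda>l. v l m)" using T0(3)[of "\<phi> m"] m by (auto simp: N0_def inv_chart)
    then have "card L \<le> dim ((\<lambda>l. v l m) ` \<U>)" by (rule indep_family_card_le_dim[OF finL]) (use L(1) in auto)
    then show ?thesis using half0 cL by linarith
  qed
  \<comment> \<open>Near \<open>m0\<close> only the corank bound can fail; semicontinuity of the
    rank makes its validity an open condition.\<close>
  define U where "U = {m \<in> N0. dim {x. bivec Q m x = 0} \<le> 1}"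
  have rank: "dim {x. bivec Q m x = 0} + dim (range (bivec_map Q (\<phi> m))) = DIM('e)" if "m \<in> O_dom" for m
    using rank_nullity_subspace[OF linear_bivec subspace_UNIV, of Q m] bivec_map_phi[OF that, of Q]
    by (simp add: image_def)
  have "openin X U"
  proof (subst openin_subopen, intro ballI)
    fix m assume m: "m \<in> U"
    then have mO: "m \<in> O_dom" using N0 by (auto simp: U_def)
    then have "\<phi> m \<in> ball (\<phi> m0) (r / 4)" by (simp add: O_dom_def)
    then have "isCont (bivec_map Q) (\<phi> m)"
      using Cinf_on_continuous_on[OF Q.Cinf_bivec_map] by (simp add: continuous_on_eq_continuous_at)
    from eventually_rank_ge[OF this] obtain T where T: "open T" "\<phi> m \<in> T"
      "\<And>y. y \<in> T \<Longrightarrow> dim (range (bivec_map Q (\<phi> m))) \<le> dim (range (bivec_map Q y))"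
      unfolding eventually_nhds by blast
    have "N0 \<inter> (V \<inter> \<phi> -` T) \<subseteq> U"
    proof
      fix m' assume m': "m' \<in> N0 \<inter> (V \<inter> \<phi> -` T)"
      then have "dim (range (bivec_map Q (\<phi> m))) \<le> dim (range (bivec_map Q (\<phi> m')))" using T(3) by auto
      then have "dim {x. bivec Q m' x = 0} \<le> dim {x. bivec Q m x = 0}"
        using rank[OF mO] rank[of m'] m' N0(3) by fastforce
      then show "m' \<in> U" using m m' by (auto simp: U_def)
    qed
    moreover have "openin X (N0 \<inter> (V \<inter> \<phi> -` T))"
      by (intro openin_Int N0(1) openin_chart_preimage[OF mani chart(1) T(1)])
    ultimately show "\<exists>T. openin X T \<and> m \<in> T \<and> T \<subseteq> U"
      using m mO O_V T(2) by (intro exI[of _ "N0 \<inter> (V \<inter> \<phi> -` T)"]) (auto simp: U_def)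
  qed
  obtain W where W: "openin X W" "m0 \<in> W" and Wcas: "\<forall>U. openin X U \<longrightarrow> U \<subseteq> W \<longrightarrow>
      (\<forall>F. (\<forall>i<1 + 1. casimir_on A U (local_bracket X A Q) (F i)) \<longrightarrow> functionally_dependent_on A U {..<1 + 1} F)"
    using assms(12) unfolding at_most_independent_casimirs_near_def Q_def[symmetric] by (elim exE conjE)
  note Wcas = Wcas[THEN spec, THEN mp, THEN mp, THEN spec, THEN mp]
  have dense: "\<exists>m\<in>U. m \<in> T" if T: "openin X T" "m0 \<in> T" for T
  proof -
    have "\<exists>m\<in>T \<inter> (N0 \<inter> W). dim {x. bivec Q m x = 0} \<le> 1"
    proof (rule Q.corank_le_one_dense[OF Wcas])
      show "openin X (T \<inter> (N0 \<inter> W))" by (intro openin_Int T N0 W)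
    qed (use T N0 W in auto)
    then show ?thesis by (auto simp: U_def)
  qed
  have clos: "m0 \<in> X closure_of U"
    unfolding in_closure_of using assms(10) dense by blast
  have normal: "\<exists>K. DIM('e) = Suc (2 * K) \<and>
      pair_isomorphic (cotangent_pair X A B1 B2 m) (direct_sum_pairs [kronecker_pair (Suc K)])" if m: "m \<in> U" for m
  proof -
    have mN: "m \<in> N0" and mO: "m \<in> O_dom" using m N0 by (auto simp: U_def)
    have cork: "dim {x. a1 *\<^sub>R bivec B1 m x + a2 *\<^sub>R bivec B2 m x = 0} \<le> 1"
      using m by (simp add: U_def bivecQ)
    show ?thesis
    proof (rule kronecker_normal_form[OF linear_bivec linear_bivec B1.bivec_skew[OF mO] B2.bivec_skew[OF mO]
          assms(6) cont[OF mO] ker[OF _ mO] half[OF mN] cork])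
      fix k and w :: "nat \<Rightarrow> 'e"
      assume k: "1 \<le> k" "DIM('e) = 2 * k - 1" and w: "indep_family {..<2 * k - 1} w"
        and r1: "\<And>i j. i < 2 * k - 1 \<Longrightarrow> j < 2 * k - 1 \<Longrightarrow>
          bivec B1 m (w i) \<bullet> w j = (if even i \<and> j = Suc i then 1 else if even j \<and> i = Suc j then - 1 else 0)"
        and r2: "\<And>i j. i < 2 * k - 1 \<Longrightarrow> j < 2 * k - 1 \<Longrightarrow>
          bivec B2 m (w i) \<bullet> w j = (if odd i \<and> j = Suc i then 1 else if odd j \<and> i = Suc j then - 1 else 0)"
      define K where "K = k - 1"
      have n: "2 * k - 1 = Suc (2 * K)" using k(1) by (simp add: K_def)
      have "pair_isomorphic (cotangent_pair X A B1 B2 m) (direct_sum_pairs [kronecker_pair (Suc K)])"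
        by (rule cotangent_pair_isomorphic[OF assms(3,4) mO k(2)[unfolded n] w[unfolded n] r1[unfolded n] r2[unfolded n]])
      then show ?thesis using k(2) n by auto
    qed
  qed
  \<comment> \<open>The parity of the dimension is read off at one point, and the closure property
    guarantees that \<open>U\<close> has one.\<close>
  obtain m where "m \<in> U" using dense[OF openin_topspace assms(10)] by blast
  then obtain K where K: "DIM('e) = Suc (2 * K)" using normal by blast
  have "homogeneous_on X A B1 B2 U [DIM('e)]"
    unfolding homogeneous_on_def
  proof (intro exI[of _ "[Suc K]"] conjI ballI)
    fix m assume "m \<in> U"
    then obtain K' where K': "DIM('e) = Suc (2 * K')"
      "pair_isomorphic (cotangent_pair X A B1 B2 m) (direct_sum_pairs [kronecker_pair (Suc K')])" using normal by blast
    \<comment> \<open>The block size is fixed by the dimension, so the type is the same at all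
      points of \<open>U\<close>.\<close>
    then have "K' = K" using K by simp
    then show "pair_isomorphic (cotangent_pair X A B1 B2 m) (direct_sum_pairs (map kronecker_pair [Suc K]))"
      using K'(2) by simp
  qed (use K in auto)
  then show ?thesis using K \<open>openin X U\<close> clos by auto
qed

end
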